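(* Let $X$ be a pure-jump isotropic Lévy process in $\mathbb{R}^d$ with characteristic exponent $\psi$. Assume its Lévy measure is infinite and has a density $\nu(x)=\nu(|x|)$ such that $\nu(r)$ is nonincreasing and absolutely continuous on $(0,\infty)$ and $-\nu'(r)/r$ is nonincreasing. Denote the transition densities of $X$ by $p_t(x)=p_t(|x|)$. Then there exists a Lévy process $X^{(d+2)}$ in $\mathbb{R}^{d+2}$ with characteristic exponent $\psi^{(d+2)}(\xi)=\psi(|\xi|)$, $\xi\in\mathbb{R}^{d+2}$, and radial, radially nonincreasing transition densities $p_t^{(d+2)}(x)=p_t^{(d+2)}(|x|)$ satisfying $$p_t^{(d+2)}(r)=\frac{-1}{2\pi r}\frac{d}{dr}p_t(r),\qquad r>0.$$ Moreover $p_t^{(d+2)}$ is continuous at every $x\ne0$.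
   Context: The characteristic exponent $\psi$ is defined by $E^0e^{i\xi\cdot X_t}=e^{-t\psi(\xi)}$; since $X$ is isotropic, $\psi$ is radial and $\psi(r)$ denotes $\psi(\xi)$ for $|\xi|=r$. $\nu'$ denotes the function with $\nu(r)=-\int_r^\infty\nu'(\rho)\,d\rho$ for $r>0$.
   Formalization: The transition densities p_t of X are taken in the version that is continuous in r on (0,∞); for an arbitrary version (densities are fixed only up to null sets) the pointwise derivative of p_t need not exist. *)

theory Defs
  imports "HOL-Probability.Probability"
begin

text \<open>A Levy process (Sato, Def. 1.6) with values in a Euclidean space, indexed by
  time t \<ge> 0: X_0 = 0 a.s., independent increments, stationary increments,
  stochastic continuity, and almost surely cadlag paths.\<close>

definition levy_process :: "'w measure \<Rightarrow> (real \<Rightarrow> 'w \<Rightarrow> 'a::euclidean_space) \<Rightarrow> bool" where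
  "levy_process M X \<longleftrightarrow>
     prob_space M \<and>
     (\<forall>t\<ge>0. X t \<in> borel_measurable M) \<and>
     (AE \<omega> in M. X 0 \<omega> = 0) \<and>
     (\<forall>(n::nat) (s::nat \<Rightarrow> real). 0 \<le> s 0 \<and> (\<forall>i<n. s i < s (Suc i)) \<longrightarrow>
        prob_space.indep_vars M (\<lambda>_. borel)
          (\<lambda>i \<omega>. if i = 0 then X (s 0) \<omega> else X (s i) \<omega> - X (s (i - 1)) \<omega>) {0..n}) \<and>
     (\<forall>s t. 0 \<le> s \<and> s \<le> t \<longrightarrow>
        distr M borel (\<lambda>\<omega>. X t \<omega> - X s \<omega>) = distr M borel (X (t - s))) \<and>
     (\<forall>t\<ge>0. \<forall>e>0. ((\<lambda>s. measure M {\<omega>\<in>space M. norm (X s \<omega> - X t \<omega>) > e}) \<longlongrightarrow> 0)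
        (at t within {0..})) \<and>
     (AE \<omega> in M. (\<forall>t\<ge>0. ((\<lambda>s. X s \<omega>) \<longlongrightarrow> X t \<omega>) (at_right t)) \<and>
                  (\<forall>t>0. \<exists>l. ((\<lambda>s. X s \<omega>) \<longlongrightarrow> l) (at_left t)))"

definition char_fun_at :: "'w measure \<Rightarrow> (real \<Rightarrow> 'w \<Rightarrow> 'a::euclidean_space) \<Rightarrow> real \<Rightarrow> 'a \<Rightarrow> complex" where
  "char_fun_at M X t \<xi> = (\<integral>\<omega>. cis (\<xi> \<bullet> X t \<omega>) \<partial>M)"

end

theory Submission
  imports Defs
begin

text \<open>
  The function \<open>v r = - \<nu>' r / (2 * pi * r)\<close> is a radially nonincreasing Levy density in dimension \<open>d + 2\<close> whose
  projection to dimension \<open>d\<close> (integration over a plane, in polar coordinates) is \<open>\<nu>\<close>; by rotation invariance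
  its exponent is \<open>\<psi>\<close>. The process is a sum of independent compound Poisson processes with jump densities cut out of
  \<open>v\<close> by levels; an Ottaviani inequality and the Borel-Cantelli lemma make the sum converge locally uniformly, which
  gives cadlag paths, and its increments are identified by their joint characteristic function.

  Each compound Poisson law is unimodal because a convolution of radially decreasing functions is radially decreasing;
  hence the measure of a ball under the law of \<open>X' t\<close> decreases with the distance of the ball from the origin. This
  bounds the law by Lebesgue measure away from \<open>0\<close>, and there is no atom at \<open>0\<close> because the projection has a
  density. The convolution of the density at time \<open>t / 2\<close> with itself is continuous off the origin.
  Finally \<open>p t r\<close> is the integral of \<open>2 * pi * u * q t u\<close> over \<open>u \<ge> r\<close>, again by polar coordinates, and can be
  differentiated in \<open>r\<close>.
\<close>

text \<open>The factor 2 pi r has one source: a radial function with profile G, integrated over a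
  plane at distance r from the origin, gives the integral of 2 pi u G(u) over u \<ge> r. For Levy
  densities this relates \<open>v\<close> to \<open>\<nu>\<close>, for laws it relates
  \<open>q t\<close> to \<open>p t\<close>; in both cases differentiation undoes it.

  The obstacle is regularity. The compound Poisson approximations have visibly decreasing profiles,
  but a density need not survive the passage to the limit. Masses of closed balls do survive, which
  is why unimodality occurs in two forms: with test functions, suited to sums, and with balls,
  suited to limits. A density recovered from ball masses is defined only almost everywhere and may
  be unbounded at the origin, so convolving two halves of the time interval serves to produce a
  continuous version.

  A second difficulty is that the law of \<open>X t\<close> determines only the nonnegative part of
  \<open>p t\<close>. Identifying \<open>p t\<close> everywhere needs a strictly positive tail, and
  this comes from the fact that a Levy process bounded at one positive time has zero
  exponent.\<close>

section \<open>Lebesgue measure under isometries and Gaussian smoothing\<close>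

text \<open>Uniqueness of the translation invariant measure, by Fubini; the constant is read off the unit balls,
  whose volume depends on the dimension only.\<close>

lemma distr_lborel_isometry:
  fixes T :: "'b::euclidean_space \<Rightarrow> 'c::euclidean_space"
  assumes lin: "linear T" and iso: "\<And>x. norm (T x) = norm x" and dim: "DIM('b) = DIM('c)"
  shows "distr lborel borel T = lborel"
proof (rule measure_eqI)
  show "sets (distr lborel borel T) = sets lborel" by simp
next
  fix A assume "A \<in> sets (distr lborel borel T)"
  then have A[measurable]: "A \<in> sets borel" by simp
  interpret T: linear T by fact
  have ballm[measurable]: "ball (0::'c) 1 \<in> sets borel" by (rule borel_open) simp
  have Tm[measurable]: "T \<in> borel_measurable borel"
    using lin by (simp add: borel_measurable_continuous_onI linear_continuous_on linear_conv_bounded_linear)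
  have inj: "inj T"
    using iso by (auto simp: inj_on_def) (metis T.diff eq_iff_diff_eq_0 norm_eq_zero)
  have surj: "surj T"
  proof -
    have "dim (range T) = DIM('b)" using dim_image_eq[OF lin, of UNIV] inj by (simp add: dim_UNIV)
    moreover have "span (range T) = range T"
      using linear_subspace_image[OF lin subspace_UNIV] by (simp add: span_eq_iff)
    ultimately show ?thesis using dim dim_eq_full[of "range T"] by simp
  qed
  let ?V = "ennreal (unit_ball_vol (real DIM('c)))"
  have V: "?V \<noteq> 0" "?V \<noteq> \<infinity>" by (auto simp: ennreal_eq_0_iff not_le)
  have inner1: "(\<integral>\<^sup>+x. indicator A (T x + y) \<partial>lborel) = emeasure (distr lborel borel T) A" for y
  proof -
    obtain w where w: "T w = y" using surj by (metis surjD)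
    have "(\<integral>\<^sup>+x. indicator A (T x + y) \<partial>lborel) = (\<integral>\<^sup>+x. indicator A (T (w + x)) \<partial>lborel)"
      by (simp add: T.add w add.commute)
    also have "\<dots> = (\<integral>\<^sup>+x. indicator A (T x) \<partial>distr lborel borel ((+) w))"
      by (subst nn_integral_distr) auto
    also have "\<dots> = (\<integral>\<^sup>+x. indicator A (T x) \<partial>lborel)" by (simp add: lborel_distr_plus)
    also have "\<dots> = (\<integral>\<^sup>+x. indicator A x \<partial>distr lborel borel T)"
      by (subst nn_integral_distr) auto
    finally show ?thesis by simp
  qed
  have inner2: "(\<integral>\<^sup>+x. indicator (ball 0 1) (y - T x) \<partial>lborel) = ?V" for y
  proof -
    obtain w where w: "T w = y" using surj by (metis surjD)
    have "indicator (ball 0 1) (y - T x) = (indicator (ball w 1) x :: ennreal)" for x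
      using iso[of "w - x"] w by (auto simp: indicator_def dist_norm T.diff norm_minus_commute)
    then have "(\<integral>\<^sup>+x. indicator (ball 0 1) (y - T x) \<partial>lborel) = emeasure lborel (ball w 1)" by simp
    then show ?thesis by (simp add: emeasure_ball dim)
  qed
  have shift: "(\<integral>\<^sup>+y. indicator A (T x + y) * indicator (ball 0 1) y \<partial>lborel)
      = (\<integral>\<^sup>+y. indicator A y * indicator (ball 0 1) (y - T x) \<partial>lborel)" for x
  proof -
    have m: "(\<lambda>y. indicator (ball 0 1) (y - T x) :: ennreal) \<in> borel_measurable borel"
      by (rule measurable_compose[of "\<lambda>y. y - T x" _ borel]) (auto intro!: borel_measurable_indicator borel_open)
    have "(\<integral>\<^sup>+y. indicator A y * indicator (ball 0 1) (y - T x) \<partial>distr lborel borel ((+) (T x)))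
        = (\<integral>\<^sup>+y. indicator A (T x + y) * indicator (ball 0 1) y \<partial>lborel)"
      by (subst nn_integral_distr) (auto intro!: nn_integral_cong borel_measurable_times_ennreal m borel_measurable_indicator A)
    then show ?thesis by (simp add: lborel_distr_plus)
  qed
  have "emeasure (distr lborel borel T) A * ?V
      = (\<integral>\<^sup>+y. emeasure (distr lborel borel T) A * indicator (ball (0::'c) 1) y \<partial>lborel)"
    by (simp add: nn_integral_cmult_indicator emeasure_ball)
  also have "\<dots> = (\<integral>\<^sup>+y. (\<integral>\<^sup>+x. indicator A (T x + y) * indicator (ball 0 1) y \<partial>lborel) \<partial>lborel)"
    by (simp add: nn_integral_multc inner1)
  also have "\<dots> = (\<integral>\<^sup>+x. (\<integral>\<^sup>+y. indicator A (T x + y) * indicator (ball 0 1) y \<partial>lborel) \<partial>lborel)"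
    by (rule lborel_pair.Fubini') measurable
  also have "\<dots> = (\<integral>\<^sup>+x. (\<integral>\<^sup>+y. indicator A y * indicator (ball 0 1) (y - T x) \<partial>lborel) \<partial>lborel)"
    by (simp add: shift)
  also have "\<dots> = (\<integral>\<^sup>+y. (\<integral>\<^sup>+x. indicator A y * indicator (ball 0 1) (y - T x) \<partial>lborel) \<partial>lborel)"
    by (rule lborel_pair.Fubini') measurable
  also have "\<dots> = (\<integral>\<^sup>+y. indicator A y * ?V \<partial>lborel)"
    by (simp add: nn_integral_cmult inner2)
  also have "\<dots> = emeasure lborel A * ?V" by (simp add: nn_integral_multc)
  finally show "emeasure (distr lborel borel T) A = emeasure lborel A"
    using V by (metis ennreal_mult_cancel_left infinity_ennreal_def mult.commute)
qed

lemma nn_integral_lborel_isometry: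
  fixes T :: "'b::euclidean_space \<Rightarrow> 'c::euclidean_space"
  assumes "linear T" "\<And>x. norm (T x) = norm x" "DIM('b) = DIM('c)"
    and [measurable]: "f \<in> borel_measurable borel"
  shows "(\<integral>\<^sup>+x. f (T x) \<partial>lborel) = (\<integral>\<^sup>+x. f x \<partial>lborel)"
proof -
  have [measurable]: "T \<in> borel_measurable borel"
    using assms(1) by (simp add: borel_measurable_continuous_onI linear_continuous_on linear_conv_bounded_linear)
  show ?thesis
    by (subst distr_lborel_isometry[OF assms(1-3), symmetric], subst nn_integral_distr) auto
qed

lemma integral_lborel_isometry:
  fixes T :: "'b::euclidean_space \<Rightarrow> 'c::euclidean_space" and f :: "'c \<Rightarrow> 'd::{banach,second_countable_topology}"
  assumes "linear T" "\<And>x. norm (T x) = norm x" "DIM('b) = DIM('c)"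
    and [measurable]: "f \<in> borel_measurable borel"
  shows "(\<integral>x. f (T x) \<partial>lborel) = (\<integral>x. f x \<partial>lborel)"
proof -
  have [measurable]: "T \<in> borel_measurable borel"
    using assms(1) by (simp add: borel_measurable_continuous_onI linear_continuous_on linear_conv_bounded_linear)
  show ?thesis
    by (subst distr_lborel_isometry[OF assms(1-3), symmetric], subst integral_distr) auto
qed

lemma integral_lborel_uminus:
  fixes f :: "'c::euclidean_space \<Rightarrow> 'd::{banach,second_countable_topology}"
  assumes [measurable]: "f \<in> borel_measurable borel"
  shows "(\<integral>x. f (- x) \<partial>lborel) = (\<integral>x. f x \<partial>lborel)"
  by (rule integral_lborel_isometry) (auto intro: linear_uminus)

lemma norm2_eq_sum_Basis: "(norm (x::'a::euclidean_space))\<^sup>2 = (\<Sum>b\<in>Basis. (x \<bullet> b)\<^sup>2)"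
  unfolding power2_norm_eq_inner by (subst euclidean_inner) (simp add: power2_eq_square)

text \<open>Built from independent coordinates, so that its characteristic function is a product and
  its second moment a sum over the basis.\<close>

definition gauss :: "'a::euclidean_space measure" where
  "gauss = distr (PiM Basis (\<lambda>_. std_normal_distribution)) borel (\<lambda>\<omega>. \<Sum>b\<in>Basis. \<omega> b *\<^sub>R b)"

lemma sets_gauss[simp, measurable_cong]: "sets gauss = sets borel"
  and space_gauss[simp]: "space gauss = UNIV"
  by (auto simp: gauss_def)

interpretation std_normal_prod: product_prob_space "\<lambda>_::'a::euclidean_space. std_normal_distribution" Basis
  by (intro product_prob_spaceI real_distribution.axioms(1)[OF real_dist_normal_dist])

lemma measurable_gauss_embed[measurable]:
  "(\<lambda>\<omega>. \<Sum>b\<in>Basis. \<omega> b *\<^sub>R b) \<in> PiM (Basis::'a::euclidean_space set) (\<lambda>_. std_normal_distribution) \<rightarrow>\<^sub>M borel"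
  by (intro borel_measurable_sum borel_measurable_scaleR measurable_component_singleton[THEN measurable_compose]) auto

interpretation gauss: prob_space "gauss :: 'a::euclidean_space measure"
  unfolding gauss_def by (rule std_normal_prod.prob_space_distr) measurable

lemma char_gauss: "(\<integral>x. cis (\<xi> \<bullet> x) \<partial>gauss) = complex_of_real (exp (- (norm \<xi>)\<^sup>2 / 2))"
proof -
  have *: "cis (\<xi> \<bullet> (\<Sum>b\<in>Basis. \<omega> b *\<^sub>R b)) = (\<Prod>b\<in>Basis. iexp ((\<xi> \<bullet> b) * \<omega> b))" for \<omega> :: "'a \<Rightarrow> real"
    by (subst exp_sum[symmetric])
      (auto simp: cis_conv_exp inner_sum_right sum_distrib_left mult_ac intro!: arg_cong[where f=exp])
  have sm: "sets (std_normal_distribution) = sets borel" by simp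
  have i: "integrable std_normal_distribution (\<lambda>x. iexp (c * x))" for c
    by (intro finite_measure.integrable_const_bound[where B=1]
        prob_space.finite_measure real_distribution.axioms(1)[OF real_dist_normal_dist]) auto
  have "(\<integral>x. cis (\<xi> \<bullet> x) \<partial>gauss) = (\<integral>\<omega>. (\<Prod>b\<in>Basis. iexp ((\<xi> \<bullet> b) * \<omega> b)) \<partial>PiM Basis (\<lambda>_. std_normal_distribution))"
    unfolding gauss_def by (subst integral_distr) (auto simp: * intro!: borel_measurable_continuous_onI continuous_intros)
  also have "\<dots> = (\<Prod>b\<in>Basis. char std_normal_distribution (\<xi> \<bullet> b))"
    unfolding char_def by (rule std_normal_prod.product_integral_prod) (simp, rule i)
  also have "\<dots> = complex_of_real (\<Prod>b\<in>Basis. exp (- ((\<xi> \<bullet> b)\<^sup>2) / 2))"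
    by (simp add: char_std_normal_distribution)
  also have "(\<Prod>b\<in>Basis. exp (- ((\<xi> \<bullet> b)\<^sup>2) / 2)) = exp (- (norm \<xi>)\<^sup>2 / 2)"
    by (subst exp_sum[symmetric], simp)
      (simp add: sum_divide_distrib[symmetric] sum_negf norm2_eq_sum_Basis)
  finally show ?thesis .
qed

lemma integrable_gauss_norm2: "integrable (gauss :: 'a::euclidean_space measure) (\<lambda>x. (norm x)\<^sup>2)"
proof -
  have 1: "integrable std_normal_distribution (\<lambda>x. x\<^sup>2)"
    using integrable_std_normal_moment[of 2] by (subst integrable_density) auto
  have 2: "integrable (PiM (Basis::'a set) (\<lambda>_. std_normal_distribution)) (\<lambda>\<omega>. (\<omega> b)\<^sup>2)" if b: "b \<in> Basis" for b
  proof -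
    have "integrable (distr (PiM (Basis::'a set) (\<lambda>_. std_normal_distribution)) std_normal_distribution (\<lambda>\<omega>. \<omega> b)) (\<lambda>x. x\<^sup>2)"
      using 1 std_normal_prod.PiM_component[OF b] by simp
    then show ?thesis by (rule integrable_distr[rotated]) (use b in measurable)
  qed
  have 3: "(norm (\<Sum>b\<in>Basis. \<omega> b *\<^sub>R b :: 'a))\<^sup>2 = (\<Sum>b\<in>Basis. (\<omega> b)\<^sup>2)" for \<omega>
    by (simp add: norm2_eq_sum_Basis)
  show ?thesis
    unfolding gauss_def by (subst integrable_distr_eq) (auto simp: 3 intro!: Bochner_Integration.integrable_sum 2)
qed

lemma integrable_exp_norm2: "integrable (lborel :: 'a::euclidean_space measure) (\<lambda>x. exp (- (norm x)\<^sup>2 / 2))"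
proof -
  have 1: "exp (- (norm x)\<^sup>2 / 2) = (\<Prod>b\<in>Basis. exp (- ((x \<bullet> b)\<^sup>2) / 2))" for x :: 'a
    by (subst exp_sum[symmetric], simp)
      (simp add: sum_divide_distrib[symmetric] sum_negf norm2_eq_sum_Basis)
  have 2: "(\<integral>\<^sup>+x. ennreal (exp (- (x\<^sup>2) / 2)) \<partial>lborel) < \<infinity>"
  proof -
    have "integrable lborel (\<lambda>x. sqrt (2 * pi) * std_normal_density x)"
      using integrable_std_normal_moment[of 0] by simp
    then have "integrable lborel (\<lambda>x::real. exp (- (x\<^sup>2) / 2))"
      by (simp add: std_normal_density_def)
    then show ?thesis by (simp add: integrable_iff_bounded)
  qed
  have "(\<integral>\<^sup>+x. ennreal (exp (- (norm (x::'a))\<^sup>2 / 2)) \<partial>lborel)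
      = (\<integral>\<^sup>+x. (\<Prod>b\<in>Basis. ennreal (exp (- ((x \<bullet> (b::'a))\<^sup>2) / 2))) \<partial>lborel)"
    by (simp only: 1 prod_ennreal exp_ge_zero)
  also have "\<dots> = (\<Prod>b\<in>(Basis::'a set). (\<integral>\<^sup>+x. ennreal (exp (- (x\<^sup>2) / 2)) \<partial>lborel))"
    by (rule nn_integral_lborel_prod) auto
  also have "\<dots> < \<infinity>" using 2 by (simp add: power_less_top_ennreal)
  finally show ?thesis by (simp add: integrable_iff_bounded)
qed

text \<open>Writing the Gaussian as its own characteristic function shows that the left-hand side depends on \<open>Y\<close>
  only through the (weighted) characteristic function.\<close>

lemma char_weighted_gauss_smooth:
  fixes Y :: "'w \<Rightarrow> 'a::euclidean_space" and W :: "'w \<Rightarrow> complex"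
  assumes "prob_space M" and [measurable]: "Y \<in> borel_measurable M" "W \<in> borel_measurable M"
    and W: "\<And>w. norm (W w) \<le> B"
  shows "(\<integral>w. W w * complex_of_real (exp (- (norm (c *\<^sub>R (Y w - y)))\<^sup>2 / 2)) \<partial>M)
       = (\<integral>g. cis (- c * (g \<bullet> y)) * (\<integral>w. W w * cis ((c *\<^sub>R g) \<bullet> Y w) \<partial>M) \<partial>gauss)"
proof -
  interpret M: prob_space M by fact
  interpret P: pair_prob_space M "gauss :: 'a measure" ..
  have [measurable]: "cis \<in> borel_measurable borel"
    by (intro borel_measurable_continuous_onI continuous_intros)
  have B: "0 \<le> B" using W[of undefined] norm_ge_zero order_trans by blast
  have "(\<integral>w. W w * complex_of_real (exp (- (norm (c *\<^sub>R (Y w - y)))\<^sup>2 / 2)) \<partial>M)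
      = (\<integral>w. (\<integral>g. W w * cis ((c *\<^sub>R (Y w - y)) \<bullet> g) \<partial>gauss) \<partial>M)"
    by (simp only: char_gauss[symmetric] integral_mult_right_zero)
  also have "\<dots> = (\<integral>g. (\<integral>w. W w * cis ((c *\<^sub>R (Y w - y)) \<bullet> g) \<partial>M) \<partial>gauss)"
    by (rule P.Fubini_integral[symmetric])
      (rule P.P.integrable_const_bound[where B=B], auto simp: norm_mult W)
  also have "\<dots> = (\<integral>g. (\<integral>w. cis (- c * (g \<bullet> y)) * (W w * cis ((c *\<^sub>R g) \<bullet> Y w)) \<partial>M) \<partial>gauss)"
    by (intro Bochner_Integration.integral_cong refl)
      (simp add: cis_mult mult_ac inner_diff_left inner_commute algebra_simps)
  finally show ?thesis by (simp only: integral_mult_right_zero)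
qed

text \<open>Since exp (-1/2) \<le> 2/3, three times 1 - exp (- |y|^2 / 2) is at least 1 once |y|
  \<ge> 1. The expectation of this function of Y / e is a Gaussian average of 1 -
  \<open>\<phi>\<close>, so the tail is controlled by the distance of the characteristic function
  from 1.\<close>

lemma prob_norm_ge_le_char:
  fixes Y :: "'w \<Rightarrow> 'a::euclidean_space"
  assumes "prob_space M" and [measurable]: "Y \<in> borel_measurable M" and e: "0 < e"
    and ch: "\<And>\<xi>. (\<integral>w. cis (\<xi> \<bullet> Y w) \<partial>M) = complex_of_real (\<phi> \<xi>)"
  shows "measure M {w\<in>space M. e \<le> norm (Y w)} \<le> 3 * (\<integral>g. 1 - \<phi> (g /\<^sub>R e) \<partial>gauss)"
proof -
  interpret M: prob_space M by fact
  have [measurable]: "cis \<in> borel_measurable borel"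
    by (intro borel_measurable_continuous_onI continuous_intros)
  have "(\<lambda>\<xi>. Re (\<integral>w. cis (\<xi> \<bullet> Y w) \<partial>M)) \<in> borel_measurable borel" by measurable
  then have phm[measurable]: "\<phi> \<in> borel_measurable borel" by (simp add: ch)
  have ph1: "\<bar>\<phi> \<xi>\<bar> \<le> 1" for \<xi>
  proof -
    have "\<bar>\<phi> \<xi>\<bar> = norm (\<integral>w. cis (\<xi> \<bullet> Y w) \<partial>M)" by (simp add: ch)
    also have "\<dots> \<le> (\<integral>w. norm (cis (\<xi> \<bullet> Y w)) \<partial>M)" by (rule integral_norm_bound)
    finally show ?thesis by (simp add: M.prob_space)
  qed
  have "complex_of_real (\<integral>w. exp (- (norm (Y w /\<^sub>R e))\<^sup>2 / 2) \<partial>M) = complex_of_real (\<integral>g. \<phi> (g /\<^sub>R e) \<partial>gauss)"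
    using char_weighted_gauss_smooth[OF \<open>prob_space M\<close>, of Y "\<lambda>_. 1" 1 "inverse e" 0]
    using ch[of "g /\<^sub>R e" for g] by simp
  then have eq: "(\<integral>w. exp (- (norm (Y w /\<^sub>R e))\<^sup>2 / 2) \<partial>M) = (\<integral>g. \<phi> (g /\<^sub>R e) \<partial>gauss)"
    by (simp only: of_real_eq_iff)
  have i1: "integrable M (\<lambda>w. exp (- (norm (Y w /\<^sub>R e))\<^sup>2 / 2))"
    by (rule M.integrable_const_bound[where B=1]) auto
  have i2: "integrable gauss (\<lambda>g::'a. \<phi> (g /\<^sub>R e))"
    by (rule gauss.integrable_const_bound[where B=1]) (auto simp: ph1)
  have ehalf: "exp (- 1 / 2 :: real) \<le> 2 / 3"
  proof -
    have "1 + 1/2 \<le> exp (1/2 :: real)" by (rule exp_ge_add_one_self)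
    then show ?thesis by (simp add: exp_minus field_simps)
  qed
  have "measure M {w\<in>space M. e \<le> norm (Y w)} = (\<integral>w. indicator {w\<in>space M. e \<le> norm (Y w)} w \<partial>M)"
    by simp
  also have "\<dots> \<le> (\<integral>w. 3 * (1 - exp (- (norm (Y w /\<^sub>R e))\<^sup>2 / 2)) \<partial>M)"
  proof (rule integral_mono)
    fix w
    show "indicator {w\<in>space M. e \<le> norm (Y w)} w \<le> 3 * (1 - exp (- (norm (Y w /\<^sub>R e))\<^sup>2 / 2))"
    proof (cases "e \<le> norm (Y w)")
      case True
      then have "1 \<le> norm (Y w /\<^sub>R e)" using e by (simp add: field_simps)
      then have "1 \<le> (norm (Y w /\<^sub>R e))\<^sup>2" by simp
      then have "exp (- (norm (Y w /\<^sub>R e))\<^sup>2 / 2) \<le> exp (- 1/2)" by (subst exp_le_cancel_iff) linarith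
      then have "exp (- (norm (Y w /\<^sub>R e))\<^sup>2 / 2) \<le> 2 / 3" using ehalf by (rule order_trans)
      then have "1 \<le> 3 * (1 - exp (- (norm (Y w /\<^sub>R e))\<^sup>2 / 2))" by (simp only: algebra_simps)
      then show ?thesis by (rule order_trans[OF indicator_le_1])
    qed (auto simp: indicator_def)
  next
    show "integrable M (indicator {w\<in>space M. e \<le> norm (Y w)} :: _ \<Rightarrow> real)"
      by (rule M.integrable_const_bound[where B=1]) (auto simp: indicator_def)
  qed (use i1 in auto)
  also have "\<dots> = 3 * (1 - (\<integral>w. exp (- (norm (Y w /\<^sub>R e))\<^sup>2 / 2) \<partial>M))"
    using i1 by (simp add: M.prob_space)
  also have "\<dots> = 3 * (\<integral>g. 1 - \<phi> (g /\<^sub>R e) \<partial>gauss)"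
    unfolding eq using i2 by (subst Bochner_Integration.integral_diff) (auto simp: gauss.prob_space[unfolded space_gauss])
  finally show ?thesis .
qed

section \<open>Uniqueness of characteristic functions\<close>

text \<open>Averaging \<open>f\<close> over a Gaussian kernel of width 1 / (n + 1) and exchanging
  integrals expresses the smoothed expectation through the left-hand sides of
  \<open>char_weighted_gauss_smooth\<close>, which the characteristic functions determine. Dominated
  convergence then removes the smoothing. Complex weights make room for further variables of a joint
  law.\<close>

lemma char_weighted_eq_continuous:
  fixes Y1 :: "'w \<Rightarrow> 'a::euclidean_space" and Y2 :: "'v \<Rightarrow> 'a"
    and W1 :: "'w \<Rightarrow> complex" and W2 :: "'v \<Rightarrow> complex"
  assumes M1: "prob_space M1" and Ym1[measurable]: "Y1 \<in> borel_measurable M1" and Wm1[measurable]: "W1 \<in> borel_measurable M1"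
    and W1: "\<And>w. norm (W1 w) \<le> B"
    and M2: "prob_space M2" and Ym2[measurable]: "Y2 \<in> borel_measurable M2" and Wm2[measurable]: "W2 \<in> borel_measurable M2"
    and W2: "\<And>w. norm (W2 w) \<le> B"
    and ch: "\<And>\<xi>. (\<integral>w. W1 w * cis (\<xi> \<bullet> Y1 w) \<partial>M1) = (\<integral>w. W2 w * cis (\<xi> \<bullet> Y2 w) \<partial>M2)"
    and f: "continuous_on UNIV f" and fb: "\<And>x. \<bar>f x :: real\<bar> \<le> C"
  shows "(\<integral>w. W1 w * complex_of_real (f (Y1 w)) \<partial>M1) = (\<integral>w. W2 w * complex_of_real (f (Y2 w)) \<partial>M2)"
proof -
  have fm[measurable]: "f \<in> borel_measurable borel" using f by (rule borel_measurable_continuous_onI)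
  let ?k = "\<lambda>z::'a. exp (- (norm z)\<^sup>2 / 2)"
  \<comment> \<open>Left unevaluated: K appears as a common factor of both sides and is cancelled at
    the end.\<close>
  define K where "K = (\<integral>z. ?k z \<partial>lborel)"
  have km: "?k \<in> borel_measurable borel" by measurable
  have Kpos: "K \<noteq> 0"
  proof
    assume "K = 0"
    then have "AE x in (lborel::'a measure). ?k x = 0"
      unfolding K_def using integrable_exp_norm2 by (subst (asm) integral_nonneg_eq_0_iff_AE) auto
    then have "AE x in (lborel::'a measure). False" by simp
    then show False 
      using AE_iff_measurable[of UNIV "lborel :: 'a measure" "\<lambda>_. False"] by simp
  qed
  have B: "0 \<le> B" using W1[of undefined] norm_ge_zero order_trans by blast
  have C: "0 \<le> C" using fb[of undefined] by linarith
  define h where "h n y = (\<integral>z. f (y + z /\<^sub>R real (Suc n)) * ?k z \<partial>lborel)" for n y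
  have hm[measurable]: "h n \<in> borel_measurable borel" for n unfolding h_def by measurable
  have hb: "\<bar>h n y\<bar> \<le> C * K" for n y
  proof -
    have "norm (h n y) \<le> (\<integral>z. C * ?k z \<partial>lborel)"
      unfolding h_def
    proof (rule Bochner_Integration.integral_norm_bound_integral)
      show c: "integrable lborel (\<lambda>z. C * ?k z)" using integrable_exp_norm2 by auto
      have le: "norm (f (y + z /\<^sub>R real (Suc n)) * ?k z) \<le> C * ?k z" for z
        using fb by (auto simp: abs_mult intro!: mult_right_mono)
      show "norm (f (y + z /\<^sub>R real (Suc n)) * ?k z) \<le> C * ?k z" for z by (rule le)
      show "integrable lborel (\<lambda>z. f (y + z /\<^sub>R real (Suc n)) * ?k z)"
        by (rule Bochner_Integration.integrable_bound[OF c])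
          (simp, intro AE_I2 order_trans[OF le], simp)
    qed
    then show ?thesis by (simp add: K_def)
  qed
  have hlim: "(\<lambda>n. h n y) \<longlonglongrightarrow> f y * K" for y
    unfolding h_def K_def integral_mult_right_zero[symmetric]
  proof (rule integral_dominated_convergence[where w="\<lambda>z. C * ?k z"])
    show "integrable lborel (\<lambda>z. C * ?k z)" using integrable_exp_norm2 by auto
    show "AE z in lborel. (\<lambda>n. f (y + z /\<^sub>R real (Suc n)) * ?k z) \<longlonglongrightarrow> f y * ?k z"
    proof (intro AE_I2 tendsto_intros)
      fix z :: 'a
      have "(\<lambda>n. y + z /\<^sub>R real (Suc n)) \<longlonglongrightarrow> y + 0 *\<^sub>R z"
        by (intro tendsto_intros LIMSEQ_inverse_real_of_nat)
      then show "(\<lambda>n. f (y + z /\<^sub>R real (Suc n))) \<longlonglongrightarrow> f y"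
        using f by (auto simp: continuous_on_eq_continuous_at isCont_def intro: isCont_tendsto_compose[of y f])
    qed
  qed (auto simp: abs_mult fb intro!: mult_right_mono)
  have swap: "(\<integral>w. W w * complex_of_real (h n (Y w)) \<partial>M)
      = (\<integral>x. complex_of_real (f x * real (Suc n) ^ DIM('a)) *
          (\<integral>w. W w * complex_of_real (?k (real (Suc n) *\<^sub>R (Y w - x))) \<partial>M) \<partial>lborel)"
    if pM: "prob_space M" and [measurable]: "Y \<in> borel_measurable M" "W \<in> borel_measurable M"
      and W: "\<And>w. norm (W w) \<le> B" for M :: "'z measure" and Y W n
  proof -
    interpret M: prob_space M by fact
    interpret P: pair_sigma_finite M "lborel :: 'a measure" ..
    let ?s = "real (Suc n)"
    let ?kk = "\<lambda>y x. ?s ^ DIM('a) * ?k (?s *\<^sub>R (y - x))"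
    \<comment> \<open>The substitution z = (n + 1) (x - y), with Jacobian (n + 1)^d, moves the
      dependence on y from \<open>f\<close> into the kernel.\<close>
    have aff: "(\<integral>z. F z \<partial>lborel) = (\<integral>x. ?s ^ DIM('a) * F (?s *\<^sub>R (x - y)) \<partial>lborel)"
      if [measurable]: "F \<in> borel_measurable borel" for F :: "'a \<Rightarrow> real" and y
      by (subst lborel_affine[of ?s "- (?s *\<^sub>R y)"], simp, subst integral_density)
        (simp_all add: integral_distr scaleR_diff_right)
    have kk: "(\<integral>x. ?kk y x \<partial>lborel) = K" for y
      unfolding K_def by (subst aff[of ?k y]) (auto simp: norm_minus_commute)
    \<comment> \<open>The Bochner integral of a nonintegrable function is 0 by convention, so the
      nonzero value K already proves integrability.\<close>
    have kki: "integrable lborel (?kk y)" for y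
      using Kpos kk[of y] not_integrable_integral_eq by fastforce
    have heq: "h n y = (\<integral>x. f x * ?kk y x \<partial>lborel)" for y
      unfolding h_def by (subst aff[of _ y]) (auto simp: norm_minus_commute mult_ac intro!: Bochner_Integration.integral_cong)
    have int1: "integrable lborel (\<lambda>x. W w * complex_of_real (f x * ?kk (Y w) x))" for w
      by (intro integrable_mult_right integrable_of_real Bochner_Integration.integrable_bound[OF integrable_mult_right[OF kki, of C "Y w"]])
        (auto simp: abs_mult intro!: mult_right_mono order_trans[OF fb])
    have int: "integrable (M \<Otimes>\<^sub>M lborel) (\<lambda>(w,x). W w * complex_of_real (f x * ?kk (Y w) x))"
    proof (rule P.Fubini_integrable)
      show "integrable M (\<lambda>w. \<integral>x. norm (case (w,x) of (w,x) \<Rightarrow> W w * complex_of_real (f x * ?kk (Y w) x)) \<partial>lborel)"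
      proof (rule M.integrable_const_bound[where B="B * C * K"])
        show "AE w in M. norm (\<integral>x. norm (case (w,x) of (w,x) \<Rightarrow> W w * complex_of_real (f x * ?kk (Y w) x)) \<partial>lborel) \<le> B * C * K"
        proof (intro AE_I2)
          fix w
          have "norm (\<integral>x. norm (W w * complex_of_real (f x * ?kk (Y w) x)) \<partial>lborel) \<le> (\<integral>x. B * C * ?kk (Y w) x \<partial>lborel)"
          proof (rule Bochner_Integration.integral_norm_bound_integral)
            show "integrable lborel (\<lambda>x. norm (W w * complex_of_real (f x * ?kk (Y w) x)))"
              using int1 by (rule integrable_norm)
            show "integrable lborel (\<lambda>x. B * C * ?kk (Y w) x)" using kki by (rule integrable_mult_right)
            show "norm (norm (W w * complex_of_real (f x * ?kk (Y w) x))) \<le> B * C * ?kk (Y w) x" for x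
            proof -
              have "\<bar>f x * ?kk (Y w) x\<bar> \<le> C * ?kk (Y w) x"
                unfolding abs_mult using fb[of x] by (intro mult_mono) auto
              then have "norm (W w) * \<bar>f x * ?kk (Y w) x\<bar> \<le> B * (C * ?kk (Y w) x)"
                using W[of w] B by (intro mult_mono) auto
              then show ?thesis by (simp only: norm_mult norm_of_real mult.assoc real_norm_def abs_mult abs_norm_cancel abs_abs)
            qed
          qed
          then show "norm (\<integral>x. norm (case (w,x) of (w,x) \<Rightarrow> W w * complex_of_real (f x * ?kk (Y w) x)) \<partial>lborel) \<le> B * C * K"
            using kk[of "Y w"] by simp
        qed
      qed measurable
      show "AE w in M. integrable lborel (\<lambda>x. case (w,x) of (w,x) \<Rightarrow> W w * complex_of_real (f x * ?kk (Y w) x))"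
        using int1 by simp
    qed measurable
    have "(\<integral>w. W w * complex_of_real (h n (Y w)) \<partial>M) = (\<integral>w. (\<integral>x. W w * complex_of_real (f x * ?kk (Y w) x) \<partial>lborel) \<partial>M)"
      by (simp only: heq integral_complex_of_real[symmetric] integral_mult_right_zero)
    also have "\<dots> = (\<integral>x. (\<integral>w. W w * complex_of_real (f x * ?kk (Y w) x) \<partial>M) \<partial>lborel)"
      by (rule P.Fubini_integral[symmetric, OF int])
    also have "\<dots> = (\<integral>x. (\<integral>w. complex_of_real (f x * real (Suc n) ^ DIM('a)) * (W w * complex_of_real (?k (?s *\<^sub>R (Y w - x)))) \<partial>M) \<partial>lborel)"
      by (intro Bochner_Integration.integral_cong refl) (simp add: mult_ac)
    finally show ?thesis by (simp only: integral_mult_right_zero)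
  qed
  have step: "(\<integral>w. W1 w * complex_of_real (?k (c *\<^sub>R (Y1 w - x))) \<partial>M1)
       = (\<integral>w. W2 w * complex_of_real (?k (c *\<^sub>R (Y2 w - x))) \<partial>M2)" for c x
    by (subst char_weighted_gauss_smooth[OF M1 Ym1 Wm1 W1], subst char_weighted_gauss_smooth[OF M2 Ym2 Wm2 W2])
      (simp only: ch)
  have lim: "(\<lambda>n. (\<integral>w. W w * complex_of_real (h n (Y w)) \<partial>M)) \<longlonglongrightarrow> (\<integral>w. W w * complex_of_real (f (Y w) * K) \<partial>M)"
    if pM: "prob_space M" and [measurable]: "Y \<in> borel_measurable M" "W \<in> borel_measurable M"
      and W: "\<And>w. norm (W w) \<le> B" for M :: "'z measure" and Y W
  proof (rule integral_dominated_convergence[where w="\<lambda>_. B * (C * K)"])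
    interpret prob_space M by fact
    show "integrable M (\<lambda>_. B * (C * K))" by simp
    show "AE w in M. (\<lambda>n. W w * complex_of_real (h n (Y w))) \<longlonglongrightarrow> W w * complex_of_real (f (Y w) * K)"
      by (intro AE_I2 tendsto_intros hlim)
    show "AE w in M. norm (W w * complex_of_real (h n (Y w))) \<le> B * (C * K)" for n
      using W hb B by (intro AE_I2) (auto simp: norm_mult intro!: mult_mono)
  qed measurable
  have "(\<integral>w. W1 w * complex_of_real (h n (Y1 w)) \<partial>M1) = (\<integral>w. W2 w * complex_of_real (h n (Y2 w)) \<partial>M2)" for n
    by (subst swap[OF M1], simp, simp, rule W1, subst swap[OF M2], simp, simp, rule W2, simp only: step)
  then have "(\<integral>w. W1 w * complex_of_real (f (Y1 w) * K) \<partial>M1) = (\<integral>w. W2 w * complex_of_real (f (Y2 w) * K) \<partial>M2)"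
    using lim[OF M1 Ym1 Wm1 W1] lim[OF M2 Ym2 Wm2 W2] by (auto intro: LIMSEQ_unique)
  then show ?thesis using Kpos
    by (simp add: mult.assoc[symmetric])
qed

text \<open>Closed sets form an intersection-stable generator, and the indicator of a nonempty one
  is the limit of the continuous functions max 0 (1 - n * \<open>infdist x A\<close>). Because the
  weights are complex, complements and disjoint unions are handled by linearity and dominated
  convergence instead of uniqueness of measures.\<close>

lemma char_weighted_eq_indicator:
  fixes Y1 :: "'w \<Rightarrow> 'a::euclidean_space" and Y2 :: "'v \<Rightarrow> 'a"
    and W1 :: "'w \<Rightarrow> complex" and W2 :: "'v \<Rightarrow> complex"
  assumes M1: "prob_space M1" and Ym1[measurable]: "Y1 \<in> borel_measurable M1" and Wm1[measurable]: "W1 \<in> borel_measurable M1"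
    and W1: "\<And>w. norm (W1 w) \<le> B"
    and M2: "prob_space M2" and Ym2[measurable]: "Y2 \<in> borel_measurable M2" and Wm2[measurable]: "W2 \<in> borel_measurable M2"
    and W2: "\<And>w. norm (W2 w) \<le> B"
    and ch: "\<And>\<xi>. (\<integral>w. W1 w * cis (\<xi> \<bullet> Y1 w) \<partial>M1) = (\<integral>w. W2 w * cis (\<xi> \<bullet> Y2 w) \<partial>M2)"
    and A: "A \<in> sets borel"
  shows "(\<integral>w. W1 w * indicator A (Y1 w) \<partial>M1) = (\<integral>w. W2 w * indicator A (Y2 w) \<partial>M2)"
proof -
  interpret M1: prob_space M1 by fact
  interpret M2: prob_space M2 by fact
  have B: "0 \<le> B" using W1[of undefined] norm_ge_zero order_trans by blast
  have i: "integrable M (\<lambda>w. W w * indicator A (Y w))"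
    if "prob_space M" and [measurable]: "Y \<in> borel_measurable M" "W \<in> borel_measurable M" "A \<in> sets borel"
      and W: "\<And>w. norm (W w :: complex) \<le> B" for M :: "'z measure" and Y :: "'z \<Rightarrow> 'a" and W A
  proof -
    interpret prob_space M by fact
    show ?thesis using B by (intro integrable_const_bound[where B=B]) (auto simp: norm_mult indicator_def W)
  qed
  have i1: "integrable M1 (\<lambda>w. W1 w * indicator A (Y1 w))" and i2: "integrable M2 (\<lambda>w. W2 w * indicator A (Y2 w))"
    if "A \<in> sets borel" for A
    using that by (auto intro!: i M1 M2 W1 W2)
  have "A \<in> sigma_sets UNIV (Collect closed)"
    using A by (simp add: borel_eq_closed)
  then show ?thesis
  proof (induction rule: sigma_sets_induct_disjoint[rotated 2, consumes 1, case_names basic empty compl union])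
    case (basic A)
    then have cl: "closed A" by simp
    then have [measurable]: "A \<in> sets borel" by simp
    show ?case
    \<comment> \<open>\<open>infdist x {}\<close> is 0 by convention, so for the empty set the
      approximating functions would be constantly 1.\<close>
    proof (cases "A = {}")
      case False
      let ?f = "\<lambda>n x. max 0 (1 - real n * infdist x A)"
      have lim: "(\<lambda>n. ?f n x) \<longlonglongrightarrow> indicator A x" for x
      proof (cases "x \<in> A")
        case True then show ?thesis by (simp)
      next
        case F: False
        then have d: "0 < infdist x A" using cl False
          by (metis in_closed_iff_infdist_zero infdist_nonneg less_eq_real_def)
        obtain N where N: "1 < real N * infdist x A" using d by (metis reals_Archimedean3)
        have "eventually (\<lambda>n. ?f n x = 0) sequentially"
          using eventually_ge_at_top[of N]
        proof eventually_elim
          case (elim n)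
          then have "real N * infdist x A \<le> real n * infdist x A" using d by (intro mult_right_mono) auto
          then show ?case using N by auto
        qed
        then show ?thesis using F by (simp add: tendsto_eventually)
      qed
      have L: "(\<lambda>n. (\<integral>w. W w * complex_of_real (?f n (Y w)) \<partial>M)) \<longlonglongrightarrow> (\<integral>w. W w * complex_of_real (indicator A (Y w)) \<partial>M)"
        if "prob_space M" and [measurable]: "Y \<in> borel_measurable M" "W \<in> borel_measurable M"
          and W: "\<And>w. norm (W w :: complex) \<le> B" for M :: "'z measure" and Y :: "'z \<Rightarrow> 'a" and W
      proof (rule integral_dominated_convergence[where w="\<lambda>_. B"])
        interpret prob_space M by fact
        show "integrable M (\<lambda>_. B)" by simp
        show "AE w in M. (\<lambda>n. W w * complex_of_real (?f n (Y w))) \<longlonglongrightarrow> W w * complex_of_real (indicator A (Y w))"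
          by (intro AE_I2 tendsto_intros lim)
        have "\<bar>?f n x\<bar> \<le> 1" for n x by (auto simp: infdist_nonneg)
        then have "norm (W w) * \<bar>?f n (Y w)\<bar> \<le> B * 1" for w n
          by (intro mult_mono W B) auto
        then show "AE w in M. norm (W w * complex_of_real (?f n (Y w))) \<le> B" for n
          by (intro AE_I2) (simp only: norm_mult norm_of_real mult_1_right)
        show "(\<lambda>w. W w * complex_of_real (indicator A (Y w))) \<in> borel_measurable M"
          by measurable
        have "(\<lambda>x. infdist x A) \<in> borel_measurable borel"
          by (intro borel_measurable_continuous_onI continuous_intros)
        then show "(\<lambda>w. W w * complex_of_real (?f n (Y w))) \<in> borel_measurable M" for n
          by measurable
      qed
      have "(\<integral>w. W1 w * complex_of_real (?f n (Y1 w)) \<partial>M1) = (\<integral>w. W2 w * complex_of_real (?f n (Y2 w)) \<partial>M2)" for n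
        by (rule char_weighted_eq_continuous[where B=B and C=1])
          (auto intro!: M1 M2 W1 W2 ch continuous_intros simp: infdist_nonneg)
      then have "(\<integral>w. W1 w * complex_of_real (indicator A (Y1 w)) \<partial>M1) = (\<integral>w. W2 w * complex_of_real (indicator A (Y2 w)) \<partial>M2)"
        using L[OF M1 Ym1 Wm1 W1] L[OF M2 Ym2 Wm2 W2] by (auto intro: LIMSEQ_unique)
      then show ?thesis by (simp add: of_real_indicator)
    qed simp
  next
    case empty then show ?case by simp
  next
    case (compl A)
    then have [measurable]: "A \<in> sets borel" by (simp add: borel_eq_closed)
    \<comment> \<open>Frequency 0 shows that the total weights agree, which the complement step
      requires.\<close>
    have U: "(\<integral>w. W1 w \<partial>M1) = (\<integral>w. W2 w \<partial>M2)" using ch[of 0] by simp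
    have e: "W w * indicator (UNIV - A) y = W w - W w * (indicator A y :: complex)" for W :: "'z \<Rightarrow> complex" and w and y :: 'a
      by (auto simp: indicator_def)
    show ?case unfolding e
      using i1[of UNIV] i2[of UNIV] i1[of A] i2[of A] compl.IH U by (simp add: Bochner_Integration.integral_diff)
  next
    case (union A)
    then have Am[measurable]: "A i \<in> sets borel" for i by (auto simp: borel_eq_closed)
    have S: "(\<lambda>i. \<integral>w. W w * indicator (A i) (Y w) \<partial>M) sums (\<integral>w. W w * indicator (\<Union>i. A i) (Y w) \<partial>M)"
        if pM: "prob_space M" and [measurable]: "Y \<in> borel_measurable M" "W \<in> borel_measurable M"
          and W: "\<And>w. norm (W w :: complex) \<le> B" for M :: "'z measure" and Y :: "'z \<Rightarrow> 'a" and W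
      unfolding sums_def
    proof -
      interpret prob_space M by fact
      have eq: "(\<Sum>i<n. \<integral>w. W w * indicator (A i) (Y w) \<partial>M) = (\<integral>w. W w * indicator (\<Union>i<n. A i) (Y w) \<partial>M)" for n
      proof -
        have "(\<Sum>i<n. W w * indicator (A i) (Y w)) = W w * indicator (\<Union>i<n. A i) (Y w)" for w
          by (subst indicator_UN_disjoint)
            (auto simp: sum_distrib_left intro: disjoint_family_on_mono[OF _ union.hyps(1)])
        note e = this
        have "(\<Sum>i<n. \<integral>w. W w * indicator (A i) (Y w) \<partial>M) = (\<integral>w. (\<Sum>i<n. W w * indicator (A i) (Y w)) \<partial>M)"
          by (rule Bochner_Integration.integral_sum[symmetric]) (rule i[OF pM _ _ _ W], auto)
        then show ?thesis by (simp only: e)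
      qed
      show "(\<lambda>n. \<Sum>i<n. \<integral>w. W w * indicator (A i) (Y w) \<partial>M) \<longlonglongrightarrow> (\<integral>w. W w * indicator (\<Union>i. A i) (Y w) \<partial>M)"
        unfolding eq
      proof (rule integral_dominated_convergence[where w="\<lambda>_. B"])
        show "AE w in M. (\<lambda>n. W w * indicator (\<Union>i<n. A i) (Y w)) \<longlonglongrightarrow> W w * indicator (\<Union>i. A i) (Y w)"
          by (intro AE_I2 tendsto_intros LIMSEQ_indicator_UN)
        show "AE w in M. norm (W w * indicator (\<Union>i<n. A i) (Y w)) \<le> B" for n
          using B by (intro AE_I2) (auto simp: norm_mult indicator_def W)
      
        show "integrable M (\<lambda>_. B)" by simp
        have [measurable]: "(\<Union>i. A i) \<in> sets borel" "(\<Union>i<n. A i) \<in> sets borel" for n by auto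
        show "random_variable borel (\<lambda>w. W w * indicator (\<Union>i. A i) (Y w))"
          "random_variable borel (\<lambda>w. W w * indicator (\<Union>i<n. A i) (Y w))" for n
          by measurable
      qed
    qed
    show ?case using S[OF M1 Ym1 Wm1 W1] S[OF M2 Ym2 Wm2 W2] union.IH
      by (auto intro: sums_unique2)
  qed (auto simp: Int_stable_def)
qed

lemma distr_eq_of_char_eq:
  fixes Y1 :: "'w \<Rightarrow> 'a::euclidean_space" and Y2 :: "'v \<Rightarrow> 'a"
  assumes M1: "prob_space M1" and Y1[measurable]: "Y1 \<in> borel_measurable M1"
    and M2: "prob_space M2" and Y2[measurable]: "Y2 \<in> borel_measurable M2"
    and ch: "\<And>\<xi>. (\<integral>w. cis (\<xi> \<bullet> Y1 w) \<partial>M1) = (\<integral>w. cis (\<xi> \<bullet> Y2 w) \<partial>M2)"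
  shows "distr M1 borel Y1 = distr M2 borel Y2"
proof (rule measure_eqI)
  fix A assume "A \<in> sets (distr M1 borel Y1)"
  then have A[measurable]: "A \<in> sets borel" by simp
  interpret M1: prob_space M1 by fact
  interpret M2: prob_space M2 by fact
  have e: "(\<integral>w. indicator A (Y w) \<partial>M) = complex_of_real (measure M (Y -` A \<inter> space M))"
    if [measurable]: "Y \<in> borel_measurable M" for M :: "'z measure" and Y :: "'z \<Rightarrow> 'a"
  proof -
    have "(\<integral>w. indicator A (Y w) \<partial>M) = (\<integral>w. complex_of_real (indicator (Y -` A \<inter> space M) w) \<partial>M)"
      by (intro Bochner_Integration.integral_cong refl) (auto simp: indicator_def)
    then show ?thesis by simp
  qed
  have "(\<integral>w. 1 * indicator A (Y1 w) \<partial>M1) = (\<integral>w. (1::complex) * indicator A (Y2 w) \<partial>M2)"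
    by (rule char_weighted_eq_indicator[where B=1]) (auto simp: M1 M2 ch A)
  then have "measure M1 (Y1 -` A \<inter> space M1) = measure M2 (Y2 -` A \<inter> space M2)"
    by (simp add: e)
  then show "emeasure (distr M1 borel Y1) A = emeasure (distr M2 borel Y2) A"
    by (simp add: emeasure_distr M1.emeasure_eq_measure M2.emeasure_eq_measure)
qed simp

text \<open>The exponentials are replaced by indicators one variable at a time; the weights in
  \<open>char_weighted_eq_indicator\<close> carry the remaining factors.\<close>

lemma (in prob_space) indep_vars_of_char:
  fixes Y :: "'i \<Rightarrow> 'a \<Rightarrow> 'b::euclidean_space"
  assumes I: "finite I" "I \<noteq> {}" and Ym: "\<And>i. i \<in> I \<Longrightarrow> Y i \<in> borel_measurable M"
    and ch: "\<And>\<eta>. (\<integral>w. (\<Prod>i\<in>I. cis (\<eta> i \<bullet> Y i w)) \<partial>M) = (\<Prod>i\<in>I. \<integral>w. cis (\<eta> i \<bullet> Y i w) \<partial>M)"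
  shows "indep_vars (\<lambda>_. borel) Y I"
proof -
  note Ym[measurable]
  have [measurable]: "cis \<in> borel_measurable borel"
    by (intro borel_measurable_continuous_onI continuous_intros)
  have key: "(\<integral>w. (\<Prod>i\<in>J. indicator (A i) (Y i w)) * (\<Prod>i\<in>I - J. cis (\<eta> i \<bullet> Y i w)) \<partial>M)
     = (\<Prod>i\<in>J. \<integral>w. indicator (A i) (Y i w) \<partial>M) * (\<Prod>i\<in>I - J. \<integral>w. cis (\<eta> i \<bullet> Y i w) \<partial>M)"
    if "finite J" "J \<subseteq> I" "\<And>i. A i \<in> sets borel" for J \<eta> and A :: "'i \<Rightarrow> 'b set"
    using that(1,2)
  proof (induction J arbitrary: \<eta>)
    case empty then show ?case by (simp add: ch)
  next
    case (insert j J)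
    note that(3)[measurable]
    have [measurable]: "Y i \<in> borel_measurable M" if "i \<in> J" for i using that insert.prems by (auto intro: Ym)
    have j[measurable]: "Y j \<in> borel_measurable M" using insert.prems by (auto intro: Ym)
    have IJ: "I - J = insert j (I - insert j J)" using insert by auto
    let ?W = "\<lambda>w. (\<Prod>i\<in>J. indicator (A i) (Y i w)) * (\<Prod>i\<in>I - insert j J. cis (\<eta> i \<bullet> Y i w))"
    let ?c = "(\<Prod>i\<in>J. \<integral>w. indicator (A i) (Y i w) \<partial>M) * (\<Prod>i\<in>I - insert j J. \<integral>w. cis (\<eta> i \<bullet> Y i w) \<partial>M)"
    have nW: "norm (?W w) \<le> 1" for w
      unfolding norm_mult prod_norm[symmetric]
      by (intro mult_le_one prod_le_1 prod_nonneg) (auto simp: indicator_def)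
    \<comment> \<open>Both sides live on M, the second one with the constant weight
      \<open>?c\<close>. The assumption on characteristic functions is then the induction hypothesis
      with frequency \<open>\<xi>\<close> at index \<open>j\<close>.\<close>
    have "(\<integral>w. ?W w * indicator (A j) (Y j w) \<partial>M) = (\<integral>w. ?c * indicator (A j) (Y j w) \<partial>M)"
    proof (rule char_weighted_eq_indicator[where B="max 1 (norm ?c)"])
      fix \<xi>
      have "(\<integral>w. ?W w * cis (\<xi> \<bullet> Y j w) \<partial>M) =
        (\<integral>w. (\<Prod>i\<in>J. indicator (A i) (Y i w)) * (\<Prod>i\<in>I - J. cis ((\<eta>(j := \<xi>)) i \<bullet> Y i w)) \<partial>M)"
        unfolding IJ using I by (intro Bochner_Integration.integral_cong refl) (auto simp: mult_ac intro!: prod.cong)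
      also have "\<dots> = (\<Prod>i\<in>J. \<integral>w. indicator (A i) (Y i w) \<partial>M) * (\<Prod>i\<in>I - J. \<integral>w. cis ((\<eta>(j := \<xi>)) i \<bullet> Y i w) \<partial>M)"
        using insert.prems by (intro insert.IH) auto
      also have "\<dots> = ?c * (\<integral>w. cis (\<xi> \<bullet> Y j w) \<partial>M)"
        unfolding IJ using I by (auto simp: mult_ac intro!: prod.cong)
      finally show "(\<integral>w. ?W w * cis (\<xi> \<bullet> Y j w) \<partial>M) = (\<integral>w. ?c * cis (\<xi> \<bullet> Y j w) \<partial>M)"
        by simp
    qed (use nW in \<open>auto simp: prob_space_axioms le_max_iff_disj\<close>)
    then show ?case using insert by (simp add: mult_ac)
  qed
  have e: "(\<integral>w. indicator A (Y i w) \<partial>M) = complex_of_real (prob (Y i -` A \<inter> space M))"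
    if "A \<in> sets borel" "i \<in> I" for A i
  proof -
    have "(\<integral>w. indicator A (Y i w) \<partial>M) = (\<integral>w. complex_of_real (indicator (Y i -` A \<inter> space M) w) \<partial>M)"
      by (intro Bochner_Integration.integral_cong refl) (auto simp: indicator_def)
    then show ?thesis using that by simp
  qed
  show ?thesis
  proof (subst indep_vars_finite[where E="\<lambda>_. sets borel"])
    show "\<forall>A\<in>I \<rightarrow> sets borel. prob (\<Inter>j\<in>I. Y j -` A j \<inter> space M) = (\<Prod>j\<in>I. prob (Y j -` A j \<inter> space M))"
    proof
      fix A' :: "'i \<Rightarrow> 'b set" assume A': "A' \<in> I \<rightarrow> sets borel"
      \<comment> \<open>\<open>A'\<close> takes Borel values on I only, while \<open>key\<close>
        asks for Borel sets at every index; off I the empty set is inserted.\<close>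
      define A where "A i = (if i \<in> I then A' i else {})" for i
      have A[measurable]: "A i \<in> sets borel" for i using A' by (auto simp: A_def)
      have "(\<integral>w. (\<Prod>i\<in>I. indicator (A i) (Y i w)) \<partial>M) = (\<Prod>i\<in>I. (\<integral>w. indicator (A i) (Y i w) \<partial>M :: complex))"
        using key[of I A "\<lambda>_. 0"] I A by simp
      also have "\<dots> = complex_of_real (\<Prod>i\<in>I. prob (Y i -` A i \<inter> space M))"
        by (simp add: e)
      also have "(\<integral>w. (\<Prod>i\<in>I. indicator (A i) (Y i w)) \<partial>M) = (\<integral>w. complex_of_real (indicator (\<Inter>j\<in>I. Y j -` A j \<inter> space M) w) \<partial>M)"
        using I by (intro Bochner_Integration.integral_cong refl) (auto simp: indicator_def of_real_prod intro!: prod.neutral)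
      also have "\<dots> = complex_of_real (prob (\<Inter>j\<in>I. Y j -` A j \<inter> space M))"
        using I by (subst integral_complex_of_real) (auto intro!: arg_cong[where f=prob])
      finally have "prob (\<Inter>j\<in>I. Y j -` A j \<inter> space M) = (\<Prod>j\<in>I. prob (Y j -` A j \<inter> space M))"
        by (simp only: of_real_eq_iff)
      then show "prob (\<Inter>j\<in>I. Y j -` A' j \<inter> space M) = (\<Prod>j\<in>I. prob (Y j -` A' j \<inter> space M))"
        by (simp add: A_def)
    qed
    show "sets borel = sigma_sets (space borel) (sets borel :: 'b set set)" by (simp only: sets.sigma_sets_eq)
    show "Int_stable (sets (borel :: 'b measure))" by (rule sets.Int_stable)
  qed (use I in auto)
qed

section \<open>Radially decreasing functions and unimodality\<close>

definition radial_decreasing :: "('a::real_normed_vector \<Rightarrow> 'c::order) \<Rightarrow> bool" where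
  "radial_decreasing g \<longleftrightarrow> (\<forall>x y. norm x \<le> norm y \<longrightarrow> g y \<le> g x)"

lemma radial_decreasingD: "radial_decreasing g \<Longrightarrow> norm x \<le> norm y \<Longrightarrow> g y \<le> g x"
  by (auto simp: radial_decreasing_def)

lemma radial_decreasing_cong_norm: "radial_decreasing g \<Longrightarrow> norm x = norm y \<Longrightarrow> g x = g y"
  by (simp add: radial_decreasing_def antisym)

text \<open>This is (a - b) * (c - d) \<ge> 0 multiplied out; as subtraction misbehaves at infinity,
  c is written as d + e instead.\<close>

lemma ennreal_rearrangement:
  fixes a b c d :: ennreal
  assumes "b \<le> a" "d \<le> c"
  shows "a * d + b * c \<le> a * c + b * d"
proof -
  obtain e where e: "c = d + e" using assms(2) by (auto simp: le_iff_add)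
  have "b * e \<le> a * e" using assms(1) by (rule mult_right_mono) simp
  then have "(a * d + b * d) + b * e \<le> (a * d + b * d) + a * e" by (rule add_left_mono)
  then show ?thesis by (simp add: e distrib_left ac_simps)
qed

text \<open>Averaging over the reflection \<open>\<sigma>\<close> that exchanges \<open>x\<close> and \<open>y\<close> reduces the claim to the
  rearrangement inequality pointwise.\<close>

lemma radial_decreasing_convolution:
  fixes f g :: "'a::euclidean_space \<Rightarrow> ennreal"
  assumes f: "radial_decreasing f" and g: "radial_decreasing g"
    and [measurable]: "f \<in> borel_measurable borel" "g \<in> borel_measurable borel"
  shows "radial_decreasing (\<lambda>x. \<integral>\<^sup>+z. f z * g (x - z) \<partial>lborel)"
  unfolding radial_decreasing_def
proof (intro allI impI)
  fix x y :: 'a assume xy: "norm x \<le> norm y"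
  show "(\<integral>\<^sup>+z. f z * g (y - z) \<partial>lborel) \<le> (\<integral>\<^sup>+z. f z * g (x - z) \<partial>lborel)"
  proof (cases "x = y")
    case False
    define w where "w = y - x"
    define k where "k = w \<bullet> w"
    have k: "0 < k" using False by (simp add: k_def w_def)
    \<comment> \<open>The linear reflection in the hyperplane orthogonal to y - x; adding
      \<open>c\<close> below moves the mirror to the perpendicular bisector of x and y.\<close>
    define S where "S z = z - (2 * (z \<bullet> w) / k) *\<^sub>R w" for z
    define c where "c = (((x + y) \<bullet> w) / k) *\<^sub>R w"
    have linS: "linear S"
      unfolding S_def by (intro linearI) (simp_all add: algebra_simps inner_add_left add_divide_distrib)
    have isoS: "norm (S z) = norm z" for z
    proof -
      have "S z \<bullet> S z = z \<bullet> z - 4 * (z \<bullet> w)\<^sup>2 / k + 4 * (z \<bullet> w)\<^sup>2 / k\<^sup>2 * k"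
        by (simp add: S_def inner_diff_left inner_diff_right k_def[symmetric] power2_eq_square inner_commute algebra_simps)
      also have "\<dots> = z \<bullet> z" using k by (simp add: power2_eq_square)
      finally show ?thesis by (simp add: norm_eq_sqrt_inner)
    qed
    define \<sigma> where "\<sigma> z = c + S z" for z
    have inv: "(\<integral>\<^sup>+z. h (\<sigma> z) \<partial>lborel) = (\<integral>\<^sup>+z. h z \<partial>lborel)" if [measurable]: "h \<in> borel_measurable borel" for h
    proof -
      have "(\<integral>\<^sup>+z. h (\<sigma> z) \<partial>lborel) = (\<integral>\<^sup>+z. h (c + z) \<partial>lborel)"
        unfolding \<sigma>_def by (rule nn_integral_lborel_isometry[OF linS isoS refl]) measurable
      also have "\<dots> = (\<integral>\<^sup>+z. h z \<partial>distr lborel borel ((+) c))" by (subst nn_integral_distr) auto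
      finally show ?thesis by (simp add: lborel_distr_plus)
    qed
    have \<sigma>m[measurable]: "\<sigma> \<in> borel_measurable borel"
      unfolding \<sigma>_def using linS by (intro borel_measurable_add borel_measurable_const)
       (simp add: borel_measurable_continuous_onI linear_continuous_on linear_conv_bounded_linear)
    have isoD: "norm (\<sigma> u - \<sigma> v) = norm (u - v)" for u v
      using isoS[of "u - v"] linear_diff[OF linS, of u v] by (simp add: \<sigma>_def)
    have ww: "x \<bullet> w + y \<bullet> w - 2 * (x \<bullet> w) = k" "x \<bullet> w + y \<bullet> w - 2 * (y \<bullet> w) = - k"
      unfolding k_def w_def by (simp_all add: inner_diff_left inner_diff_right inner_commute)
    have sg: "\<sigma> z = z + (((x + y) \<bullet> w - 2 * (z \<bullet> w)) / k) *\<^sub>R w" for z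
      by (simp add: \<sigma>_def S_def c_def diff_divide_distrib scaleR_diff_left)
    have sx: "\<sigma> x = y"
    proof -
      have "\<sigma> x = x + ((x \<bullet> w + y \<bullet> w - 2 * (x \<bullet> w)) / k) *\<^sub>R w"
        by (simp only: sg inner_add_left)
      also have "\<dots> = y" using k by (simp only: ww) (simp add: w_def)
      finally show ?thesis .
    qed
    have sy: "\<sigma> y = x"
    proof -
      have "\<sigma> y = y + ((x \<bullet> w + y \<bullet> w - 2 * (y \<bullet> w)) / k) *\<^sub>R w"
        by (simp only: sg inner_add_left)
      also have "\<dots> = x" using k by (simp only: ww) (simp add: w_def)
      finally show ?thesis .
    qed
    have m0: "0 \<le> (x + y) \<bullet> w"
    proof -
      have "(x + y) \<bullet> w = y \<bullet> y - x \<bullet> x" by (simp add: w_def inner_add_left inner_diff_right inner_commute[of y x])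
      moreover have "(norm x)\<^sup>2 \<le> (norm y)\<^sup>2" using xy by (rule power_mono) simp
      ultimately show ?thesis by (simp add: power2_norm_eq_inner)
    qed
    \<comment> \<open>The sign of \<open>\<delta> z\<close> tells the side of the bisector:
      \<open>\<delta> z \<le> 0\<close> means that z is at least as close to x as to y. By
      \<open>m0\<close> the origin lies on the side of x, so reflecting such a z cannot shorten
      it.\<close>
    define \<delta> where "\<delta> z = 2 * (z \<bullet> w) - (x + y) \<bullet> w" for z
    have nsig: "(norm (\<sigma> z))\<^sup>2 = (norm z)\<^sup>2 - \<delta> z * ((x + y) \<bullet> w) / k" for z
    proof -
      have e: "\<sigma> z = z - (\<delta> z / k) *\<^sub>R w"
        by (simp add: \<sigma>_def S_def c_def \<delta>_def algebra_simps diff_divide_distrib)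
      have "(norm (\<sigma> z))\<^sup>2 = (norm z)\<^sup>2 - 2 * (\<delta> z / k) * (z \<bullet> w) + (\<delta> z / k)\<^sup>2 * k"
        unfolding e power2_norm_eq_inner
        by (simp add: inner_diff_left inner_diff_right k_def[symmetric] power2_eq_square inner_commute algebra_simps)
      also have "\<dots> = (norm z)\<^sup>2 - \<delta> z / k * (2 * (z \<bullet> w) - \<delta> z)"
        using k by (simp add: power2_eq_square field_simps)
      finally show ?thesis by (simp add: \<delta>_def)
    qed
    have dd: "(norm (x - z))\<^sup>2 - (norm (y - z))\<^sup>2 = \<delta> z" for z
    proof -
      have sq: "(norm (u - z))\<^sup>2 = u \<bullet> u - 2 * (z \<bullet> u) + z \<bullet> z" for u
        unfolding power2_norm_eq_inner by (simp add: inner_diff_left inner_diff_right inner_commute[of u z])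
      have "(x + y) \<bullet> w = y \<bullet> y - x \<bullet> x"
        by (simp add: w_def inner_add_left inner_diff_right inner_commute[of y x])
      moreover have "z \<bullet> w = z \<bullet> y - z \<bullet> x" by (simp add: w_def inner_diff_right)
      ultimately show ?thesis unfolding \<delta>_def sq by linarith
    qed
    have pw: "f z * g (y - z) + f (\<sigma> z) * g (x - z) \<le> f z * g (x - z) + f (\<sigma> z) * g (y - z)" for z
    proof (cases "\<delta> z \<le> 0")
      case True
      then have "norm (x - z) \<le> norm (y - z)" using dd[of z] by (intro power2_le_imp_le[OF _ norm_ge_zero]) linarith
      moreover have "\<delta> z * ((x + y) \<bullet> w) / k \<le> 0" using True m0 k by (simp add: mult_nonpos_nonneg divide_nonpos_pos)
      then have "norm z \<le> norm (\<sigma> z)" using nsig[of z] by (intro power2_le_imp_le[OF _ norm_ge_zero]) linarith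
      ultimately show ?thesis by (intro ennreal_rearrangement radial_decreasingD[OF f] radial_decreasingD[OF g])
    next
      case F: False
      then have "norm (y - z) \<le> norm (x - z)" using dd[of z] by (intro power2_le_imp_le[OF _ norm_ge_zero]) linarith
      moreover have "\<delta> z * ((x + y) \<bullet> w) / k \<ge> 0" using F m0 k by simp
      then have "norm (\<sigma> z) \<le> norm z" using nsig[of z] by (intro power2_le_imp_le[OF _ norm_ge_zero]) linarith
      ultimately have "f (\<sigma> z) * g (x - z) + f z * g (y - z) \<le> f (\<sigma> z) * g (y - z) + f z * g (x - z)"
        by (intro ennreal_rearrangement radial_decreasingD[OF f] radial_decreasingD[OF g])
      then show ?thesis by (simp only: add.commute)
    qed
    have gy: "g (y - \<sigma> z) = g (x - z)" for z
      using isoD[of x z] sx by (intro radial_decreasing_cong_norm[OF g]) simp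
    have gx: "g (x - \<sigma> z) = g (y - z)" for z
      using isoD[of y z] sy by (intro radial_decreasing_cong_norm[OF g]) simp
    \<comment> \<open>One of the two copies is reflected, so that \<open>pw\<close> can compare the
      integrands at z and \<open>\<sigma> z\<close> together.\<close>
    have "2 * (\<integral>\<^sup>+z. f z * g (y - z) \<partial>lborel) = (\<integral>\<^sup>+z. f z * g (y - z) \<partial>lborel) + (\<integral>\<^sup>+z. f (\<sigma> z) * g (y - \<sigma> z) \<partial>lborel)"
      by (subst inv) (auto simp: mult_2)
    also have "\<dots> = (\<integral>\<^sup>+z. f z * g (y - z) + f (\<sigma> z) * g (x - z) \<partial>lborel)"
      by (subst nn_integral_add) (auto simp: gy)
    also have "\<dots> \<le> (\<integral>\<^sup>+z. f z * g (x - z) + f (\<sigma> z) * g (y - z) \<partial>lborel)"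
      by (intro nn_integral_mono pw)
    also have "\<dots> = (\<integral>\<^sup>+z. f z * g (x - z) \<partial>lborel) + (\<integral>\<^sup>+z. f (\<sigma> z) * g (x - \<sigma> z) \<partial>lborel)"
      by (subst nn_integral_add) (auto simp: gx)
    also have "\<dots> = 2 * (\<integral>\<^sup>+z. f z * g (x - z) \<partial>lborel)"
      by (subst inv) (auto simp: mult_2)
    finally show ?thesis
      by (subst (asm) ennreal_mult_le_mult_iff) auto
  qed simp
qed

text \<open>Stated with test functions because compound Poisson laws have an atom at the origin and
  hence no density. In this form independent sums only require applying the definition
  twice.\<close>

definition unimodal_rv :: "'w measure \<Rightarrow> ('w \<Rightarrow> 'a::euclidean_space) \<Rightarrow> bool" where
  "unimodal_rv M Y \<longleftrightarrow> (\<forall>g::'a \<Rightarrow> ennreal. g \<in> borel_measurable borel \<longrightarrow> radial_decreasing g \<longrightarrow>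
     radial_decreasing (\<lambda>x. \<integral>\<^sup>+w. g (x + Y w) \<partial>M))"

lemma unimodal_rvD:
  "unimodal_rv M Y \<Longrightarrow> g \<in> borel_measurable borel \<Longrightarrow> radial_decreasing g \<Longrightarrow>
    radial_decreasing (\<lambda>x. \<integral>\<^sup>+w. g (x + Y w) \<partial>M)"
  by (simp add: unimodal_rv_def)

text \<open>The atom at the origin contributes a multiple of the test function itself and the
  density contributes a convolution; both are radially decreasing.\<close>

lemma unimodal_rv_density:
  fixes f :: "'a::euclidean_space \<Rightarrow> ennreal"
  assumes f: "radial_decreasing f" and [measurable]: "f \<in> borel_measurable borel"
    and law: "\<And>g::'a \<Rightarrow> ennreal. g \<in> borel_measurable borel \<Longrightarrow>
      (\<integral>\<^sup>+w. g (Y w) \<partial>M) = a * g 0 + (\<integral>\<^sup>+z. f z * g z \<partial>lborel)"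
  shows "unimodal_rv M Y"
  unfolding unimodal_rv_def
proof (intro allI impI)
  fix g :: "'a \<Rightarrow> ennreal" assume [measurable]: "g \<in> borel_measurable borel" and g: "radial_decreasing g"
  have e: "(\<integral>\<^sup>+w. g (x + Y w) \<partial>M) = a * g x + (\<integral>\<^sup>+z. f z * g (x - z) \<partial>lborel)" for x
  proof -
    have "(\<integral>\<^sup>+w. g (x + Y w) \<partial>M) = a * g x + (\<integral>\<^sup>+z. f z * g (x + z) \<partial>lborel)"
      by (subst law[of "\<lambda>y. g (x + y)"]) auto
    also have "(\<integral>\<^sup>+z. f z * g (x + z) \<partial>lborel) = (\<integral>\<^sup>+z. f (- z) * g (x + - z) \<partial>lborel)"
      by (rule nn_integral_lborel_isometry[symmetric]) (auto intro: linear_uminus)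
    also have "\<dots> = (\<integral>\<^sup>+z. f z * g (x - z) \<partial>lborel)"
      using radial_decreasing_cong_norm[OF f, of "- z" z for z] by simp
    finally show ?thesis .
  qed
  show "radial_decreasing (\<lambda>x. \<integral>\<^sup>+w. g (x + Y w) \<partial>M)"
    unfolding e using radial_decreasing_convolution[OF f g] g
    by (auto simp: radial_decreasing_def intro!: add_mono mult_left_mono)
qed

text \<open>Integrating out \<open>Y2\<close> first leaves a radially decreasing function, which is
  again an admissible test function for \<open>Y1\<close>.\<close>

lemma (in prob_space) unimodal_rv_add:
  fixes Y1 Y2 :: "'a \<Rightarrow> 'b::euclidean_space"
  assumes ind: "indep_var borel Y1 borel Y2" and 1: "unimodal_rv M Y1" and 2: "unimodal_rv M Y2"
  shows "unimodal_rv M (\<lambda>w. Y1 w + Y2 w)"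
  unfolding unimodal_rv_def
proof (intro allI impI)
  fix g :: "'b \<Rightarrow> ennreal" assume [measurable]: "g \<in> borel_measurable borel" and g: "radial_decreasing g"
  have [measurable]: "Y1 \<in> borel_measurable M" "Y2 \<in> borel_measurable M"
    using indep_var_rv1[OF ind] indep_var_rv2[OF ind] by auto
  interpret D2: prob_space "distr M borel Y2" by (rule prob_space_distr) simp
  let ?g2 = "\<lambda>x. \<integral>\<^sup>+w. g (x + Y2 w) \<partial>M"
  have m2[measurable]: "?g2 \<in> borel_measurable borel" by measurable
  have r2: "radial_decreasing ?g2" using 2 g by (auto simp: unimodal_rv_def)
  have "(\<integral>\<^sup>+w. g (x + (Y1 w + Y2 w)) \<partial>M) = (\<integral>\<^sup>+w. ?g2 (x + Y1 w) \<partial>M)" for x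
  proof -
    have "(\<integral>\<^sup>+w. g (x + (Y1 w + Y2 w)) \<partial>M)
        = (\<integral>\<^sup>+p. g (x + (fst p + snd p)) \<partial>distr M (borel \<Otimes>\<^sub>M borel) (\<lambda>w. (Y1 w, Y2 w)))"
      by (subst nn_integral_distr) auto
    also have "\<dots> = (\<integral>\<^sup>+p. g (x + (fst p + snd p)) \<partial>(distr M borel Y1 \<Otimes>\<^sub>M distr M borel Y2))"
      using ind by (simp add: indep_var_distribution_eq)
    also have "\<dots> = (\<integral>\<^sup>+u. \<integral>\<^sup>+v. g (x + (u + v)) \<partial>distr M borel Y2 \<partial>distr M borel Y1)"
      by (subst D2.nn_integral_fst[symmetric]) auto
    also have "\<dots> = (\<integral>\<^sup>+w. ?g2 (x + Y1 w) \<partial>M)"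
      by (simp add: nn_integral_distr add.assoc)
    finally show ?thesis .
  qed
  then show "radial_decreasing (\<lambda>x. \<integral>\<^sup>+w. g (x + (Y1 w + Y2 w)) \<partial>M)"
    using unimodal_rvD[OF 1 m2 r2] by simp
qed

lemma (in prob_space) unimodal_rv_sum:
  fixes Y :: "'i \<Rightarrow> 'a \<Rightarrow> 'b::euclidean_space"
  assumes "finite I" "indep_vars (\<lambda>_. borel) Y I" "\<And>i. i \<in> I \<Longrightarrow> unimodal_rv M (Y i)"
  shows "unimodal_rv M (\<lambda>w. \<Sum>i\<in>I. Y i w)"
  using assms
proof (induction I)
  case empty
  show ?case by (simp add: unimodal_rv_def emeasure_space_1)
next
  case (insert i I)
  have "indep_var borel ((\<lambda>f. f i) \<circ> (\<lambda>\<omega>. restrict (\<lambda>i. Y i \<omega>) {i}))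
     borel ((\<lambda>f. \<Sum>i\<in>I. f i) \<circ> (\<lambda>\<omega>. restrict (\<lambda>i. Y i \<omega>) I))"
    using insert.hyps by (intro indep_var_compose[OF indep_var_restrict[OF insert.prems(1)]]) auto
  also have "((\<lambda>f. f i) \<circ> (\<lambda>\<omega>. restrict (\<lambda>i. Y i \<omega>) {i})) = Y i"
    by auto
  also have "((\<lambda>f. \<Sum>i\<in>I. f i) \<circ> (\<lambda>\<omega>. restrict (\<lambda>i. Y i \<omega>) I)) = (\<lambda>\<omega>. \<Sum>i\<in>I. Y i \<omega>)"
    by (auto cong: rev_conj_cong)
  finally have ind: "indep_var borel (Y i) borel (\<lambda>\<omega>. \<Sum>i\<in>I. Y i \<omega>)" .
  have "unimodal_rv M (\<lambda>w. \<Sum>i\<in>I. Y i w)"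
    using insert by (auto intro: indep_vars_subset)
  from unimodal_rv_add[OF ind _ this] show ?case using insert by simp
qed

text \<open>Expectations of bounded continuous test functions pass through the almost sure limit.
  The indicator of a closed ball is afterwards recovered from the radially decreasing cut-offs
  \<open>\<phi> k\<close>, which approximate it from above.\<close>

lemma (in prob_space) unimodal_limit_cball:
  fixes Y :: "nat \<Rightarrow> 'a \<Rightarrow> 'b::euclidean_space"
  assumes Ym[measurable]: "\<And>n. Y n \<in> borel_measurable M" and [measurable]: "Z \<in> borel_measurable M"
    and u: "\<And>n. unimodal_rv M (Y n)" and lim: "AE w in M. (\<lambda>n. Y n w) \<longlonglongrightarrow> Z w"
  shows "radial_decreasing (\<lambda>x. measure M {w\<in>space M. Z w \<in> cball x r})"
  unfolding radial_decreasing_def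
proof (intro allI impI)
  fix x y :: 'b assume xy: "norm x \<le> norm y"
  define \<phi> where "\<phi> k z = max 0 (min 1 (1 + real k * (r - norm z)))" for k and z :: 'b
  have ph01: "0 \<le> \<phi> k z" "\<phi> k z \<le> 1" for k z by (auto simp: \<phi>_def)
  have phc: "continuous_on UNIV (\<phi> k)" for k unfolding \<phi>_def by (intro continuous_intros)
  have phm[measurable]: "\<phi> k \<in> borel_measurable borel" for k
    by (rule borel_measurable_continuous_onI[OF phc])
  have phd: "radial_decreasing (\<lambda>z. ennreal (\<phi> k z))" for k
    unfolding radial_decreasing_def \<phi>_def
    by (auto intro!: ennreal_leI max.mono min.mono add_left_mono mult_left_mono)
  have int: "integrable M (\<lambda>w. \<phi> k (z + V w))" if [measurable]: "V \<in> borel_measurable M" for k V z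
    by (rule integrable_const_bound[where B=1]) (auto simp: ph01)
  have 1: "(\<integral>w. \<phi> k (- y + Y n w) \<partial>M) \<le> (\<integral>w. \<phi> k (- x + Y n w) \<partial>M)" for k n
  proof -
    have "ennreal (\<integral>w. \<phi> k (z + Y n w) \<partial>M) = (\<integral>\<^sup>+w. ennreal (\<phi> k (z + Y n w)) \<partial>M)" for z
      by (rule nn_integral_eq_integral[symmetric]) (auto simp: ph01 int)
    moreover have "(\<integral>\<^sup>+w. ennreal (\<phi> k (- y + Y n w)) \<partial>M) \<le> (\<integral>\<^sup>+w. ennreal (\<phi> k (- x + Y n w)) \<partial>M)"
      using xy by (intro radial_decreasingD[OF unimodal_rvD[OF u _ phd]]) auto
    ultimately have "ennreal (\<integral>w. \<phi> k (- y + Y n w) \<partial>M) \<le> ennreal (\<integral>w. \<phi> k (- x + Y n w) \<partial>M)"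
      by (simp only:)
    then show ?thesis by (subst (asm) ennreal_le_iff) (auto intro!: Bochner_Integration.integral_nonneg ph01)
  qed
  have L1: "(\<lambda>n. \<integral>w. \<phi> k (z + Y n w) \<partial>M) \<longlonglongrightarrow> (\<integral>w. \<phi> k (z + Z w) \<partial>M)" for k z
  proof (rule integral_dominated_convergence[where w="\<lambda>_. 1"])
    show "AE w in M. (\<lambda>n. \<phi> k (z + Y n w)) \<longlonglongrightarrow> \<phi> k (z + Z w)"
      using lim
    proof eventually_elim
      case (elim w)
      have "isCont (\<phi> k) (z + Z w)" using phc by (simp add: continuous_on_eq_continuous_at)
      then show ?case by (rule isCont_tendsto_compose) (intro tendsto_intros elim)
    qed
  qed (auto simp: ph01)
  have 2: "(\<integral>w. \<phi> k (- y + Z w) \<partial>M) \<le> (\<integral>w. \<phi> k (- x + Z w) \<partial>M)" for k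
    by (rule LIMSEQ_le[OF L1 L1]) (use 1 in auto)
  have L2: "(\<lambda>k. \<integral>w. \<phi> k (- z + Z w) \<partial>M) \<longlonglongrightarrow> measure M {w\<in>space M. Z w \<in> cball z r}" for z
  proof -
    have "(\<lambda>k. \<integral>w. \<phi> k (- z + Z w) \<partial>M) \<longlonglongrightarrow> (\<integral>w. indicator {w\<in>space M. Z w \<in> cball z r} w \<partial>M)"
    proof (rule integral_dominated_convergence[where w="\<lambda>_. 1"])
      show "AE w in M. (\<lambda>k. \<phi> k (- z + Z w)) \<longlonglongrightarrow> indicator {w\<in>space M. Z w \<in> cball z r} w"
      proof (intro AE_I2)
        fix w assume w: "w \<in> space M"
        show "(\<lambda>k. \<phi> k (- z + Z w)) \<longlonglongrightarrow> indicator {w\<in>space M. Z w \<in> cball z r} w"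
        proof (cases "norm (- z + Z w) \<le> r")
          case True
          then have "\<phi> k (- z + Z w) = 1" for k by (auto simp: \<phi>_def min_absorb1)
          moreover have "Z w \<in> cball z r" using True by (simp add: dist_norm norm_minus_commute)
          ultimately show ?thesis using w by simp
        next
          case False
          then have d: "0 < norm (- z + Z w) - r" by simp
          obtain N where N: "1 < real N * (norm (- z + Z w) - r)" using d by (metis reals_Archimedean3)
          have "eventually (\<lambda>k. \<phi> k (- z + Z w) = 0) sequentially"
            using eventually_ge_at_top[of N]
          proof eventually_elim
            case (elim n)
            then have "real N * (norm (- z + Z w) - r) \<le> real n * (norm (- z + Z w) - r)"
              using d by (intro mult_right_mono) auto
            then have "1 + real n * (r - norm (- z + Z w)) \<le> 0" using N by (simp add: algebra_simps)
            then show ?case by (simp add: \<phi>_def)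
          qed
          moreover have "Z w \<notin> cball z r" using False by (simp add: dist_norm norm_minus_commute)
          ultimately show ?thesis by (simp add: tendsto_eventually)
        qed
      qed
    qed (auto simp: ph01)
    then show ?thesis by simp
  qed
  show "measure M {w\<in>space M. Z w \<in> cball y r} \<le> measure M {w\<in>space M. Z w \<in> cball x r}"
    by (rule LIMSEQ_le[OF L2 L2]) (use 2 in auto)
qed

section \<open>Compound Poisson blocks\<close>

lemma measurable_cis[measurable]: "cis \<in> borel_measurable borel"
  by (intro borel_measurable_continuous_onI continuous_intros)

lemma (in product_prob_space) indep_vars_coordinates:
  assumes "I \<noteq> {}"
  shows "P.indep_vars M (\<lambda>i \<omega>. \<omega> i) I"
proof -
  have "distr (PiM I M) (PiM I M) (\<lambda>x. \<lambda>i\<in>I. x i) = distr (PiM I M) (PiM I M) (\<lambda>x. x)"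
    by (rule distr_cong) (auto simp: space_PiM PiE_def extensional_restrict)
  also have "\<dots> = PiM I (\<lambda>i. distr (PiM I M) (M i) (\<lambda>x. x i))"
    by (auto simp: distr_id PiM_component intro!: PiM_cong)
  finally show ?thesis
    using assms by (subst P.indep_vars_iff_distr_eq_PiM') auto
qed

lemma poisson_generating_function:
  fixes a :: complex
  assumes "0 < l" "norm a \<le> 1"
  shows "(\<integral>n. a ^ n \<partial>measure_pmf (poisson_pmf l)) = exp (of_real l * (a - 1))"
proof -
  have i: "integrable (measure_pmf (poisson_pmf l)) (\<lambda>n. a ^ n)"
    using assms by (intro measure_pmf.integrable_const_bound[where B=1]) (auto simp: norm_power power_le_one)
  have eq: "pmf (poisson_pmf l) n *\<^sub>R a ^ n = exp (- of_real l) * ((of_real l * a) ^ n /\<^sub>R fact n)" for n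
    using assms by (simp add: pmf_poisson power_mult_distrib exp_of_real[symmetric] scaleR_conv_of_real divide_inverse)
  have "integrable (count_space UNIV) (\<lambda>n. pmf (poisson_pmf l) n *\<^sub>R a ^ n)"
    using i by (simp add: measure_pmf_eq_density integrable_density pmf_nonneg)
  moreover have "(\<integral>n. a ^ n \<partial>measure_pmf (poisson_pmf l)) = (\<integral>n. pmf (poisson_pmf l) n *\<^sub>R a ^ n \<partial>count_space UNIV)"
    by (simp add: measure_pmf_eq_density integral_density pmf_nonneg)
  ultimately have "(\<lambda>n. pmf (poisson_pmf l) n *\<^sub>R a ^ n) sums (\<integral>n. a ^ n \<partial>measure_pmf (poisson_pmf l))"
    using sums_integral_count_space_nat by metis
  moreover have "(\<lambda>n. pmf (poisson_pmf l) n *\<^sub>R a ^ n) sums (exp (- of_real l) * exp (of_real l * a))"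
    unfolding eq by (intro sums_mult exp_converges)
  ultimately have "(\<integral>n. a ^ n \<partial>measure_pmf (poisson_pmf l)) = exp (- of_real l) * exp (of_real l * a)"
    by (rule sums_unique2)
  then show ?thesis by (simp add: exp_add[symmetric] algebra_simps)
qed

section \<open>Joint characteristic functions of increments and Poisson sums of marks\<close>

definition incr :: "(nat \<Rightarrow> real) \<Rightarrow> (real \<Rightarrow> 'w \<Rightarrow> 'a::euclidean_space) \<Rightarrow> nat \<Rightarrow> 'w \<Rightarrow> 'a" where
  "incr s Y i \<omega> = (if i = 0 then Y (s 0) \<omega> else Y (s i) \<omega> - Y (s (i - 1)) \<omega>)"

definition grid_start :: "(nat \<Rightarrow> real) \<Rightarrow> nat \<Rightarrow> real" where
  "grid_start s i = (if i = 0 then 0 else s (i - 1))"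

text \<open>One identity over all grids and frequencies carries independence, stationarity and the
  exponent together. The first increment runs from time 0 to \<open>s 0\<close>. The horizon T
  allows for sums of blocks whose jump intensity is the prescribed one up to a finite time
  only.\<close>

definition levy_char :: "'w measure \<Rightarrow> (real \<Rightarrow> 'w \<Rightarrow> 'a::euclidean_space) \<Rightarrow> real \<Rightarrow> ('a \<Rightarrow> real) \<Rightarrow> bool" where
  "levy_char M Y T \<Psi> \<longleftrightarrow> (\<forall>n s \<eta>. 0 \<le> s 0 \<and> (\<forall>i<n. s i < s (Suc i)) \<and> s n \<le> T \<longrightarrow>
     (\<integral>\<omega>. (\<Prod>i\<le>n. cis (\<eta> i \<bullet> incr s Y i \<omega>)) \<partial>M)
       = complex_of_real (\<Prod>i\<le>n. exp (- ((s i - grid_start s i) * \<Psi> (\<eta> i)))))"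

lemma cis_sum: "finite A \<Longrightarrow> cis (sum f A) = (\<Prod>a\<in>A. cis (f a))"
  by (induction A rule: finite_induct) (auto simp: cis_mult[symmetric])

lemma lborel_prod_integrable_times:
  fixes f :: "'a::euclidean_space \<Rightarrow> real" and F :: "'b::euclidean_space \<Rightarrow> real"
  assumes f: "integrable lborel f" and F: "integrable lborel F"
  shows "integrable lborel (\<lambda>z. f (fst z) * F (snd z))"
    and "(\<integral>z. f (fst z) * F (snd z) \<partial>lborel) = (\<integral>u. f u \<partial>lborel) * (\<integral>x. F x \<partial>lborel)"
proof -
  have [measurable]: "f \<in> borel_measurable borel" "F \<in> borel_measurable borel"
    using borel_measurable_integrable[OF f] borel_measurable_integrable[OF F] by simp_all
  have i: "integrable (lborel \<Otimes>\<^sub>M lborel) (\<lambda>z. f (fst z) * F (snd z))"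
    by (rule lborel_pair.Fubini_integrable) (use f F in \<open>auto simp: abs_mult\<close>)
  then show "integrable lborel (\<lambda>z. f (fst z) * F (snd z))" by (simp add: lborel_prod)
  show "(\<integral>z. f (fst z) * F (snd z) \<partial>lborel) = (\<integral>u. f u \<partial>lborel) * (\<integral>x. F x \<partial>lborel)"
    using lborel_pair.integral_fst'[OF i] by (simp add: lborel_prod)
qed

lemma strict_grid_mono:
  fixes s :: "nat \<Rightarrow> real"
  assumes "\<And>i. i < n \<Longrightarrow> s i < s (Suc i)" "i \<le> j" "j \<le> n"
  shows "s i \<le> s j"
  using assms(2,3)
proof (induction j rule: dec_induct)
  case (step m)
  then show ?case using assms(1)[of m] by simp
qed simp

text \<open>\<open>g k\<close> is the joint intensity in time and space of the jumps of block k.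
  Finite positive mass makes the block a Poisson number of independent marks; symmetry in space
  makes the characteristic functions real, so that no drift arises.\<close>

locale jump_blocks =
  fixes g :: "nat \<Rightarrow> real \<times> 'b::euclidean_space \<Rightarrow> real"
  assumes g_meas[measurable]: "\<And>k. g k \<in> borel_measurable borel"
    and g_nonneg: "\<And>k z. 0 \<le> g k z"
    and g_int: "\<And>k. integrable lborel (g k)"
    and g_pos: "\<And>k. 0 < (\<integral>z. g k z \<partial>lborel)"
    and g_sym: "\<And>k u x. g k (u, - x) = g k (u, x)"
begin

definition lam where "lam k = (\<integral>z. g k z \<partial>lborel)"
definition mark where "mark k = density lborel (\<lambda>z. ennreal (g k z / lam k))"
text \<open>A Poisson number together with an infinite sequence of marks, of which only the first
  ones, as many as the number says, are used. This keeps the sample space a plain product.\<close>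

definition block where "block k = measure_pmf (poisson_pmf (lam k)) \<Otimes>\<^sub>M PiM UNIV (\<lambda>_::nat. mark k)"
definition Om where "Om = PiM UNIV block"

lemma lam_pos: "0 < lam k" unfolding lam_def by (rule g_pos)

lemma sets_mark[simp, measurable_cong]: "sets (mark k) = sets borel" and space_mark[simp]: "space (mark k) = UNIV"
  by (auto simp: mark_def)

lemma prob_space_mark: "prob_space (mark k)"
proof
  have "emeasure (mark k) (space (mark k)) = (\<integral>\<^sup>+z. ennreal (g k z / lam k) \<partial>lborel)"
    by (simp add: mark_def emeasure_density)
  also have "\<dots> = ennreal (\<integral>z. g k z / lam k \<partial>lborel)"
    by (rule nn_integral_eq_integral) (use g_int g_nonneg lam_pos[of k] in auto)
  also have "\<dots> = 1" using lam_pos[of k] by (simp add: lam_def)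
  finally show "emeasure (mark k) (space (mark k)) = 1" .
qed

sublocale mark: prob_space "mark k" for k by (rule prob_space_mark)
sublocale marks: product_prob_space "\<lambda>_::nat. mark k" UNIV for k ..
sublocale blk: pair_prob_space "measure_pmf (poisson_pmf (lam k))" "PiM UNIV (\<lambda>_::nat. mark k)" for k
  unfolding block_def ..

lemma prob_space_block: "prob_space (block k)"
  unfolding block_def by (rule blk.P.prob_space_axioms)

sublocale block: prob_space "block k" for k by (rule prob_space_block)
sublocale Om: product_prob_space block UNIV ..

lemma prob_space_Om: "prob_space Om"
  unfolding Om_def by (rule Om.P.prob_space_axioms)

sublocale prob_space Om by (rule prob_space_Om)

lemma measurable_Om_coord[measurable]: "(\<lambda>\<omega>. \<omega> k) \<in> Om \<rightarrow>\<^sub>M block k"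
  unfolding Om_def by simp

text \<open>The number of factors is random but takes countably many values, and for each fixed
  value the product is measurable.\<close>

lemma measurable_block_prod[measurable]:
  assumes [measurable]: "\<phi> \<in> borel_measurable borel"
  shows "(\<lambda>z. \<Prod>i<fst z. \<phi> (snd z i) :: complex) \<in> borel_measurable (block k)"
  unfolding block_def
  by (rule measurable_compose_countable'[where f="\<lambda>n z. \<Prod>i<n. \<phi> (snd z i)" and g=fst and I=UNIV])
    (auto simp: measurable_count_space_eq1)

lemma measurable_block_sum[measurable]:
  assumes [measurable]: "\<phi> \<in> borel_measurable borel"
  shows "(\<lambda>z. \<Sum>i<fst z. \<phi> (snd z i) :: 'c::euclidean_space) \<in> borel_measurable (block k)"
  unfolding block_def
  by (rule measurable_compose_countable'[where f="\<lambda>n z. \<Sum>i<n. \<phi> (snd z i)" and g=fst and I=UNIV])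
    (auto simp: measurable_count_space_eq1)

lemma integral_mark:
  fixes \<phi> :: "real \<times> 'b \<Rightarrow> 'c::{banach, second_countable_topology}"
  assumes [measurable]: "\<phi> \<in> borel_measurable borel"
  shows "(\<integral>z. \<phi> z \<partial>mark k) = (\<integral>z. (g k z / lam k) *\<^sub>R \<phi> z \<partial>lborel)"
  unfolding mark_def using g_nonneg lam_pos[of k] by (subst integral_density) (auto intro: divide_nonneg_pos)

text \<open>Given the Poisson number n, the product has mean \<open>?a ^ n\<close> with
  \<open>?a\<close> the mean of \<open>\<phi>\<close> under the mark law. The Poisson generating
  function at \<open>?a\<close> gives an exponential in which \<open>lam k\<close> cancels the
  normalisation of the mark density.\<close>

lemma block_char:
  fixes \<phi> :: "real \<times> 'b \<Rightarrow> complex"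
  assumes [measurable]: "\<phi> \<in> borel_measurable borel" and b: "\<And>z. norm (\<phi> z) \<le> 1"
  shows "(\<integral>z. (\<Prod>i<fst z. \<phi> (snd z i)) \<partial>block k) = exp (\<integral>z. (\<phi> z - 1) * of_real (g k z) \<partial>lborel)"
proof -
  have [measurable]: "\<phi> \<in> borel_measurable (mark k)"
    using assms(1) by (simp cong: measurable_cong_sets)
  let ?a = "\<integral>z. \<phi> z \<partial>mark k"
  have inner: "(\<integral>w. (\<Prod>i<n. \<phi> (w i)) \<partial>PiM UNIV (\<lambda>_::nat. mark k)) = ?a ^ n" for n
  proof -
    have "marks.P.indep_vars k (\<lambda>_. borel) (\<lambda>i w. \<phi> (w i)) {..<n}"
      by (rule marks.P.indep_vars_compose2[OF marks.P.indep_vars_subset[OF marks.indep_vars_coordinates]]) simp_all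
    moreover have "(\<integral>w. \<phi> (w i) \<partial>PiM UNIV (\<lambda>_::nat. mark k)) = ?a" for i
      by (subst marks.PiM_component[of i k, symmetric], simp, subst integral_distr) auto
    moreover have "integrable (PiM UNIV (\<lambda>_::nat. mark k)) (\<lambda>w. \<phi> (w i))" for i
      using b by (intro marks.P.integrable_const_bound[where B=1]) auto
    ultimately show ?thesis
      using marks.P.indep_vars_lebesgue_integral[of "{..<n}" k "\<lambda>i w. \<phi> (w i)"] by simp
  qed
  have na: "norm ?a \<le> 1"
  proof -
    have "norm ?a \<le> (\<integral>z. norm (\<phi> z) \<partial>mark k)" by (rule integral_norm_bound)
    also have "\<dots> \<le> (\<integral>z. 1 \<partial>mark k)"
      using b by (intro integral_mono mark.integrable_const_bound[where B=1]) auto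
    finally show ?thesis using mark.prob_space[of k] by simp
  qed
  have "(\<integral>z. (\<Prod>i<fst z. \<phi> (snd z i)) \<partial>block k) = (\<integral>n. (\<integral>w. (\<Prod>i<n. \<phi> (w i)) \<partial>PiM UNIV (\<lambda>_::nat. mark k)) \<partial>measure_pmf (poisson_pmf (lam k)))"
  proof -
    have "integrable (block k) (\<lambda>z. \<Prod>i<fst z. \<phi> (snd z i))"
      by (intro block.integrable_const_bound[where B=1] AE_I2) (auto simp: prod_norm[symmetric] intro!: prod_le_1 b)
    from blk.integral_fst'[OF this[unfolded block_def]] show ?thesis
      unfolding block_def by simp
  qed
  also have "\<dots> = exp (of_real (lam k) * (?a - 1))"
    unfolding inner using lam_pos na by (rule poisson_generating_function)
  also have "of_real (lam k) * (?a - 1) = (\<integral>z. (\<phi> z - 1) * of_real (g k z) \<partial>lborel)"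
  proof -
    have ig: "integrable lborel (\<lambda>z. \<phi> z * of_real (g k z))"
      using b by (intro Bochner_Integration.integrable_bound[OF g_int[of k]])
        (auto simp: norm_mult intro!: mult_left_le_one_le g_nonneg)
    have "?a = (\<integral>z. (\<phi> z * of_real (g k z)) / of_real (lam k) \<partial>lborel)"
      by (subst integral_mark) (auto simp: scaleR_conv_of_real mult_ac)
    then have "of_real (lam k) * (?a - 1) = (\<integral>z. \<phi> z * of_real (g k z) \<partial>lborel) - of_real (lam k)"
      using lam_pos[of k] by (simp add: algebra_simps)
    also have "\<dots> = (\<integral>z. (\<phi> z - 1) * of_real (g k z) \<partial>lborel)"
      using ig g_int[of k] by (simp add: lam_def left_diff_distrib)
    finally show ?thesis .
  qed
  finally show ?thesis .
qed

text \<open>The reflection (u, x) to (u, -x) preserves the intensity and reverses the sine, so only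
  the cosine part remains.\<close>

lemma integral_sin_vanishes:
  assumes [measurable]: "\<eta> \<in> borel_measurable borel"
  shows "(\<integral>z. (cis (\<eta> (fst z) \<bullet> snd z) - 1) * of_real (g k z) \<partial>lborel)
      = complex_of_real (- (\<integral>z. (1 - cos (\<eta> (fst z) \<bullet> snd z)) * g k z \<partial>lborel))"
proof -
  let ?s = "\<lambda>z. sin (\<eta> (fst z) \<bullet> snd z) * g k z" and ?c = "\<lambda>z. (1 - cos (\<eta> (fst z) \<bullet> snd z)) * g k z"
  have [measurable]: "fst \<in> borel_measurable (borel :: (real \<times> 'b) measure)" "snd \<in> borel_measurable (borel :: (real \<times> 'b) measure)"
    by (auto intro!: borel_measurable_continuous_onI continuous_intros)
  have isn: "integrable lborel ?s"
    by (rule Bochner_Integration.integrable_bound[OF g_int[of k]]) (auto simp: abs_mult intro!: mult_left_le_one_le g_nonneg)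
  have ic: "integrable lborel ?c"
  proof (rule Bochner_Integration.integrable_bound[OF integrable_mult_right[OF g_int[of k], of 2]])
    have "\<bar>1 - cos t\<bar> \<le> 2" for t :: real using cos_le_one[of t] cos_ge_minus_one[of t] by linarith
    then show "AE z in lborel. norm (?c z) \<le> norm (2 * g k z)"
      by (auto simp: abs_mult intro!: mult_right_mono)
  qed simp
  have "(\<integral>z. ?s (fst z, - snd z) \<partial>lborel) = (\<integral>z. ?s z \<partial>lborel)"
    by (rule integral_lborel_isometry) (auto simp: norm_prod_def intro!: linearI)
  then have s0: "(\<integral>z. ?s z \<partial>lborel) = 0" using isn by (simp add: g_sym)
  have "(\<integral>z. (cis (\<eta> (fst z) \<bullet> snd z) - 1) * of_real (g k z) \<partial>lborel) = (\<integral>z. \<i> * of_real (?s z) - of_real (?c z) \<partial>lborel)"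
    by (intro Bochner_Integration.integral_cong refl) (auto simp: complex_eq_iff algebra_simps)
  also have "\<dots> = \<i> * of_real (\<integral>z. ?s z \<partial>lborel) - of_real (\<integral>z. ?c z \<partial>lborel)"
  proof -
    have "integrable lborel (\<lambda>z. \<i> * complex_of_real (?s z))"
      using isn by (intro integrable_mult_right integrable_of_real)
    moreover have "integrable lborel (\<lambda>z. complex_of_real (?c z))"
      using ic by (rule integrable_of_real)
    ultimately show ?thesis
      by (simp only: Bochner_Integration.integral_diff integral_mult_right_zero integral_complex_of_real)
  qed
  finally show ?thesis by (simp add: s0)
qed

definition jump where "jump t z = (if fst z \<le> t then snd z else 0)" for t and z :: "real \<times> 'b"
definition Z where "Z k t \<omega> = (\<Sum>i<fst (\<omega> k). jump t (snd (\<omega> k) i))" for k t and \<omega> :: "nat \<Rightarrow> nat \<times> (nat \<Rightarrow> real \<times> 'b)"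
definition S where "S J t \<omega> = (\<Sum>k\<in>J. Z k t \<omega>)"

lemma jump_meas[measurable]: "jump t \<in> borel_measurable borel"
proof -
  have [measurable]: "fst \<in> borel_measurable (borel :: (real \<times> 'b) measure)" "snd \<in> borel_measurable (borel :: (real \<times> 'b) measure)"
    by (auto intro!: borel_measurable_continuous_onI continuous_intros)
  show ?thesis unfolding jump_def by measurable
qed

lemma Z_meas[measurable]: "Z k t \<in> borel_measurable Om"
  unfolding Z_def by (rule measurable_compose[OF measurable_Om_coord measurable_block_sum]) simp

lemma S_meas[measurable]: "S J t \<in> borel_measurable Om"
  unfolding S_def by measurable

text \<open>Independence of the blocks multiplies their exponential formulas, so the intensities add
  up. Letting the frequency depend on the jump time allows a whole combination of increments to be
  treated as one sum over marks.\<close>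

lemma Om_char:
  assumes [measurable]: "\<eta> \<in> borel_measurable borel" and J: "finite J"
  shows "(\<integral>\<omega>. cis (\<Sum>k\<in>J. \<Sum>i<fst (\<omega> k). \<eta> (fst (snd (\<omega> k) i)) \<bullet> snd (snd (\<omega> k) i)) \<partial>Om)
      = complex_of_real (exp (- (\<integral>z. (1 - cos (\<eta> (fst z) \<bullet> snd z)) * (\<Sum>k\<in>J. g k z) \<partial>lborel)))"
proof -
  have [measurable]: "fst \<in> borel_measurable (borel :: (real \<times> 'b) measure)" "snd \<in> borel_measurable (borel :: (real \<times> 'b) measure)"
    by (auto intro!: borel_measurable_continuous_onI continuous_intros)
  let ?\<phi> = "\<lambda>z::real \<times> 'b. cis (\<eta> (fst z) \<bullet> snd z)"
  let ?c = "\<lambda>k z. (1 - cos (\<eta> (fst z) \<bullet> snd z)) * g k z"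
  let ?F = "\<lambda>z. \<Prod>i<fst z. ?\<phi> (snd z i)"
  have Fm[measurable]: "?F \<in> borel_measurable (block k)" for k by (rule measurable_block_prod) measurable
  have ic: "integrable lborel (?c k)" for k
  proof (rule Bochner_Integration.integrable_bound[OF integrable_mult_right[OF g_int[of k], of 2]])
    have "\<bar>1 - cos t\<bar> \<le> 2" for t :: real using cos_le_one[of t] cos_ge_minus_one[of t] by linarith
    then show "AE z in lborel. norm (?c k z) \<le> norm (2 * g k z)"
      by (auto simp: abs_mult intro!: mult_right_mono)
  qed simp
  have cs: "cis (sum f A) = (\<Prod>a\<in>A. cis (f a))" if "finite A" for f and A :: "nat set"
    using that by (induction A) (auto simp: cis_mult[symmetric])
  have e1: "(\<integral>\<omega>. ?F (\<omega> k) \<partial>Om) = complex_of_real (exp (- (\<integral>z. ?c k z \<partial>lborel)))" for k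
  proof -
    have "(\<integral>\<omega>. ?F (\<omega> k) \<partial>Om) = (\<integral>z. ?F z \<partial>block k)"
      unfolding Om_def by (subst Om.PiM_component[of k, symmetric], simp, subst integral_distr) auto
    also have "\<dots> = exp (\<integral>z. (?\<phi> z - 1) * of_real (g k z) \<partial>lborel)"
      by (rule block_char) auto
    also have "\<dots> = complex_of_real (exp (- (\<integral>z. ?c k z \<partial>lborel)))"
      by (subst integral_sin_vanishes) (auto simp: exp_of_real[symmetric])
    finally show ?thesis .
  qed
  have ind: "indep_vars (\<lambda>_. borel) (\<lambda>k \<omega>. ?F (\<omega> k)) J"
    unfolding Om_def
    by (rule Om.P.indep_vars_compose2[OF Om.P.indep_vars_subset[OF Om.indep_vars_coordinates]]) simp_all
  have "(\<integral>\<omega>. cis (\<Sum>k\<in>J. \<Sum>i<fst (\<omega> k). \<eta> (fst (snd (\<omega> k) i)) \<bullet> snd (snd (\<omega> k) i)) \<partial>Om)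
      = (\<integral>\<omega>. (\<Prod>k\<in>J. ?F (\<omega> k)) \<partial>Om)"
    using J by (simp add: cs)
  also have "\<dots> = (\<Prod>k\<in>J. \<integral>\<omega>. ?F (\<omega> k) \<partial>Om)"
    using J ind by (rule indep_vars_lebesgue_integral)
      (rule integrable_const_bound[where B=1], auto simp: prod_norm[symmetric])
  also have "\<dots> = complex_of_real (exp (- (\<Sum>k\<in>J. \<integral>z. ?c k z \<partial>lborel)))"
    by (simp only: e1 of_real_prod[symmetric] exp_sum[OF J, symmetric] sum_negf)
  also have "(\<Sum>k\<in>J. \<integral>z. ?c k z \<partial>lborel) = (\<integral>z. (1 - cos (\<eta> (fst z) \<bullet> snd z)) * (\<Sum>k\<in>J. g k z) \<partial>lborel)"
    by (subst Bochner_Integration.integral_sum[symmetric]) (auto simp: sum_distrib_left ic)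
  finally show ?thesis .
qed

text \<open>A combination of increments is the sum over all marks of \<open>he\<close> at the jump
  time, paired with the jump size, for a step function \<open>he\<close>; so \<open>Om_char\<close>
  applies. By \<open>G\<close> the summed intensity is Lebesgue measure in time times
  \<open>h\<close> in space up to T, hence the exponent splits over the grid intervals.\<close>

lemma S_levy_char:
  fixes h :: "'b \<Rightarrow> real"
  assumes J: "finite J" and [measurable]: "h \<in> borel_measurable borel" and h: "integrable lborel h"
    and G: "\<And>u x. u \<le> T \<Longrightarrow> (\<Sum>k\<in>J. g k (u, x)) = (if 0 < u then h x else 0)"
  shows "levy_char Om (S J) T (\<lambda>\<xi>. \<integral>x. (1 - cos (\<xi> \<bullet> x)) * h x \<partial>lborel)"
  unfolding levy_char_def
proof (intro allI impI, elim conjE)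
  fix n s and \<eta> :: "nat \<Rightarrow> 'b"
  assume s0: "0 \<le> s 0" and sm: "\<forall>i<n. s i < s (Suc i)" and sn: "s n \<le> T"
  have mono: "s i \<le> s j" if "i \<le> j" "j \<le> n" for i j
    by (rule strict_grid_mono[of n]) (use sm that in blast)+
  \<comment> \<open>There is no lower bound for i = 0, because \<open>jump\<close> counts every mark
    with time at most \<open>s 0\<close>. Marks at nonpositive times have zero intensity by
    \<open>G\<close> and disappear in \<open>B\<close>.\<close>
  define ind where "ind i u \<longleftrightarrow> (if i = 0 then u \<le> s 0 else s (i - 1) < u \<and> u \<le> s i)" for i u
  define he where "he u = (\<Sum>i\<le>n. if ind i u then \<eta> i else 0)" for u
  have [measurable]: "he \<in> borel_measurable borel" unfolding he_def ind_def by measurable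
  have jd: "jump (s i) z - jump (s (i - 1)) z = (if ind i (fst z) then snd z else 0)" if "0 < i" "i \<le> n" for i z
    using that mono[of "i - 1" i] by (auto simp: jump_def ind_def)
  have inc: "incr s (S J) i \<omega> = (\<Sum>k\<in>J. \<Sum>l<fst (\<omega> k). if ind i (fst (snd (\<omega> k) l)) then snd (snd (\<omega> k) l) else 0)"
    if "i \<le> n" for i \<omega>
  proof (cases "i = 0")
    case True
    then show ?thesis by (simp add: incr_def S_def Z_def jump_def ind_def)
  next
    case False
    then have "incr s (S J) i \<omega> = (\<Sum>k\<in>J. \<Sum>l<fst (\<omega> k). jump (s i) (snd (\<omega> k) l) - jump (s (i - 1)) (snd (\<omega> k) l))"
      by (simp add: incr_def S_def Z_def sum_subtractf)
    then show ?thesis using False that by (simp add: jd[simplified])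
  qed
  have A: "(\<Prod>i\<le>n. cis (\<eta> i \<bullet> incr s (S J) i \<omega>))
      = cis (\<Sum>k\<in>J. \<Sum>l<fst (\<omega> k). he (fst (snd (\<omega> k) l)) \<bullet> snd (snd (\<omega> k) l))" for \<omega>
  proof -
    have "(\<Sum>i\<le>n. \<eta> i \<bullet> incr s (S J) i \<omega>)
       = (\<Sum>i\<le>n. \<Sum>k\<in>J. \<Sum>l<fst (\<omega> k). (if ind i (fst (snd (\<omega> k) l)) then \<eta> i else 0) \<bullet> snd (snd (\<omega> k) l))"
      by (intro sum.cong refl) (auto simp: inc inner_sum_right intro!: sum.cong)
    also have "\<dots> = (\<Sum>k\<in>J. \<Sum>i\<le>n. \<Sum>l<fst (\<omega> k). (if ind i (fst (snd (\<omega> k) l)) then \<eta> i else 0) \<bullet> snd (snd (\<omega> k) l))"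
      by (rule sum.swap)
    also have "\<dots> = (\<Sum>k\<in>J. \<Sum>l<fst (\<omega> k). \<Sum>i\<le>n. (if ind i (fst (snd (\<omega> k) l)) then \<eta> i else 0) \<bullet> snd (snd (\<omega> k) l))"
      by (intro sum.cong refl sum.swap)
    also have "\<dots> = (\<Sum>k\<in>J. \<Sum>l<fst (\<omega> k). he (fst (snd (\<omega> k) l)) \<bullet> snd (snd (\<omega> k) l))"
      by (simp add: he_def inner_sum_left)
    finally show ?thesis by (simp add: cis_sum[symmetric])
  qed
  let ?A = "\<lambda>i. {grid_start s i<..s i}"
  let ?F = "\<lambda>i x. (1 - cos (\<eta> i \<bullet> x)) * h x"
  have indA: "ind i u \<and> 0 < u \<longleftrightarrow> u \<in> ?A i" if "i \<le> n" for i u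
    using that s0 mono[OF le0 order_trans[OF diff_le_self that], of 1] by (auto simp: ind_def grid_start_def)
  have disj: "i = j" if "ind i u" "ind j u" "i \<le> n" "j \<le> n" for i j u
  proof (rule ccontr)
    assume "i \<noteq> j"
    have False if "ind i u" "ind j u" "i < j" "j \<le> n" for i j
    proof -
      have "s i \<le> s (j - 1)" using that by (intro mono; linarith)
      then show False using that by (auto simp: ind_def split: if_splits)
    qed
    then show False using that \<open>i \<noteq> j\<close> by (metis linorder_neqE_nat)
  qed
  have B: "(1 - cos (he (fst z) \<bullet> snd z)) * (\<Sum>k\<in>J. g k z) = (\<Sum>i\<le>n. indicator (?A i) (fst z) * ?F i (snd z))" for z
  proof (cases "\<exists>i\<le>n. ind i (fst z)")
    case True
    then obtain i where i: "i \<le> n" "ind i (fst z)" by auto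
    have "ind j (fst z) \<longleftrightarrow> j = i" if "j \<le> n" for j using disj[of j "fst z" i] i that by auto
    then have "he (fst z) = (\<Sum>j\<le>n. if j = i then \<eta> j else 0)" unfolding he_def by (intro sum.cong) auto
    then have he: "he (fst z) = \<eta> i" using i by simp
    have uT: "fst z \<le> T" using i mono[of i n] sn by (auto simp: ind_def split: if_splits)
    have "(\<Sum>k\<in>J. g k z) = (if 0 < fst z then h (snd z) else 0)" using G[OF uT, of "snd z"] by simp
    moreover have "indicator (?A j) (fst z) = (if j = i \<and> 0 < fst z then 1 else 0 :: real)" if "j \<le> n" for j
    proof -
      have "fst z \<in> ?A j \<longleftrightarrow> j = i \<and> 0 < fst z"
        using indA[OF that, of "fst z"] disj[of j "fst z" i] i that by blast
      then show ?thesis by (simp only: indicator_def of_bool_def)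
    qed
    then have "(\<Sum>j\<le>n. indicator (?A j) (fst z) * ?F j (snd z)) = (\<Sum>j\<le>n. if j = i then (if 0 < fst z then ?F i (snd z) else 0) else 0)"
      by (intro sum.cong) auto
    ultimately show ?thesis using i he by simp
  next
    case False
    then have "he (fst z) = 0" by (simp add: he_def)
    moreover have "indicator (?A j) (fst z) = (0 :: real)" if "j \<le> n" for j
    proof -
      have "fst z \<notin> ?A j" using indA[OF that, of "fst z"] False that by blast
      then show ?thesis by (simp only: indicator_def of_bool_def if_False)
    qed
    ultimately show ?thesis by simp
  qed
  have Fi: "integrable lborel (?F i)" for i
  proof (rule Bochner_Integration.integrable_bound[OF integrable_mult_right[OF h, of 2]])
    have "\<bar>1 - cos t\<bar> \<le> 2" for t :: real using cos_le_one[of t] cos_ge_minus_one[of t] by linarith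
    then show "AE x in lborel. norm (?F i x) \<le> norm (2 * h x)"
      by (auto simp: abs_mult intro!: mult_right_mono)
  qed simp
  have Ai: "integrable lborel (indicator (?A i) :: real \<Rightarrow> real)" for i
    by (cases "grid_start s i \<le> s i") (auto intro!: integrable_real_indicator)
  have len: "grid_start s i \<le> s i" if "i \<le> n" for i
    using that s0 mono[of "i - 1" i] by (auto simp: grid_start_def)
  have "(\<integral>\<omega>. (\<Prod>i\<le>n. cis (\<eta> i \<bullet> incr s (S J) i \<omega>)) \<partial>Om)
      = complex_of_real (exp (- (\<integral>z. (1 - cos (he (fst z) \<bullet> snd z)) * (\<Sum>k\<in>J. g k z) \<partial>lborel)))"
    unfolding A by (rule Om_char) (auto simp: J)
  also have "(\<integral>z. (1 - cos (he (fst z) \<bullet> snd z)) * (\<Sum>k\<in>J. g k z) \<partial>lborel)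
      = (\<Sum>i\<le>n. \<integral>z. indicator (?A i) (fst z) * ?F i (snd z) \<partial>lborel)"
    unfolding B by (rule Bochner_Integration.integral_sum) (rule lborel_prod_integrable_times(1)[OF Ai Fi])
  also have "\<dots> = (\<Sum>i\<le>n. (s i - grid_start s i) * (\<integral>x. ?F i x \<partial>lborel))"
    by (intro sum.cong refl) (simp add: lborel_prod_integrable_times(2)[OF Ai Fi] len)
  finally show "(\<integral>\<omega>. (\<Prod>i\<le>n. cis (\<eta> i \<bullet> incr s (S J) i \<omega>)) \<partial>Om)
       = complex_of_real (\<Prod>i\<le>n. exp (- ((s i - grid_start s i) * (\<integral>x. ?F i x \<partial>lborel))))"
    by (simp only: sum_negf[symmetric] exp_sum[OF finite_atMost])
qed

end

section \<open>A maximal inequality\<close>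

lemma (in prob_space) levy_char_single:
  assumes lc: "levy_char M Y T \<Psi>" and t: "0 \<le> t" "t \<le> T"
  shows "(\<integral>\<omega>. cis (\<xi> \<bullet> Y t \<omega>) \<partial>M) = complex_of_real (exp (- (t * \<Psi> \<xi>)))"
  using lc[unfolded levy_char_def, rule_format, of "\<lambda>_. t" 0 "\<lambda>_. \<xi>"] t
  by (simp add: incr_def grid_start_def)

text \<open>A grid of two points with frequency 0 on the first increment, whose factor is 1 by
  \<open>P0\<close>. Grids are strictly increasing, so s = t is treated apart.\<close>

lemma (in prob_space) levy_char_increment:
  assumes lc: "levy_char M Y T \<Psi>" and P0: "\<Psi> 0 = 0" and t: "0 \<le> s" "s \<le> t" "t \<le> T"
  shows "(\<integral>\<omega>. cis (\<xi> \<bullet> (Y t \<omega> - Y s \<omega>)) \<partial>M) = complex_of_real (exp (- ((t - s) * \<Psi> \<xi>)))"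
proof (cases "s = t")
  case True then show ?thesis by (simp add: prob_space)
next
  case False
  have "{..Suc 0} = {0, Suc 0}" by auto
  then show ?thesis
    using lc[unfolded levy_char_def, rule_format, of "\<lambda>i. if i = 0 then s else t" 1 "\<lambda>i. if i = 0 then 0 else \<xi>"] t False
    by (simp add: incr_def grid_start_def P0)
qed

text \<open>Setting all frequencies but one to 0 identifies the single characteristic functions, and
  the joint one is visibly their product.\<close>

lemma (in prob_space) levy_char_indep:
  assumes lc: "levy_char M Y T \<Psi>" and P0: "\<Psi> 0 = 0" and Ym: "\<And>t. Y t \<in> borel_measurable M"
    and s: "0 \<le> s 0" "\<And>i. i < n \<Longrightarrow> s i < s (Suc i)" "s n \<le> T"
  shows "indep_vars (\<lambda>_. borel) (incr s Y) {..n}"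
proof (rule indep_vars_of_char)
  note Ym[measurable]
  show "incr s Y i \<in> borel_measurable M" for i unfolding incr_def by (cases "i = 0") simp_all
  have all: "(\<integral>\<omega>. (\<Prod>i\<le>n. cis (\<eta> i \<bullet> incr s Y i \<omega>)) \<partial>M)
       = complex_of_real (\<Prod>i\<le>n. exp (- ((s i - grid_start s i) * \<Psi> (\<eta> i))))" for \<eta>
    using lc[unfolded levy_char_def, rule_format, of s n \<eta>] s by blast
  have one: "(\<integral>\<omega>. cis (\<eta> i \<bullet> incr s Y i \<omega>) \<partial>M) = complex_of_real (exp (- ((s i - grid_start s i) * \<Psi> (\<eta> i))))"
    if i: "i \<le> n" for \<eta> i
  proof -
    let ?e = "\<lambda>j. if j = i then \<eta> i else 0"
    have a: "(\<Prod>j\<le>n. cis (?e j \<bullet> incr s Y j \<omega>)) = (\<Prod>j\<le>n. if j = i then cis (\<eta> i \<bullet> incr s Y i \<omega>) else 1)" for \<omega>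
      by (intro prod.cong refl) simp
    have b: "(\<Prod>j\<le>n. exp (- ((s j - grid_start s j) * \<Psi> (?e j)))) = (\<Prod>j\<le>n. if j = i then exp (- ((s i - grid_start s i) * \<Psi> (\<eta> i))) else 1)"
      by (intro prod.cong refl) (simp add: P0)
    show ?thesis using all[of ?e] i by (simp only: a b) (simp add: prod.delta)
  qed
  show "(\<integral>w. (\<Prod>i\<le>n. cis (\<eta> i \<bullet> incr s Y i w)) \<partial>M) = (\<Prod>i\<le>n. \<integral>w. cis (\<eta> i \<bullet> incr s Y i w) \<partial>M)" for \<eta>
    unfolding all of_real_prod by (intro prod.cong refl one[symmetric]) simp
qed simp_all

lemma sum_incr: "(\<Sum>i\<le>j. incr s Y i \<omega>) = Y (s j) \<omega>"
  by (induction j) (auto simp: incr_def)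

text \<open>\<open>A j\<close> says that the partial sums exceed 2 e for the first time at index j,
  and \<open>B j\<close> that the rest of the sum stays below e. The two are independent,
  \<open>B j\<close> has probability at least 1/2, together they push the full sum above e, and the
  \<open>A j\<close> are disjoint.\<close>

lemma (in prob_space) ottaviani:
  fixes D :: "nat \<Rightarrow> 'a \<Rightarrow> 'b::euclidean_space"
  assumes ind: "indep_vars (\<lambda>_. borel) D {..n}" and Dm: "\<And>i. D i \<in> borel_measurable M"
    and small: "\<And>j. j \<le> n \<Longrightarrow> prob {\<omega>\<in>space M. e \<le> norm (\<Sum>i\<in>{j<..n}. D i \<omega>)} \<le> 1 / 2"
  shows "prob {\<omega>\<in>space M. \<exists>j\<le>n. 2 * e < norm (\<Sum>i\<le>j. D i \<omega>)} \<le> 2 * prob {\<omega>\<in>space M. e \<le> norm (\<Sum>i\<le>n. D i \<omega>)}"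
proof -
  note Dm[measurable]
  define A where "A j = {\<omega>\<in>space M. 2 * e < norm (\<Sum>i\<le>j. D i \<omega>) \<and> (\<forall>l<j. norm (\<Sum>i\<le>l. D i \<omega>) \<le> 2 * e)}" for j
  define B where "B j = {\<omega>\<in>space M. norm (\<Sum>i\<in>{j<..n}. D i \<omega>) < e}" for j
  have [measurable]: "A j \<in> events" "B j \<in> events" for j unfolding A_def B_def by measurable
  have half: "prob (A j) * (1 / 2) \<le> prob (A j \<inter> B j)" if j: "j \<le> n" for j
  proof -
    let ?u = "\<lambda>f. if 2 * e < norm (\<Sum>i\<le>j. f i :: 'b) \<and> (\<forall>l<j. norm (\<Sum>i\<le>l. f i) \<le> 2 * e) then 1 else 0 :: real"
    let ?v = "\<lambda>f. norm (\<Sum>i\<in>{j<..n}. f i :: 'b)"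
    have um: "?u \<in> borel_measurable (PiM {..j} (\<lambda>_. borel))"
    proof -
      have [measurable]: "(\<lambda>f. \<Sum>i\<le>l. f i :: 'b) \<in> borel_measurable (PiM {..j} (\<lambda>_. borel))" if "l \<le> j" for l
        using that by (intro borel_measurable_sum measurable_component_singleton) auto
      show ?thesis by measurable
    qed
    have vm: "?v \<in> borel_measurable (PiM {j<..n} (\<lambda>_. borel))"
    proof -
      have [measurable]: "(\<lambda>f. \<Sum>i\<in>{j<..n}. f i :: 'b) \<in> borel_measurable (PiM {j<..n} (\<lambda>_. borel))"
        by (intro borel_measurable_sum measurable_component_singleton) auto
      show ?thesis by measurable
    qed
    have "indep_var borel (?u \<circ> (\<lambda>\<omega>. restrict (\<lambda>i. D i \<omega>) {..j})) borel (?v \<circ> (\<lambda>\<omega>. restrict (\<lambda>i. D i \<omega>) {j<..n}))"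
      by (rule indep_var_compose[OF indep_var_restrict[OF ind] um vm]) (use j in auto)
    then have "prob {\<omega>\<in>space M. (?u \<circ> (\<lambda>\<omega>. restrict (\<lambda>i. D i \<omega>) {..j})) \<omega> \<in> {1} \<and>
         (?v \<circ> (\<lambda>\<omega>. restrict (\<lambda>i. D i \<omega>) {j<..n})) \<omega> \<in> {..<e}}
       = prob {\<omega>\<in>space M. (?u \<circ> (\<lambda>\<omega>. restrict (\<lambda>i. D i \<omega>) {..j})) \<omega> \<in> {1}} *
         prob {\<omega>\<in>space M. (?v \<circ> (\<lambda>\<omega>. restrict (\<lambda>i. D i \<omega>) {j<..n})) \<omega> \<in> {..<e}}"
      by (rule prob_indep_random_variable) auto
    moreover have "{\<omega>\<in>space M. (?u \<circ> (\<lambda>\<omega>. restrict (\<lambda>i. D i \<omega>) {..j})) \<omega> \<in> {1} \<and>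
         (?v \<circ> (\<lambda>\<omega>. restrict (\<lambda>i. D i \<omega>) {j<..n})) \<omega> \<in> {..<e}} = A j \<inter> B j"
      and "{\<omega>\<in>space M. (?u \<circ> (\<lambda>\<omega>. restrict (\<lambda>i. D i \<omega>) {..j})) \<omega> \<in> {1}} = A j"
      and "{\<omega>\<in>space M. (?v \<circ> (\<lambda>\<omega>. restrict (\<lambda>i. D i \<omega>) {j<..n})) \<omega> \<in> {..<e}} = B j"
      unfolding A_def B_def by auto
    ultimately have "prob (A j \<inter> B j) = prob (A j) * prob (B j)" by simp
    moreover have "1 / 2 \<le> prob (B j)"
    proof -
      have "prob (B j) = 1 - prob {\<omega>\<in>space M. e \<le> norm (\<Sum>i\<in>{j<..n}. D i \<omega>)}"
        by (subst prob_compl[symmetric]) (auto simp: B_def intro!: arg_cong[where f=prob])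
      then show ?thesis using small[OF j] by linarith
    qed
    ultimately show ?thesis by (simp only:) (rule mult_left_mono, simp_all)
  qed
  have disj: "disjoint_family_on A {..n}"
  proof (unfold disjoint_family_on_def, intro ballI impI)
    have aux: "A i \<inter> A j = {}" if "i < j" for i j using that unfolding A_def by force
    fix i j :: nat assume "i \<noteq> j"
    then show "A i \<inter> A j = {}" using aux[of i j] aux[of j i] by (cases "i < j") auto
  qed
  have ex: "{\<omega>\<in>space M. \<exists>j\<le>n. 2 * e < norm (\<Sum>i\<le>j. D i \<omega>)} = (\<Union>j\<le>n. A j)"
  proof (intro equalityI subsetI)
    fix \<omega> assume w: "\<omega> \<in> {\<omega>\<in>space M. \<exists>j\<le>n. 2 * e < norm (\<Sum>i\<le>j. D i \<omega>)}"
    define j where "j = (LEAST j. 2 * e < norm (\<Sum>i\<le>j. D i \<omega>))"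
    obtain j0 where j0: "j0 \<le> n" "2 * e < norm (\<Sum>i\<le>j0. D i \<omega>)" using w by blast
    have 1: "2 * e < norm (\<Sum>i\<le>j. D i \<omega>)" unfolding j_def using j0(2) by (rule LeastI)
    have 2: "j \<le> n" unfolding j_def using Least_le[of "\<lambda>j. 2 * e < norm (\<Sum>i\<le>j. D i \<omega>)", OF j0(2)] j0(1) by linarith
    have 3: "norm (\<Sum>i\<le>l. D i \<omega>) \<le> 2 * e" if "l < j" for l
      using not_less_Least[OF that[unfolded j_def]] by linarith
    have "\<omega> \<in> A j" using w 1 3 by (simp add: A_def)
    then show "\<omega> \<in> (\<Union>j\<le>n. A j)" using 2 by blast
  qed (auto simp: A_def)
  have sub: "(\<Union>j\<le>n. A j \<inter> B j) \<subseteq> {\<omega>\<in>space M. e \<le> norm (\<Sum>i\<le>n. D i \<omega>)}"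
  proof
    fix \<omega> assume "\<omega> \<in> (\<Union>j\<le>n. A j \<inter> B j)"
    then obtain j where j: "j \<le> n" "\<omega> \<in> A j" "\<omega> \<in> B j" by blast
    have "{..n} = {..j} \<union> {j<..n}" using j(1) by auto
    then have "(\<Sum>i\<le>n. D i \<omega>) = (\<Sum>i\<le>j. D i \<omega>) + (\<Sum>i\<in>{j<..n}. D i \<omega>)"
      by (metis finite_atMost finite_greaterThanAtMost ivl_disj_int_one(3) sum.union_disjoint)
    moreover have "2 * e < norm (\<Sum>i\<le>j. D i \<omega>)" "norm (\<Sum>i\<in>{j<..n}. D i \<omega>) < e"
      using j by (auto simp: A_def B_def)
    ultimately show "\<omega> \<in> {\<omega>\<in>space M. e \<le> norm (\<Sum>i\<le>n. D i \<omega>)}"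
      using norm_diff_ineq[of "\<Sum>i\<le>j. D i \<omega>" "\<Sum>i\<in>{j<..n}. D i \<omega>"] j(2) by (simp add: A_def)
  qed
  have "prob (\<Union>j\<le>n. A j) = (\<Sum>j\<le>n. prob (A j))"
    by (rule finite_measure_finite_Union) (use disj in auto)
  also have "\<dots> \<le> (\<Sum>j\<le>n. 2 * prob (A j \<inter> B j))"
    by (intro sum_mono) (use half in fastforce)
  also have "\<dots> = 2 * prob (\<Union>j\<le>n. A j \<inter> B j)"
    by (subst finite_measure_finite_Union) (use disj in \<open>auto simp: sum_distrib_left disjoint_family_on_def\<close>)
  also have "\<dots> \<le> 2 * prob {\<omega>\<in>space M. e \<le> norm (\<Sum>i\<le>n. D i \<omega>)}"
    by (intro mult_left_mono finite_measure_mono sub) auto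
  finally show ?thesis unfolding ex .
qed

definition gauss_moment :: "'a::euclidean_space itself \<Rightarrow> real" where
  "gauss_moment _ = (\<integral>g. (norm (g::'a))\<^sup>2 \<partial>gauss)"

text \<open>With 1 - exp (-x) \<le> x the tail bound by the characteristic function becomes a
  Chebyshev inequality in which \<open>c\<close> plays the part of a variance.\<close>

lemma (in prob_space) prob_norm_ge_quadratic:
  fixes Y :: "'a \<Rightarrow> 'b::euclidean_space"
  assumes [measurable]: "Y \<in> borel_measurable M" and e: "0 < e" and l: "0 \<le> l"
    and ch: "\<And>\<xi>. (\<integral>w. cis (\<xi> \<bullet> Y w) \<partial>M) = complex_of_real (exp (- (l * \<Psi> \<xi>)))"
    and P: "\<And>\<xi>. 0 \<le> \<Psi> \<xi>" "\<And>\<xi>. \<Psi> \<xi> \<le> c * (norm \<xi>)\<^sup>2"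
  shows "prob {w\<in>space M. e \<le> norm (Y w)} \<le> 3 * l * c * gauss_moment TYPE('b) / e\<^sup>2"
proof -
  have "(\<lambda>\<xi>. Re (\<integral>w. cis (\<xi> \<bullet> Y w) \<partial>M)) \<in> borel_measurable borel" by measurable
  then have phm[measurable]: "(\<lambda>\<xi>. exp (- (l * \<Psi> \<xi>))) \<in> borel_measurable borel" by (simp add: ch)
  have "prob {w\<in>space M. e \<le> norm (Y w)} \<le> 3 * (\<integral>g. 1 - exp (- (l * \<Psi> (g /\<^sub>R e))) \<partial>gauss)"
    by (rule prob_norm_ge_le_char[OF prob_space_axioms _ e ch]) simp
  also have "(\<integral>g. 1 - exp (- (l * \<Psi> (g /\<^sub>R e))) \<partial>gauss) \<le> (\<integral>g. (l * c / e\<^sup>2) * (norm (g::'b))\<^sup>2 \<partial>gauss)"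
  proof (rule integral_mono)
    have b: "0 \<le> exp (- (l * \<Psi> \<xi>))" "exp (- (l * \<Psi> \<xi>)) \<le> 1" for \<xi> using P(1)[of \<xi>] l by auto
    have m: "(\<lambda>g. exp (- (l * \<Psi> (g /\<^sub>R e)))) \<in> borel_measurable borel"
      by (rule measurable_compose[OF _ phm]) simp
    show "integrable gauss (\<lambda>g. 1 - exp (- (l * \<Psi> (g /\<^sub>R e))))"
    proof (rule gauss.integrable_const_bound[where B=1])
      show "AE g in gauss. norm (1 - exp (- (l * \<Psi> (g /\<^sub>R e)))) \<le> 1"
        using b by (intro AE_I2) (simp add: abs_le_iff)
      show "(\<lambda>g. 1 - exp (- (l * \<Psi> (g /\<^sub>R e)))) \<in> borel_measurable gauss"
        using m by (subst measurable_cong_sets[OF sets_gauss refl]) (rule borel_measurable_diff, simp_all)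
    qed
    show "integrable gauss (\<lambda>g::'b. (l * c / e\<^sup>2) * (norm g)\<^sup>2)"
      by (rule integrable_mult_right[OF integrable_gauss_norm2])
    fix g :: 'b
    have "1 - exp (- (l * \<Psi> (g /\<^sub>R e))) \<le> l * \<Psi> (g /\<^sub>R e)"
      using exp_ge_add_one_self[of "- (l * \<Psi> (g /\<^sub>R e))"] by linarith
    also have "\<dots> \<le> l * (c * (norm (g /\<^sub>R e))\<^sup>2)" using P(2) l by (rule mult_left_mono)
    also have "\<dots> = (l * c / e\<^sup>2) * (norm g)\<^sup>2" using e by (simp add: power_mult_distrib power_inverse divide_inverse)
    finally show "1 - exp (- (l * \<Psi> (g /\<^sub>R e))) \<le> (l * c / e\<^sup>2) * (norm g)\<^sup>2" .
  qed
  finally show ?thesis by (simp add: gauss_moment_def)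
qed

text \<open>Ottaviani's inequality on dyadic grids gives a bound independent of the mesh, the
  exceptional sets grow under refinement, and right continuity carries the bound from grid times to
  all times below T. Producing an exceptional event avoids the measurability of an uncountable
  supremum.\<close>

lemma (in prob_space) levy_maximal:
  fixes Y :: "real \<Rightarrow> 'a \<Rightarrow> 'b::euclidean_space"
  assumes Ym: "\<And>t. Y t \<in> borel_measurable M" and lc: "levy_char M Y T \<Psi>" and P0: "\<Psi> 0 = 0"
    and P: "\<And>\<xi>. 0 \<le> \<Psi> \<xi>" "\<And>\<xi>. \<Psi> \<xi> \<le> c * (norm \<xi>)\<^sup>2" and c: "0 \<le> c" and T: "0 < T" and e: "0 < e"
    and rc: "\<And>\<omega> t. \<omega> \<in> space M \<Longrightarrow> ((\<lambda>s. Y s \<omega>) \<longlongrightarrow> Y t \<omega>) (at_right t)"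
  shows "\<exists>A\<in>events. prob A \<le> 6 * T * c * gauss_moment TYPE('b) / e\<^sup>2 \<and>
     (\<forall>\<omega>\<in>space M - A. \<forall>t. 0 \<le> t \<and> t < T \<longrightarrow> norm (Y t \<omega>) \<le> 2 * e)"
proof -
  note Ym[measurable]
  \<comment> \<open>Half of the claimed bound. If it exceeds 1/2, the whole space serves as
    exceptional event; otherwise it is the smallness that \<open>ottaviani\<close> demands.\<close>
  define b where "b = 3 * T * c * gauss_moment TYPE('b) / e\<^sup>2"
  have gm: "0 \<le> gauss_moment TYPE('b)" unfolding gauss_moment_def by simp
  have tail: "prob {w\<in>space M. e \<le> norm (Y t w - Y s w)} \<le> b" if "0 \<le> s" "s \<le> t" "t \<le> T" for s t
  proof -
    have "prob {w\<in>space M. e \<le> norm (Y t w - Y s w)} \<le> 3 * (t - s) * c * gauss_moment TYPE('b) / e\<^sup>2"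
      by (rule prob_norm_ge_quadratic[OF _ e _ levy_char_increment[OF lc P0 that] P]) (use that in auto)
    also have "\<dots> \<le> b" unfolding b_def using that c gm
      by (intro divide_right_mono mult_right_mono) auto
    finally show ?thesis .
  qed
  have tail0: "prob {w\<in>space M. e \<le> norm (Y T w)} \<le> b"
    unfolding b_def using T by (intro prob_norm_ge_quadratic[OF _ e _ levy_char_single[OF lc] P]) auto
  show ?thesis
  proof (cases "b \<le> 1 / 2")
    case False
    then have "prob (space M) \<le> 6 * T * c * gauss_moment TYPE('b) / e\<^sup>2" by (simp add: b_def prob_space)
    then show ?thesis by (intro bexI[of _ "space M"]) auto
  next
    case True
    \<comment> \<open>The grid starts at T / 2^m, since the first increment already begins at time
      0; the index 2^m - 1 is then the time T.\<close>
    define s where "s m i = real (Suc i) * T / 2 ^ m" for m i :: nat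
    define E where "E m = {\<omega>\<in>space M. \<exists>j\<le>2 ^ m - 1. 2 * e < norm (Y (s m j) \<omega>)}" for m :: nat
    have [measurable]: "E m \<in> events" for m unfolding E_def by measurable
    have s_last: "s m (2 ^ m - 1) = T" for m by (simp add: s_def of_nat_diff)
    have s_le: "s m j \<le> T" if "j \<le> 2 ^ m - 1" for m j
    proof -
      have "(0::nat) < 2 ^ m" by simp
      then have "Suc j \<le> 2 ^ m" using that by linarith
      then have "real (Suc j) \<le> real (2 ^ m)" by (simp only: of_nat_le_iff)
      then show ?thesis using T by (simp add: s_def divide_le_eq)
    qed
    have s_pos: "0 < s m j" for m j using T by (simp add: s_def)
    have s_mono: "s m i < s m (Suc i)" for m i using T by (simp add: s_def divide_strict_right_mono)
    have PE: "prob (E m) \<le> 2 * b" for m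
    proof -
      let ?D = "incr (s m) Y" and ?n = "2 ^ m - 1 :: nat"
      have "prob {\<omega>\<in>space M. \<exists>j\<le>?n. 2 * e < norm (\<Sum>i\<le>j. ?D i \<omega>)} \<le> 2 * prob {\<omega>\<in>space M. e \<le> norm (\<Sum>i\<le>?n. ?D i \<omega>)}"
      proof (rule ottaviani)
        show "indep_vars (\<lambda>_. borel) ?D {..?n}"
          by (rule levy_char_indep[OF lc P0 Ym]) (simp_all add: s_pos s_mono s_last less_imp_le del: One_nat_def)
        show "?D i \<in> borel_measurable M" for i unfolding incr_def by (cases "i = 0") simp_all
        fix j assume j: "j \<le> ?n"
        have "{..?n} = {..j} \<union> {j<..?n}" using j by auto
        then have "(\<Sum>i\<le>?n. ?D i \<omega>) = (\<Sum>i\<le>j. ?D i \<omega>) + (\<Sum>i\<in>{j<..?n}. ?D i \<omega>)" for \<omega>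
          by (metis finite_atMost finite_greaterThanAtMost ivl_disj_int_one(3) sum.union_disjoint)
        then have "(\<Sum>i\<in>{j<..?n}. ?D i \<omega>) = Y T \<omega> - Y (s m j) \<omega>" for \<omega>
          unfolding sum_incr s_last by (metis add_diff_cancel_left')
        then show "prob {\<omega>\<in>space M. e \<le> norm (\<Sum>i\<in>{j<..?n}. ?D i \<omega>)} \<le> 1 / 2"
          using tail[OF less_imp_le[OF s_pos] s_le[OF j] order_refl] True by simp
      qed
      then have "prob (E m) \<le> 2 * prob {\<omega>\<in>space M. e \<le> norm (Y T \<omega>)}"
        unfolding sum_incr s_last E_def .
      then show ?thesis using tail0 by linarith
    qed
    have inc: "incseq E"
    proof (rule incseq_SucI, rule subsetI)
      fix m \<omega> assume "\<omega> \<in> E m"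
      then obtain j where j: "\<omega> \<in> space M" "j \<le> 2 ^ m - 1" "2 * e < norm (Y (s m j) \<omega>)" unfolding E_def by blast
      have "s (Suc m) (2 * j + 1) = s m j" by (simp add: s_def field_simps)
      moreover have "2 * j + 1 \<le> 2 ^ Suc m - 1"
      proof -
        have "(0::nat) < 2 ^ m" by simp
        then have "2 * j + 1 \<le> 2 * 2 ^ m - 1" using j(2) by linarith
        then show ?thesis by simp
      qed
      ultimately show "\<omega> \<in> E (Suc m)" unfolding E_def using j by force
    qed
    have "prob (\<Union>m. E m) \<le> 2 * b"
      by (rule LIMSEQ_le_const2[OF finite_Lim_measure_incseq[OF _ inc]]) (use PE in auto)
    moreover have "norm (Y t \<omega>) \<le> 2 * e" if w: "\<omega> \<in> space M - (\<Union>m. E m)" and t: "0 \<le> t" "t < T" for \<omega> t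
    proof -
      \<comment> \<open>\<open>s m (j m)\<close> is the first grid time strictly above t; strictness
        is what an approach from the right requires.\<close>
      define j where "j m = nat \<lfloor>t * 2 ^ m / T\<rfloor>" for m :: nat
      have fl: "real (j m) = of_int \<lfloor>t * 2 ^ m / T\<rfloor>" for m using t by (simp add: j_def)
      have gt: "t < s m (j m)" for m
      proof -
        have "t * 2 ^ m / T < real (Suc (j m))" using fl[of m] by linarith
        then show ?thesis using T by (simp add: s_def field_simps)
      qed
      have le: "s m (j m) \<le> t + T / 2 ^ m" for m
      proof -
        have "real (j m) \<le> t * 2 ^ m / T" using fl[of m] by linarith
        then have "real (j m) * T \<le> t * 2 ^ m" using T by (simp add: field_simps)
        then show ?thesis using T by (simp add: s_def field_simps)
      qed
      have jm: "j m \<le> 2 ^ m - 1" for m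
      proof -
        have "real (j m) \<le> t * 2 ^ m / T" using fl[of m] by linarith
        also have "\<dots> < 2 ^ m" using t T by (simp add: field_simps)
        finally have "j m < 2 ^ m" by (metis of_nat_less_iff of_nat_numeral of_nat_power)
        then show ?thesis by linarith
      qed
      have lim: "(\<lambda>m. s m (j m)) \<longlonglongrightarrow> t"
      proof (rule tendsto_sandwich[where f="\<lambda>_. t" and h="\<lambda>m. t + T / 2 ^ m"])
        have "(\<lambda>m. t + T * (1 / 2) ^ m) \<longlonglongrightarrow> t + T * 0"
          by (intro tendsto_intros LIMSEQ_power_zero) simp
        then show "(\<lambda>m. t + T / 2 ^ m) \<longlonglongrightarrow> t" by (simp add: power_divide)
      qed (use gt le in \<open>auto intro!: always_eventually less_imp_le\<close>)
      have "filterlim (\<lambda>m. s m (j m)) (at_right t) sequentially"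
        unfolding filterlim_at using lim gt by (auto intro!: always_eventually simp: less_imp_neq[symmetric])
      then have "(\<lambda>m. Y (s m (j m)) \<omega>) \<longlonglongrightarrow> Y t \<omega>"
        using w by (intro filterlim_compose[OF rc]) auto
      then have "(\<lambda>m. norm (Y (s m (j m)) \<omega>)) \<longlonglongrightarrow> norm (Y t \<omega>)" by (rule tendsto_norm)
      moreover have "norm (Y (s m (j m)) \<omega>) \<le> 2 * e" for m
      proof -
        have "\<omega> \<notin> E m" using w by blast
        then show ?thesis using w jm[of m] unfolding E_def by force
      qed
      ultimately show ?thesis by (intro LIMSEQ_le_const2) auto
    qed
    ultimately show ?thesis
      by (intro bexI[of _ "\<Union>m. E m"]) (auto simp: b_def)
  qed
qed

section \<open>Path regularity of finite sums of blocks\<close>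

context jump_blocks
begin

lemma jump_right: "((\<lambda>s. jump s z) \<longlongrightarrow> jump t z) (at_right t)"
proof (rule tendsto_eventually)
  show "eventually (\<lambda>s. jump s z = jump t z) (at_right t)"
  proof (cases "fst z \<le> t")
    case True
    have "eventually (\<lambda>s. t < s) (at_right t)" by (rule eventually_at_right_less)
    then show ?thesis by eventually_elim (use True in \<open>simp add: jump_def\<close>)
  next
    case False
    then have "eventually (\<lambda>s. s < fst z) (at_right t)" by (intro eventually_at_right_real[THEN eventually_mono]) auto
    then show ?thesis by eventually_elim (use False in \<open>auto simp: jump_def\<close>)
  qed
qed

lemma jump_left: "\<exists>l. ((\<lambda>s. jump s z) \<longlongrightarrow> l) (at_left t)"
proof (cases "fst z < t")
  case True
  then have "eventually (\<lambda>s. fst z < s) (at_left t)" by (intro eventually_at_left_real[THEN eventually_mono]) auto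
  then have "eventually (\<lambda>s. jump s z = snd z) (at_left t)" by eventually_elim (auto simp: jump_def)
  then show ?thesis by (blast intro: tendsto_eventually)
next
  case False
  have "eventually (\<lambda>s. s < t) (at_left t)" by (simp add: eventually_at_filter)
  then have "eventually (\<lambda>s. jump s z = 0) (at_left t)" by eventually_elim (use False in \<open>auto simp: jump_def\<close>)
  then show ?thesis by (blast intro: tendsto_eventually)
qed

lemma Z_right: "((\<lambda>s. Z k s \<omega>) \<longlongrightarrow> Z k t \<omega>) (at_right t)"
  unfolding Z_def by (intro tendsto_sum jump_right)

lemma Z_left: "\<exists>l. ((\<lambda>s. Z k s \<omega>) \<longlongrightarrow> l) (at_left t)"
proof -
  obtain l where l: "\<And>z. ((\<lambda>s. jump s z) \<longlongrightarrow> l z) (at_left t)" using jump_left[of _ t] by metis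
  have "((\<lambda>s. \<Sum>i<fst (\<omega> k). jump s (snd (\<omega> k) i)) \<longlongrightarrow> (\<Sum>i<fst (\<omega> k). l (snd (\<omega> k) i))) (at_left t)"
    by (intro tendsto_sum l)
  then show ?thesis unfolding Z_def by blast
qed

lemma S_right: "((\<lambda>s. S J s \<omega>) \<longlongrightarrow> S J t \<omega>) (at_right t)"
  unfolding S_def by (intro tendsto_sum Z_right)

end

section \<open>From characteristic functions to Levy processes\<close>

text \<open>Apart from path regularity everything is read off the joint characteristic functions.
  Stochastic continuity at t follows from \<open>prob_norm_ge_le_char\<close>, because exp (- |s -
  t| \<open>\<Psi>\<close>) tends to 1 as s tends to t.\<close>

lemma (in prob_space) levy_process_of_levy_char:
  fixes X :: "real \<Rightarrow> 'a \<Rightarrow> 'b::euclidean_space"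
  assumes Xm: "\<And>t. X t \<in> borel_measurable M"
    and lc: "\<And>T. levy_char M X T \<Psi>" and P0: "\<Psi> 0 = 0" and Ppos: "\<And>\<xi>. 0 \<le> \<Psi> \<xi>"
    and cadlag: "AE \<omega> in M. (\<forall>t\<ge>0. ((\<lambda>s. X s \<omega>) \<longlongrightarrow> X t \<omega>) (at_right t)) \<and>
                  (\<forall>t>0. \<exists>l. ((\<lambda>s. X s \<omega>) \<longlongrightarrow> l) (at_left t))"
  shows "levy_process M X"
  unfolding levy_process_def
proof (intro conjI allI impI, goal_cases)
  case 1 show ?case by (rule prob_space_axioms)
next
  case (2 t) show ?case by (rule Xm)
next
  case 3
  note Xm[measurable]
  have "distr M borel (X 0) = distr M borel (\<lambda>_. 0)"
    by (rule distr_eq_of_char_eq[OF prob_space_axioms _ prob_space_axioms])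
      (use levy_char_single[OF lc[of 0], of 0] in \<open>auto simp: prob_space\<close>)
  moreover have "AE x in distr M borel (\<lambda>_. 0::'b). x = 0"
    by (subst AE_distr_iff) auto
  ultimately have "AE x in distr M borel (X 0). x = 0" by (simp only:)
  then show ?case by (rule AE_distrD[rotated]) simp
next
  case (4 n s)
  have "indep_vars (\<lambda>_. borel) (incr s X) {..n}"
    by (rule levy_char_indep[OF lc[of "s n"] P0 Xm]) (use 4 in auto)
  then show ?case by (simp add: incr_def[abs_def] atMost_atLeast0)
next
  case (5 s t)
  note Xm[measurable]
  show ?case
    by (rule distr_eq_of_char_eq[OF prob_space_axioms _ prob_space_axioms])
      (use 5 levy_char_increment[OF lc[of t] P0, of s t] levy_char_single[OF lc[of "t - s"], of "t - s"] in auto)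
next
  case (6 t e)
  note Xm[measurable]
  show ?case
    unfolding tendsto_at_iff_sequentially
  proof (intro allI impI)
    fix u :: "nat \<Rightarrow> real" assume u: "\<forall>i. u i \<in> {0..} - {t}" and ut: "u \<longlonglongrightarrow> t"
    have ch: "(\<integral>w. cis (\<xi> \<bullet> (X (u i) w - X t w)) \<partial>M) = complex_of_real (exp (- (\<bar>u i - t\<bar> * \<Psi> \<xi>)))" for i \<xi>
    proof (cases "t \<le> u i")
      case True
      then show ?thesis using levy_char_increment[OF lc[of "u i"] P0, of t "u i" \<xi>] 6 by simp
    next
      case False
      have "(\<integral>w. cis (\<xi> \<bullet> (X (u i) w - X t w)) \<partial>M) = (\<integral>w. cis ((- \<xi>) \<bullet> (X t w - X (u i) w)) \<partial>M)"
        by (intro Bochner_Integration.integral_cong refl arg_cong[where f=cis]) (simp add: inner_diff_right)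
      also have "\<dots> = complex_of_real (exp (- ((t - u i) * \<Psi> (- \<xi>))))"
        using False u by (intro levy_char_increment[OF lc[of t] P0]) auto
      \<comment> \<open>A real characteristic function equals its conjugate, so the exponent is
        even; this covers times before t.\<close>
      also have "\<Psi> (- \<xi>) = \<Psi> \<xi>"
      proof -
        have e: "(\<integral>w. cis (- \<xi> \<bullet> X 1 w) \<partial>M) = cnj (\<integral>w. cis (\<xi> \<bullet> X 1 w) \<partial>M)"
          by (subst Bochner_Integration.integral_cnj[symmetric]) (simp add: cis_cnj)
        then have "complex_of_real (exp (- \<Psi> (- \<xi>))) = complex_of_real (exp (- \<Psi> \<xi>))"
          using levy_char_single[OF lc[of 1], of 1 \<xi>] levy_char_single[OF lc[of 1], of 1 "- \<xi>"] by simp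
        then show ?thesis by (simp only: of_real_eq_iff exp_inj_iff neg_equal_iff_equal)
      qed
      finally show ?thesis using False by simp
    qed
    \<comment> \<open>Measurability of \<open>\<Psi>\<close> is recovered from the characteristic
      function at time 1 by taking the logarithm.\<close>
    have "(\<lambda>\<xi>. Re (\<integral>w. cis (\<xi> \<bullet> X 1 w) \<partial>M)) \<in> borel_measurable borel" by measurable
    then have "(\<lambda>\<xi>. exp (- \<Psi> \<xi>)) \<in> borel_measurable borel"
      by (simp add: levy_char_single[OF lc[of 1], of 1])
    then have "(\<lambda>\<xi>. - ln (exp (- \<Psi> \<xi>))) \<in> borel_measurable borel" by measurable
    then have [measurable]: "\<Psi> \<in> borel_measurable borel" by simp
    have lim: "(\<lambda>i. \<integral>g. 1 - exp (- (\<bar>u i - t\<bar> * \<Psi> (g /\<^sub>R e))) \<partial>gauss) \<longlonglongrightarrow> (\<integral>g. 0 \<partial>(gauss :: 'b measure))"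
    proof (rule integral_dominated_convergence[where w="\<lambda>_. 1"])
      show "AE g in gauss. (\<lambda>i. 1 - exp (- (\<bar>u i - t\<bar> * \<Psi> (g /\<^sub>R e)))) \<longlonglongrightarrow> 0"
      proof (intro AE_I2)
        fix g :: 'b
        have "(\<lambda>i. 1 - exp (- (\<bar>u i - t\<bar> * \<Psi> (g /\<^sub>R e)))) \<longlonglongrightarrow> 1 - exp (- (\<bar>t - t\<bar> * \<Psi> (g /\<^sub>R e)))"
          by (intro tendsto_intros ut)
        then show "(\<lambda>i. 1 - exp (- (\<bar>u i - t\<bar> * \<Psi> (g /\<^sub>R e)))) \<longlonglongrightarrow> 0" by simp
      qed
      show "AE g in gauss. norm (1 - exp (- (\<bar>u i - t\<bar> * \<Psi> (g /\<^sub>R e)))) \<le> 1" for i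
      proof (intro AE_I2)
        fix g :: 'b
        have "0 \<le> \<bar>u i - t\<bar> * \<Psi> (g /\<^sub>R e)" using Ppos by simp
        then show "norm (1 - exp (- (\<bar>u i - t\<bar> * \<Psi> (g /\<^sub>R e)))) \<le> 1" by (simp add: abs_le_iff)
      qed
    qed simp_all
    show "((\<lambda>s. measure M {\<omega>\<in>space M. e < norm (X s \<omega> - X t \<omega>)}) \<circ> u) \<longlonglongrightarrow> 0"
    proof (rule tendsto_sandwich[where f="\<lambda>_. 0"])
      show "eventually (\<lambda>i. ((\<lambda>s. measure M {\<omega>\<in>space M. e < norm (X s \<omega> - X t \<omega>)}) \<circ> u) i
          \<le> 3 * (\<integral>g. 1 - exp (- (\<bar>u i - t\<bar> * \<Psi> (g /\<^sub>R e))) \<partial>gauss)) sequentially"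
      proof (intro always_eventually allI)
        fix i
        have "measure M {\<omega>\<in>space M. e < norm (X (u i) \<omega> - X t \<omega>)} \<le> measure M {\<omega>\<in>space M. e \<le> norm (X (u i) \<omega> - X t \<omega>)}"
          by (rule finite_measure_mono) auto
        also have "\<dots> \<le> 3 * (\<integral>g. 1 - exp (- (\<bar>u i - t\<bar> * \<Psi> (g /\<^sub>R e))) \<partial>gauss)"
          using 6 by (intro prob_norm_ge_le_char[OF prob_space_axioms _ _ ch]) auto
        finally show "((\<lambda>s. measure M {\<omega>\<in>space M. e < norm (X s \<omega> - X t \<omega>)}) \<circ> u) i
          \<le> 3 * (\<integral>g. 1 - exp (- (\<bar>u i - t\<bar> * \<Psi> (g /\<^sub>R e))) \<partial>gauss)" by simp
      qed
      show "(\<lambda>i. 3 * (\<integral>g. 1 - exp (- (\<bar>u i - t\<bar> * \<Psi> (g /\<^sub>R e))) \<partial>gauss)) \<longlonglongrightarrow> 0"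
        using tendsto_mult_left[OF lim, of 3] by simp
    qed auto
  qed
next
  case 7 show ?case by (rule cadlag)
qed

lemma levy_char_distr:
  assumes r: "r \<in> M' \<rightarrow>\<^sub>M M" and d: "distr M' M r = M" and Ym: "\<And>t. Y t \<in> borel_measurable M"
    and lc: "levy_char M Y T \<Psi>"
  shows "levy_char M' (\<lambda>t \<omega>. Y t (r \<omega>)) T \<Psi>"
  unfolding levy_char_def
proof (intro allI impI)
  fix n s \<eta> assume s: "0 \<le> s 0 \<and> (\<forall>i<n. s i < s (Suc i)) \<and> s n \<le> T"
  note Ym[measurable]
  have [measurable]: "incr s Y i \<in> borel_measurable M" for i unfolding incr_def by (cases "i = 0") simp_all
  have "(\<integral>\<omega>. (\<Prod>i\<le>n. cis (\<eta> i \<bullet> incr s (\<lambda>t \<omega>. Y t (r \<omega>)) i \<omega>)) \<partial>M') = (\<integral>\<omega>. (\<Prod>i\<le>n. cis (\<eta> i \<bullet> incr s Y i (r \<omega>))) \<partial>M')"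
    by (simp add: incr_def)
  also have "\<dots> = (\<integral>\<omega>. (\<Prod>i\<le>n. cis (\<eta> i \<bullet> incr s Y i \<omega>)) \<partial>distr M' M r)"
    by (rule integral_distr[symmetric, OF r]) measurable
  finally show "(\<integral>\<omega>. (\<Prod>i\<le>n. cis (\<eta> i \<bullet> incr s (\<lambda>t \<omega>. Y t (r \<omega>)) i \<omega>)) \<partial>M')
    = complex_of_real (\<Prod>i\<le>n. exp (- ((s i - grid_start s i) * \<Psi> (\<eta> i))))"
    using lc[unfolded levy_char_def, rule_format, OF s] by (simp add: d)
qed

text \<open>The theorem prescribes the type of the sample space; the space carrying the Poisson numbers, jump times
  and jump sizes is embedded into it.\<close>

definition encode_path :: "(nat \<Rightarrow> nat \<times> (nat \<Rightarrow> real \<times> 'b)) \<Rightarrow> real \<Rightarrow> 'b::euclidean_space" where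
  "encode_path \<omega> y = (case prod_decode (nat \<lfloor>y\<rfloor>) of (k, l) \<Rightarrow>
     if l = 0 then real (fst (\<omega> k)) *\<^sub>R (SOME b. b \<in> Basis)
     else if even l then snd (snd (\<omega> k) (l div 2 - 1))
     else fst (snd (\<omega> k) (l div 2)) *\<^sub>R (SOME b. b \<in> Basis))"

text \<open>For each block k, slot 0 holds the Poisson number, slot 2 i + 1 the time and slot 2 i +
  2 the size of mark i. Real entries are stored along a basis vector, which is nonzero, so all of
  them can be read back.\<close>

lemma inj_encode_path: "inj (encode_path :: _ \<Rightarrow> real \<Rightarrow> 'b::euclidean_space)"
proof (rule injI)
  fix \<omega> \<omega>' :: "nat \<Rightarrow> nat \<times> (nat \<Rightarrow> real \<times> 'b)" assume e: "encode_path \<omega> = encode_path \<omega>'"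
  have b: "(SOME b. b \<in> (Basis :: 'b set)) \<noteq> 0" using SOME_Basis nonzero_Basis by metis
  have v: "encode_path \<omega> (real (prod_encode (k, l))) = encode_path \<omega>' (real (prod_encode (k, l)))" for k l
    by (simp add: e)
  show "\<omega> = \<omega>'"
  proof
    fix k
    have "fst (\<omega> k) = fst (\<omega>' k)" using v[of k 0] b by (simp add: encode_path_def)
    moreover have "snd (\<omega> k) i = snd (\<omega>' k) i" for i
      using v[of k "2 * i + 1"] v[of k "2 * i + 2"] b by (simp add: encode_path_def prod_eq_iff)
    ultimately show "\<omega> k = \<omega>' k" by (simp add: prod_eq_iff fun_eq_iff)
  qed
qed

section \<open>Unimodality of the blocks and convergence of their sum\<close>

context jump_blocks
begin

text \<open>A mark with time after t contributes the jump 0 and thus an atom at the origin. The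
  remaining marks, integrated over time, give the density \<open>f\<close>, a mixture of radially
  decreasing functions.\<close>

lemma unimodal_jump_mark:
  assumes rd: "\<And>u. radial_decreasing (\<lambda>x. g k (u, x))"
  shows "unimodal_rv (mark k) (jump t)"
proof -
  define f where "f x = (\<integral>\<^sup>+u. indicator {..t} u * ennreal (g k (u, x) / lam k) \<partial>lborel)" for x
  have gm[measurable]: "g k \<in> borel_measurable (borel \<Otimes>\<^sub>M borel)" using g_meas[of k] by (simp add: borel_prod)
  have fm[measurable]: "f \<in> borel_measurable borel" unfolding f_def by measurable
  have frd: "radial_decreasing f"
    unfolding radial_decreasing_def f_def
    using rd lam_pos[of k] by (auto simp: radial_decreasing_def intro!: nn_integral_mono mult_left_mono ennreal_leI divide_right_mono)
  show ?thesis
  proof (rule unimodal_rv_density[OF frd fm])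
    fix G :: "'b \<Rightarrow> ennreal" assume [measurable]: "G \<in> borel_measurable borel"
    let ?d = "\<lambda>u x. ennreal (g k (u, x) / lam k)"
    have "(\<integral>\<^sup>+z. G (jump t z) \<partial>mark k) = (\<integral>\<^sup>+z. ennreal (g k z / lam k) * G (jump t z) \<partial>lborel)"
      unfolding mark_def by (subst nn_integral_density) auto
    also have "\<dots> = (\<integral>\<^sup>+z. indicator {t<..} (fst z) * ennreal (g k z / lam k) * G 0 + indicator {..t} (fst z) * ennreal (g k z / lam k) * G (snd z) \<partial>(lborel \<Otimes>\<^sub>M lborel))"
      unfolding lborel_prod by (intro nn_integral_cong) (auto simp: jump_def indicator_def)
    also have "\<dots> = (\<integral>\<^sup>+z. indicator {t<..} (fst z) * ennreal (g k z / lam k) * G 0 \<partial>(lborel \<Otimes>\<^sub>M lborel)) +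
        (\<integral>\<^sup>+z. indicator {..t} (fst z) * ennreal (g k z / lam k) * G (snd z) \<partial>(lborel \<Otimes>\<^sub>M lborel))"
      by (intro nn_integral_add) measurable
    also have "(\<integral>\<^sup>+z. indicator {t<..} (fst z) * ennreal (g k z / lam k) * G 0 \<partial>(lborel \<Otimes>\<^sub>M lborel))
       = (\<integral>\<^sup>+z. indicator {t<..} (fst z) * ennreal (g k z / lam k) \<partial>(lborel \<Otimes>\<^sub>M lborel)) * G 0"
      by (rule nn_integral_multc) measurable
    also have "(\<integral>\<^sup>+z. indicator {..t} (fst z) * ennreal (g k z / lam k) * G (snd z) \<partial>(lborel \<Otimes>\<^sub>M lborel))
       = (\<integral>\<^sup>+x. \<integral>\<^sup>+u. indicator {..t} u * ?d u x * G x \<partial>lborel \<partial>lborel)"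
      by (subst lborel_pair.nn_integral_snd[symmetric]) (simp_all add: split_beta')
    also have "\<dots> = (\<integral>\<^sup>+x. f x * G x \<partial>lborel)"
      unfolding f_def by (intro nn_integral_cong nn_integral_multc) measurable
    finally show "(\<integral>\<^sup>+z. G (jump t z) \<partial>mark k) =
      (\<integral>\<^sup>+z. indicator {t<..} (fst z) * ennreal (g k z / lam k) \<partial>(lborel \<Otimes>\<^sub>M lborel)) * G 0 + (\<integral>\<^sup>+x. f x * G x \<partial>lborel)" .
  qed
qed

text \<open>Given the Poisson number this is a sum of independent unimodal jumps, and radial
  monotonicity survives mixing over that number.\<close>

lemma unimodal_Z:
  assumes rd: "\<And>u. radial_decreasing (\<lambda>x. g k (u, x))"
  shows "unimodal_rv Om (Z k t)"
  unfolding unimodal_rv_def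
proof (intro allI impI)
  fix G :: "'b \<Rightarrow> ennreal" assume [measurable]: "G \<in> borel_measurable borel" and G: "radial_decreasing G"
  let ?P = "PiM UNIV (\<lambda>_::nat. mark k)"
  have jm[measurable]: "jump t \<in> borel_measurable (mark k)"
    by (subst measurable_cong_sets[OF sets_mark refl]) (rule jump_meas)
  have 1: "unimodal_rv ?P (\<lambda>w. jump t (w i))" for i
    unfolding unimodal_rv_def
  proof (intro allI impI)
    fix H :: "'b \<Rightarrow> ennreal" assume [measurable]: "H \<in> borel_measurable borel" and H: "radial_decreasing H"
    have "(\<integral>\<^sup>+w. H (x + jump t (w i)) \<partial>?P) = (\<integral>\<^sup>+z. H (x + jump t z) \<partial>mark k)" for x
      by (subst marks.PiM_component[of i k, symmetric], simp, subst nn_integral_distr) auto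
    then show "radial_decreasing (\<lambda>x. \<integral>\<^sup>+w. H (x + jump t (w i)) \<partial>?P)"
      using unimodal_rvD[OF unimodal_jump_mark[OF rd] _ H] by simp
  qed
  have 2: "unimodal_rv ?P (\<lambda>w. \<Sum>i<n. jump t (w i))" for n
  proof (rule marks.P.unimodal_rv_sum)
    show "marks.P.indep_vars k (\<lambda>_. borel) (\<lambda>i w. jump t (w i)) {..<n}"
      by (rule marks.P.indep_vars_compose2[OF marks.P.indep_vars_subset[OF marks.indep_vars_coordinates]]) simp_all
  qed (simp_all add: 1)
  have Fm: "(\<lambda>z. \<Sum>i<fst z. jump t (snd z i)) \<in> borel_measurable (block k)"
    by (rule measurable_block_sum) simp
  have e: "(\<integral>\<^sup>+\<omega>. G (x + Z k t \<omega>) \<partial>Om) = (\<integral>\<^sup>+n. (\<integral>\<^sup>+w. G (x + (\<Sum>i<n. jump t (w i))) \<partial>?P) \<partial>measure_pmf (poisson_pmf (lam k)))" for x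
  proof -
    have m: "(\<lambda>z. G (x + (\<Sum>i<fst z. jump t (snd z i)))) \<in> borel_measurable (block k)"
      using Fm by measurable
    have "(\<integral>\<^sup>+\<omega>. G (x + Z k t \<omega>) \<partial>Om) = (\<integral>\<^sup>+z. G (x + (\<Sum>i<fst z. jump t (snd z i))) \<partial>block k)"
      unfolding Z_def Om_def by (subst Om.PiM_component[of k, symmetric], simp, subst nn_integral_distr) (use m in auto)
    also have "\<dots> = (\<integral>\<^sup>+n. (\<integral>\<^sup>+w. G (x + (\<Sum>i<n. jump t (w i))) \<partial>?P) \<partial>measure_pmf (poisson_pmf (lam k)))"
      using marks.P.nn_integral_fst[OF m[unfolded block_def]] unfolding block_def by simp
    finally show ?thesis .
  qed
  show "radial_decreasing (\<lambda>x. \<integral>\<^sup>+\<omega>. G (x + Z k t \<omega>) \<partial>Om)"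
    unfolding e
  proof (subst radial_decreasing_def, intro allI impI)
    fix x y :: 'b assume xy: "norm x \<le> norm y"
    show "(\<integral>\<^sup>+n. (\<integral>\<^sup>+w. G (y + (\<Sum>i<n. jump t (w i))) \<partial>?P) \<partial>measure_pmf (poisson_pmf (lam k)))
      \<le> (\<integral>\<^sup>+n. (\<integral>\<^sup>+w. G (x + (\<Sum>i<n. jump t (w i))) \<partial>?P) \<partial>measure_pmf (poisson_pmf (lam k)))"
      by (rule nn_integral_mono, rule radial_decreasingD[OF unimodal_rvD[OF 2 _ G] xy]) simp
  qed
qed

lemma unimodal_S:
  assumes rd: "\<And>k u. radial_decreasing (\<lambda>x. g k (u, x))" and J: "finite J"
  shows "unimodal_rv Om (S J t)"
  unfolding S_def[abs_def]
proof (rule unimodal_rv_sum[OF J])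
  have m: "(\<lambda>z. \<Sum>i<fst z. jump t (snd z i)) \<in> borel_measurable (block k)" for k
    by (rule measurable_block_sum) simp
  show "indep_vars (\<lambda>_. borel) (\<lambda>k. Z k t) J"
    unfolding Om_def Z_def[abs_def]
    by (rule Om.P.indep_vars_compose2[OF Om.P.indep_vars_subset[OF Om.indep_vars_coordinates]]) (simp_all add: m)
qed (rule unimodal_Z[OF rd])

text \<open>The time range grows with the block index, so on every bounded interval all but finitely
  many blocks obey the geometric bound.\<close>

definition good where
  "good \<omega> \<longleftrightarrow> (\<exists>k0. \<forall>k\<ge>k0. \<forall>t. 0 \<le> t \<and> t < real k \<longrightarrow> norm (Z k t \<omega>) \<le> 2 * (1 / 2) ^ k)"

definition X where "X t \<omega> = (\<Sum>k. Z k t \<omega>)"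

lemma X_meas[measurable]: "X t \<in> borel_measurable Om"
  unfolding X_def[abs_def] by measurable

lemma summable_geo: "summable (\<lambda>k. 2 * (1 / 2) ^ k :: real)"
  by (intro summable_mult summable_geometric) simp

lemma good_uniform:
  assumes "good \<omega>"
  shows "uniform_limit {0..T} (\<lambda>K t. S {..<K} t \<omega>) (\<lambda>t. X t \<omega>) sequentially"
  unfolding S_def X_def
proof (rule Weierstrass_m_test_ev[OF _ summable_geo])
  obtain k0 where k0: "\<And>k t. k \<ge> k0 \<Longrightarrow> 0 \<le> t \<Longrightarrow> t < real k \<Longrightarrow> norm (Z k t \<omega>) \<le> 2 * (1 / 2) ^ k"
    using assms unfolding good_def by blast
  obtain k1 :: nat where k1: "T < real k1" using reals_Archimedean2 by blast
  show "\<forall>\<^sub>F n in sequentially. \<forall>x\<in>{0..T}. norm (Z n x \<omega>) \<le> 2 * (1 / 2) ^ n"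
    using eventually_ge_at_top[of "max k0 k1"]
  proof eventually_elim
    case (elim n)
    then have "T < real n" using k1 by simp
    then show ?case using elim by (intro ballI k0) auto
  qed
qed

lemma good_pointwise:
  assumes "good \<omega>" "0 \<le> t"
  shows "(\<lambda>K. S {..<K} t \<omega>) \<longlonglongrightarrow> X t \<omega>"
  using tendsto_uniform_limitI[OF good_uniform[OF assms(1), of t]] assms(2) by simp

lemma good_right:
  assumes "good \<omega>" "0 \<le> t"
  shows "((\<lambda>s. X s \<omega>) \<longlongrightarrow> X t \<omega>) (at_right t)"
proof -
  have "((\<lambda>s. X s \<omega>) \<longlongrightarrow> X t \<omega>) (at t within {t..t + 1})"
  proof (rule swap_uniform_limit)
    show "\<forall>\<^sub>F n in sequentially. ((\<lambda>s. S {..<n} s \<omega>) \<longlongrightarrow> S {..<n} t \<omega>) (at t within {t..t + 1})"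
      using S_right by (simp add: at_within_Icc_at_right)
    show "(\<lambda>n. S {..<n} t \<omega>) \<longlonglongrightarrow> X t \<omega>" by (rule good_pointwise[OF assms])
    show "uniform_limit {t..t + 1} (\<lambda>n s. S {..<n} s \<omega>) (\<lambda>s. X s \<omega>) sequentially"
      by (rule uniform_limit_on_subset[OF good_uniform[OF assms(1), of "t + 1"]]) (use assms in auto)
  qed simp
  then show ?thesis by (simp add: at_within_Icc_at_right)
qed

text \<open>The geometric bound passes to the left limits of the single blocks; hence their series
  converges, and uniform convergence permits exchanging the limits.\<close>

lemma good_left:
  assumes "good \<omega>" "0 < t"
  shows "\<exists>l. ((\<lambda>s. X s \<omega>) \<longlongrightarrow> l) (at_left t)"
proof -
  obtain l where l: "\<And>k. ((\<lambda>s. Z k s \<omega>) \<longlongrightarrow> l k) (at_left t)" using Z_left[of _ \<omega> t] by metis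
  obtain k0 where k0: "\<And>k t. k \<ge> k0 \<Longrightarrow> 0 \<le> t \<Longrightarrow> t < real k \<Longrightarrow> norm (Z k t \<omega>) \<le> 2 * (1 / 2) ^ k"
    using assms unfolding good_def by blast
  obtain k1 :: nat where k1: "t < real k1" using reals_Archimedean2 by blast
  have lb: "norm (l k) \<le> 2 * (1 / 2) ^ k" if k: "k \<ge> max k0 k1" for k
  proof (rule tendsto_upperbound[OF tendsto_norm[OF l]])
    have tk: "t < real k" using k k1 by simp
    have "eventually (\<lambda>s. s \<in> {0<..<t}) (at_left t)" using assms(2) by (rule eventually_at_left_real)
    then show "eventually (\<lambda>s. norm (Z k s \<omega>) \<le> 2 * (1 / 2) ^ k) (at_left t)"
      by eventually_elim (use k tk in \<open>auto intro!: k0\<close>)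
  qed simp
  have "summable l"
    by (rule summable_comparison_test_ev[OF _ summable_geo])
      (unfold eventually_sequentially, rule exI[of _ "max k0 k1"], use lb in blast)
  then have g: "(\<lambda>n. \<Sum>k<n. l k) \<longlonglongrightarrow> suminf l" by (rule summable_LIMSEQ)
  have "((\<lambda>s. X s \<omega>) \<longlongrightarrow> suminf l) (at t within {0..t})"
  proof (rule swap_uniform_limit[OF _ g good_uniform[OF assms(1), of t]])
    show "\<forall>\<^sub>F n in sequentially. ((\<lambda>s. S {..<n} s \<omega>) \<longlongrightarrow> (\<Sum>k<n. l k)) (at t within {0..t})"
      unfolding S_def using assms(2) l by (intro always_eventually allI tendsto_sum) (simp add: at_within_Icc_at_left)
  qed simp
  then show ?thesis using assms(2) by (auto simp: at_within_Icc_at_left)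
qed

text \<open>Almost sure convergence of the increments passes to their joint characteristic
  functions. The K-th partial sum has the prescribed intensity only up to time K, which exceeds T
  for large K.\<close>

lemma X_levy_char:
  assumes AEgood: "AE \<omega> in Om. good \<omega>"
    and lc: "\<And>K. levy_char Om (S {..<K}) (real K) (\<Psi>K K)"
    and lim: "\<And>\<xi>. (\<lambda>K. \<Psi>K K \<xi>) \<longlonglongrightarrow> \<Psi> \<xi>"
  shows "levy_char Om X T \<Psi>"
  unfolding levy_char_def
proof (intro allI impI)
  fix n s \<eta> assume s: "0 \<le> s 0 \<and> (\<forall>i<n. s i < s (Suc i)) \<and> s n \<le> T"
  have [measurable]: "incr s X i \<in> borel_measurable Om" "incr s (S J) i \<in> borel_measurable Om" for i J
    unfolding incr_def by (cases "i = 0"; simp)+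
  have spos: "0 \<le> s i" if "i \<le> n" for i
    using strict_grid_mono[of n s 0 i] s that by fastforce
  have L: "(\<lambda>K. \<integral>\<omega>. (\<Prod>i\<le>n. cis (\<eta> i \<bullet> incr s (S {..<K}) i \<omega>)) \<partial>Om) \<longlonglongrightarrow> (\<integral>\<omega>. (\<Prod>i\<le>n. cis (\<eta> i \<bullet> incr s X i \<omega>)) \<partial>Om)"
  proof (rule integral_dominated_convergence[where w="\<lambda>_. 1"])
    show "AE \<omega> in Om. (\<lambda>K. \<Prod>i\<le>n. cis (\<eta> i \<bullet> incr s (S {..<K}) i \<omega>)) \<longlonglongrightarrow> (\<Prod>i\<le>n. cis (\<eta> i \<bullet> incr s X i \<omega>))"
      using AEgood
    proof eventually_elim
      case (elim \<omega>)
      have "(\<lambda>K. incr s (S {..<K}) i \<omega>) \<longlonglongrightarrow> incr s X i \<omega>" if "i \<le> n" for i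
        unfolding incr_def using good_pointwise[OF elim spos[OF that]] good_pointwise[OF elim spos[of "i - 1"]] good_pointwise[OF elim spos[of 0]] that
        by (cases "i = 0") (auto intro!: tendsto_diff)
      then show ?case by (intro tendsto_prod tendsto_cis tendsto_inner tendsto_const) auto
    qed
  qed (auto simp: prod_norm[symmetric])
  obtain K1 :: nat where K1: "T < real K1" using reals_Archimedean2 by blast
  have "eventually (\<lambda>K. (\<integral>\<omega>. (\<Prod>i\<le>n. cis (\<eta> i \<bullet> incr s (S {..<K}) i \<omega>)) \<partial>Om)
       = complex_of_real (\<Prod>i\<le>n. exp (- ((s i - grid_start s i) * \<Psi>K K (\<eta> i))))) sequentially"
    using eventually_ge_at_top[of K1]
  proof eventually_elim
    case (elim K)
    then have "T \<le> real K" using K1 by linarith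
    then show ?case using lc[of K, unfolded levy_char_def, rule_format, of s n \<eta>] s by force
  qed
  moreover have "(\<lambda>K. complex_of_real (\<Prod>i\<le>n. exp (- ((s i - grid_start s i) * \<Psi>K K (\<eta> i)))))
      \<longlonglongrightarrow> complex_of_real (\<Prod>i\<le>n. exp (- ((s i - grid_start s i) * \<Psi> (\<eta> i))))"
    by (intro tendsto_of_real tendsto_prod tendsto_exp tendsto_minus tendsto_mult tendsto_const lim)
  ultimately have "(\<lambda>K. \<integral>\<omega>. (\<Prod>i\<le>n. cis (\<eta> i \<bullet> incr s (S {..<K}) i \<omega>)) \<partial>Om) \<longlonglongrightarrow> complex_of_real (\<Prod>i\<le>n. exp (- ((s i - grid_start s i) * \<Psi> (\<eta> i))))"
    by (simp add: filterlim_cong[OF refl refl])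
  from LIMSEQ_unique[OF L this] show "(\<integral>\<omega>. (\<Prod>i\<le>n. cis (\<eta> i \<bullet> incr s X i \<omega>)) \<partial>Om) = complex_of_real (\<Prod>i\<le>n. exp (- ((s i - grid_start s i) * \<Psi> (\<eta> i))))" .
qed

end

section \<open>Levy processes with a radially decreasing Levy density\<close>

lemma one_minus_cos_le: "1 - cos y \<le> (y::real)\<^sup>2 / 2"
proof -
  have "1 - cos y = 2 * (sin (y / 2))\<^sup>2" using cos_double_sin[of "y / 2"] by simp
  also have "(sin (y / 2))\<^sup>2 \<le> (y / 2)\<^sup>2"
    by (rule abs_le_square_iff[THEN iffD1, OF abs_sin_x_le_abs_x])
  finally show ?thesis by (simp add: power_divide)
qed

lemma one_minus_cos_inner_le: "1 - cos (\<xi> \<bullet> x) \<le> (norm \<xi>)\<^sup>2 * (norm x)\<^sup>2 / 2"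
proof -
  have "(\<xi> \<bullet> x)\<^sup>2 \<le> (norm \<xi> * norm x)\<^sup>2"
    using Cauchy_Schwarz_ineq2[of \<xi> x] by (intro abs_le_square_iff[THEN iffD1]) simp
  then show ?thesis using one_minus_cos_le[of "\<xi> \<bullet> x"] by (simp add: power_mult_distrib)
qed

lemma one_minus_cos_inner_bound: "1 - cos (\<xi> \<bullet> x) \<le> (2 + (norm \<xi>)\<^sup>2) * min 1 ((norm x)\<^sup>2)"
proof (cases "(norm x)\<^sup>2 \<le> 1")
  case True
  then have "(norm \<xi>)\<^sup>2 * (norm x)\<^sup>2 / 2 \<le> (2 + (norm \<xi>)\<^sup>2) * (norm x)\<^sup>2"
    by (simp add: algebra_simps)
  then show ?thesis using True one_minus_cos_inner_le[of \<xi> x] by (simp add: min_def)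
next
  case False
  have "- 1 \<le> cos (\<xi> \<bullet> x)" by simp
  moreover have "0 \<le> (norm \<xi>)\<^sup>2" by simp
  ultimately have "1 - cos (\<xi> \<bullet> x) \<le> 2 + (norm \<xi>)\<^sup>2" by linarith
  then show ?thesis using False by (simp add: min_def)
qed

text \<open>Nothing is known about \<open>v\<close> at 0; the cap \<open>a\<close> is the value at
  the origin that keeps the function radially decreasing.\<close>

definition trunc :: "(real \<Rightarrow> real) \<Rightarrow> real \<Rightarrow> 'b::real_normed_vector \<Rightarrow> real" where
  "trunc v a x = (if x = 0 then a else min (v (norm x)) a)"

text \<open>The point \<open>r0\<close> witnesses that \<open>v\<close> does not vanish identically.
  Every truncated intensity then has positive mass, as a Poisson parameter must.\<close>

locale radial_levy_density =
  fixes v :: "real \<Rightarrow> real" and dum :: "'b::euclidean_space itself" and r0 :: real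
  assumes v_nonneg: "\<And>r. 0 < r \<Longrightarrow> 0 \<le> v r"
    and v_mono: "\<And>r s. 0 < r \<Longrightarrow> r \<le> s \<Longrightarrow> v s \<le> v r"
    and v_int: "integrable lborel (\<lambda>x::'b. min 1 ((norm x)\<^sup>2) * v (norm x))"
    and r0: "0 < r0" "0 < v r0"
begin

abbreviation "tr a \<equiv> trunc v a :: 'b \<Rightarrow> real"
definition V :: "'b \<Rightarrow> real" where "V x = (if x = 0 then 0 else v (norm x))"

text \<open>The integrability assumption yields measurability of the product with min 1 |x|^2; this
  factor vanishes at the origin only, so it can be divided out.\<close>

lemma V_meas[measurable]: "V \<in> borel_measurable borel"
proof -
  have [measurable]: "(\<lambda>x::'b. min 1 ((norm x)\<^sup>2) * v (norm x)) \<in> borel_measurable borel"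
    using borel_measurable_integrable[OF v_int] by simp
  have "V = (\<lambda>x. if x = 0 then 0 else (min 1 ((norm x)\<^sup>2) * v (norm x)) / min 1 ((norm x)\<^sup>2))"
    by (auto simp: V_def fun_eq_iff min_def)
  also have "\<dots> \<in> borel_measurable borel" by measurable
  finally show ?thesis .
qed

lemma V_nonneg: "0 \<le> V x" using v_nonneg by (simp add: V_def)

lemma min_V: "min 1 ((norm x)\<^sup>2) * v (norm x) = min 1 ((norm x)\<^sup>2) * V x" by (simp add: V_def)

lemma V_int: "integrable lborel (\<lambda>x. min 1 ((norm x)\<^sup>2) * V x)"
  using v_int by (simp only: min_V)

lemma tr_eq: "tr a = (\<lambda>x. if x = 0 then a else min (V x) a)"
  by (auto simp: trunc_def V_def fun_eq_iff)

lemma tr_meas[measurable]: "tr a \<in> borel_measurable borel"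
  unfolding tr_eq by measurable

lemma tr_nonneg: "0 \<le> a \<Longrightarrow> 0 \<le> tr a x" using v_nonneg by (simp add: trunc_def)
lemma tr_le: "0 \<le> a \<Longrightarrow> tr a x \<le> a" by (simp add: trunc_def)
lemma tr_le_V: "x \<noteq> 0 \<Longrightarrow> tr a x \<le> V x" by (simp add: trunc_def V_def)
lemma tr_mono: "a \<le> b \<Longrightarrow> tr a x \<le> tr b x" by (auto simp: trunc_def)
lemma tr_uminus: "tr a (- x) = tr a x" by (simp add: trunc_def)

lemma tr_rd: "0 \<le> a \<Longrightarrow> radial_decreasing (tr a)"
  unfolding radial_decreasing_def trunc_def using v_mono by (auto simp: min.coboundedI1)

text \<open>For a \<le> b the function min s b - min s a is nondecreasing in s. Cutting by levels
  therefore keeps the pieces radially decreasing, whereas cutting by distance from the origin would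
  produce annuli.\<close>

lemma tr_diff_rd: "a \<le> b \<Longrightarrow> radial_decreasing (\<lambda>x. tr b x - tr a x)"
  unfolding radial_decreasing_def
proof (intro allI impI)
  fix x y :: 'b assume ab: "a \<le> b" and xy: "norm x \<le> norm y"
  show "tr b y - tr a y \<le> tr b x - tr a x"
  proof (cases "x = 0")
    case True then show ?thesis using ab by (auto simp: trunc_def min_def)
  next
    case False
    then have "v (norm y) \<le> v (norm x)" "y \<noteq> 0" using xy v_mono[of "norm x" "norm y"] by auto
    then show ?thesis using ab False by (auto simp: trunc_def min_def)
  qed
qed

text \<open>The cap bounds the function inside the unit ball, where \<open>V\<close> may fail to be
  integrable; outside, the Levy condition controls \<open>V\<close> itself.\<close>

lemma tr_int:
  assumes a: "0 \<le> a" shows "integrable lborel (tr a)"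
proof (rule Bochner_Integration.integrable_bound)
  show "integrable lborel (\<lambda>x. a * indicator (cball 0 1) x + min 1 ((norm x)\<^sup>2) * V x)"
    by (intro Bochner_Integration.integrable_add V_int integrable_mult_right integrable_real_indicator)
      (auto simp: emeasure_cball)
  show "AE x in lborel. norm (tr a x) \<le> norm (a * indicator (cball 0 1) x + min 1 ((norm x)\<^sup>2) * V x)"
  proof (intro AE_I2)
    fix x :: 'b
    have nn: "0 \<le> min 1 ((norm x)\<^sup>2) * V x" using V_nonneg by simp
    have "tr a x \<le> a * indicator (cball 0 1) x + min 1 ((norm x)\<^sup>2) * V x"
    proof (cases "norm x \<le> 1")
      case True then show ?thesis using tr_le[OF a, of x] nn by (simp add: indicator_def)
    next
      case False
      then have "1 \<le> (norm x)\<^sup>2" by (simp add: power2_eq_square mult_ge1_I)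
      then show ?thesis using tr_le_V[of x a] False by (cases "x = 0") (auto simp: indicator_def min_absorb1)
    qed
    moreover have "0 \<le> tr a x" by (rule tr_nonneg[OF a])
    moreover have "0 \<le> a * indicator (cball 0 1) x + min 1 ((norm x)\<^sup>2) * V x" using a nn by simp
    ultimately show "norm (tr a x) \<le> norm (a * indicator (cball 0 1) x + min 1 ((norm x)\<^sup>2) * V x)" by simp
  qed
qed simp

lemma tr_pos:
  assumes a: "0 < a" shows "0 < (\<integral>x. tr a x \<partial>lborel)"
proof -
  let ?m = "min (v r0) a"
  have "0 < ?m * measure lborel (ball (0::'b) r0)"
    using a r0 by (simp add: measure_def emeasure_ball)
  also have "\<dots> = (\<integral>x. ?m * indicator (ball (0::'b) r0) x \<partial>lborel)" by simp
  also have "\<dots> \<le> (\<integral>x. tr a x \<partial>lborel)"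
  proof (rule integral_mono)
    show "integrable lborel (\<lambda>x. ?m * indicator (ball (0::'b) r0) x)"
      by (intro integrable_mult_right integrable_real_indicator) (auto simp: emeasure_ball r0 less_imp_le)
    show "integrable lborel (tr a)" using a by (simp add: tr_int)
    show "?m * indicator (ball 0 r0) x \<le> tr a x" for x :: 'b
      using v_mono[of "norm x" r0] a tr_nonneg[of a x] by (auto simp: indicator_def trunc_def min_def)
  qed
  finally show ?thesis .
qed

lemma V_tail_small:
  assumes "0 < e"
  shows "\<exists>a\<ge>0. (\<integral>x. min 1 ((norm x)\<^sup>2) * (V x - min (V x) a) \<partial>lborel) < e"
proof -
  have "(\<lambda>n. \<integral>x. min 1 ((norm x)\<^sup>2) * (V x - min (V x) (real n)) \<partial>lborel) \<longlonglongrightarrow> (\<integral>x. 0 \<partial>(lborel :: 'b measure))"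
  proof (rule integral_dominated_convergence[OF _ _ V_int])
    show "AE x in lborel. (\<lambda>n. min 1 ((norm x)\<^sup>2) * (V x - min (V x) (real n))) \<longlonglongrightarrow> 0"
    proof (intro AE_I2 tendsto_eventually)
      fix x :: 'b
      obtain N where N: "V x < real N" using reals_Archimedean2 by blast
      show "eventually (\<lambda>n. min 1 ((norm x)\<^sup>2) * (V x - min (V x) (real n)) = 0) sequentially"
        using eventually_ge_at_top[of N]
      proof eventually_elim
        case (elim n)
        then have "V x \<le> real n" using N by (meson le_less_trans less_imp_le of_nat_le_iff order_trans)
        then show ?case by (simp add: min_absorb1)
      qed
    qed
    show "AE x in lborel. norm (min 1 ((norm x)\<^sup>2) * (V x - min (V x) (real n))) \<le> min 1 ((norm x)\<^sup>2) * V x" for n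
      using V_nonneg by (intro AE_I2) (auto simp: abs_mult min_def intro!: mult_left_mono)
  qed simp_all
  then have "eventually (\<lambda>n. (\<integral>x. min 1 ((norm x)\<^sup>2) * (V x - min (V x) (real n)) \<partial>lborel) < e) sequentially"
    using assms by (intro order_tendstoD(2)) simp_all
  then obtain n where "(\<integral>x. min 1 ((norm x)\<^sup>2) * (V x - min (V x) (real n)) \<partial>lborel) < e"
    using eventually_happens'[OF sequentially_bot] by blast
  then show ?thesis by (intro exI[of _ "real n"]) simp
qed

lemma V_tail_int: "integrable lborel (\<lambda>x. min 1 ((norm x)\<^sup>2) * (V x - min (V x) a))" if "0 \<le> a"
proof (rule Bochner_Integration.integrable_bound[OF V_int])
  show "AE x in lborel. norm (min 1 ((norm x)\<^sup>2) * (V x - min (V x) a)) \<le> norm (min 1 ((norm x)\<^sup>2) * V x)"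
    using V_nonneg that by (intro AE_I2) (auto simp: abs_mult min_def intro!: mult_left_mono)
qed simp

text \<open>The rate 32^-k makes the maximal inequality with threshold 2^-k over time k summable.
  The condition \<open>v 1 \<le> a k\<close> confines truncation to the unit ball,
  \<open>real k \<le> a k\<close> lets the truncations exhaust \<open>V\<close>, and taking partial
  sums of \<open>B\<close> enforces monotonicity.\<close>

lemma exists_levels:
  "\<exists>a::nat \<Rightarrow> real. incseq a \<and> (\<forall>k. 1 \<le> a k \<and> v 1 \<le> a k \<and> real k \<le> a k \<and>
     (\<integral>x. min 1 ((norm x)\<^sup>2) * (V x - min (V x) (a k)) \<partial>lborel) \<le> (1 / 32) ^ k)"
proof -
  have "\<forall>k. \<exists>a\<ge>0. (\<integral>x. min 1 ((norm x)\<^sup>2) * (V x - min (V x) a) \<partial>lborel) < (1 / 32) ^ k"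
    using V_tail_small by simp
  then obtain A where A0: "\<And>k. 0 \<le> A k" and A: "\<And>k. (\<integral>x. min 1 ((norm x)\<^sup>2) * (V x - min (V x) (A k)) \<partial>lborel) < (1 / 32) ^ k"
    by metis
  define B where "B k = \<bar>A k\<bar> + \<bar>v 1\<bar> + 1" for k
  define a where "a k = (\<Sum>i\<le>k. B i)" for k
  have B1: "1 \<le> B k" for k by (simp add: B_def)
  have Ba: "B k \<le> a k" for k unfolding a_def using B1 by (intro member_le_sum) (auto intro: order_trans[OF zero_le_one])
  have ka: "real k \<le> a k" for k
    unfolding a_def using sum_bounded_below[of "{..k}" "1::real" B] B1 by simp
  have "incseq a" unfolding a_def using B1 by (intro incseq_SucI) (simp add: order_trans[OF zero_le_one])
  moreover have "(\<integral>x. min 1 ((norm x)\<^sup>2) * (V x - min (V x) (a k)) \<partial>lborel) \<le> (1 / 32) ^ k" for k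
  proof -
    have "A k \<le> a k" using Ba[of k] by (simp add: B_def)
    then have "(\<integral>x. min 1 ((norm x)\<^sup>2) * (V x - min (V x) (a k)) \<partial>lborel) \<le> (\<integral>x. min 1 ((norm x)\<^sup>2) * (V x - min (V x) (A k)) \<partial>lborel)"
      using A0[of k] by (intro integral_mono V_tail_int mult_left_mono) auto
    then show ?thesis using A[of k] by linarith
  qed
  moreover have "1 \<le> a k" "v 1 \<le> a k" for k using Ba[of k] by (auto simp: B_def)
  ultimately show ?thesis using ka by blast
qed

end

section \<open>The process with a given radially decreasing Levy density\<close>

locale radial_levy_levels = radial_levy_density v dum r0
  for v and dum :: "'b::euclidean_space itself" and r0 +
  fixes a :: "nat \<Rightarrow> real"
  assumes a_mono: "incseq a" and a1: "\<And>k. 1 \<le> a k" and av: "\<And>k. v 1 \<le> a k" and ak: "\<And>k. real k \<le> a k"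
    and avar: "\<And>k. (\<integral>x. min 1 ((norm x)\<^sup>2) * (V x - min (V x) (a k)) \<partial>lborel) \<le> (1 / 32) ^ k"
begin

text \<open>Block \<open>k\<close> adds the jumps with level between \<open>a k\<close> and \<open>a (Suc k)\<close> up to time \<open>k\<close> and all jumps of
  level at most \<open>a (Suc k)\<close> in the time interval from \<open>k\<close> to \<open>Suc k\<close>, so that every block has finite intensity.\<close>

definition G :: "nat \<Rightarrow> real \<times> 'b \<Rightarrow> real" where
  "G k z = indicator {0<..real k} (fst z) * tr (a k) (snd z)"
definition g :: "nat \<Rightarrow> real \<times> 'b \<Rightarrow> real" where "g k z = G (Suc k) z - G k z"

lemma level_nonneg: "0 \<le> a k" using a1[of k] by linarith
lemma level_Suc: "a k \<le> a (Suc k)" using a_mono by (simp add: incseq_SucD)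

lemma G_meas[measurable]: "G k \<in> borel_measurable borel"
proof -
  have [measurable]: "fst \<in> borel_measurable (borel :: (real \<times> 'b) measure)" "snd \<in> borel_measurable (borel :: (real \<times> 'b) measure)"
    by (auto intro!: borel_measurable_continuous_onI continuous_intros)
  show ?thesis unfolding G_def by measurable
qed

lemma G_int: "integrable lborel (G k)" "(\<integral>z. G k z \<partial>lborel) = real k * (\<integral>x. tr (a k) x \<partial>lborel)"
  unfolding G_def[abs_def] using lborel_prod_integrable_times[of "indicator {0<..real k}" "tr (a k)"] tr_int[OF level_nonneg]
  by (auto simp: integrable_real_indicator)

lemma g_cases:
  "g k (u, x) = (if u \<le> 0 then 0 else if u \<le> real k then tr (a (Suc k)) x - tr (a k) x
     else if u \<le> real (Suc k) then tr (a (Suc k)) x else 0)"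
  by (auto simp: g_def G_def indicator_def)

lemma sum_g: "(\<Sum>k<K. g k z) = G K z"
proof -
  have "(\<Sum>k<K. g k z) = G K z - G 0 z"
    unfolding g_def by (rule sum_lessThan_telescope[of "\<lambda>k. G k z"])
  then show ?thesis by (simp add: G_def indicator_def)
qed

sublocale jump_blocks g
proof
  fix k
  show "g k \<in> borel_measurable borel" unfolding g_def[abs_def] by measurable
  show "integrable lborel (g k)" unfolding g_def[abs_def] using G_int(1) by (intro Bochner_Integration.integrable_diff)
  show "0 \<le> g k z" for z
    using tr_mono[OF level_Suc[of k], of "snd z"] tr_nonneg[OF level_nonneg[of "Suc k"], of "snd z"] g_cases[of k "fst z" "snd z"] by simp
  show "g k (u, - x) = g k (u, x)" for u x by (simp add: g_cases tr_uminus)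
  \<comment> \<open>The subtracted k copies belong to the lower level, so at least one full copy of
    the integral at the higher level remains.\<close>
  have "(\<integral>z. g k z \<partial>lborel) = real (Suc k) * (\<integral>x. tr (a (Suc k)) x \<partial>lborel) - real k * (\<integral>x. tr (a k) x \<partial>lborel)"
    unfolding g_def using G_int(1) by (subst Bochner_Integration.integral_diff) (simp_all only: G_int(2))
  moreover have "(\<integral>x. tr (a k) x \<partial>lborel) \<le> (\<integral>x. tr (a (Suc k)) x \<partial>lborel)"
    by (intro integral_mono tr_int level_nonneg tr_mono level_Suc)
  then have "real k * (\<integral>x. tr (a k) x \<partial>lborel) \<le> real k * (\<integral>x. tr (a (Suc k)) x \<partial>lborel)"
    by (rule mult_left_mono) simp
  moreover have "0 < (\<integral>x. tr (a (Suc k)) x \<partial>lborel)" using a1[of "Suc k"] by (intro tr_pos) linarith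
  ultimately show "0 < (\<integral>z. g k z \<partial>lborel)" by (simp add: distrib_right)
qed

lemma g_rd: "radial_decreasing (\<lambda>x. g k (u, x))"
  using tr_diff_rd[OF level_Suc[of k]] tr_rd[OF level_nonneg[of "Suc k"]]
  by (cases "u \<le> 0"; cases "u \<le> real k"; cases "u \<le> real (Suc k)") (auto simp: g_cases radial_decreasing_def)

definition Psi :: "'b \<Rightarrow> real" where "Psi \<xi> = (\<integral>x. (1 - cos (\<xi> \<bullet> x)) * V x \<partial>lborel)"
definition PsiK :: "nat \<Rightarrow> 'b \<Rightarrow> real" where "PsiK K \<xi> = (\<integral>x. (1 - cos (\<xi> \<bullet> x)) * tr (a K) x \<partial>lborel)"
definition PsiB :: "nat \<Rightarrow> 'b \<Rightarrow> real" where
  "PsiB k \<xi> = (\<integral>x. (1 - cos (\<xi> \<bullet> x)) * (tr (a (Suc k)) x - tr (a k) x) \<partial>lborel)"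

lemma levy_char_partial_sum: "levy_char Om (S {..<K}) (real K) (PsiK K)"
  unfolding PsiK_def[abs_def]
  by (rule S_levy_char) (auto simp: sum_g G_def indicator_def tr_int[OF level_nonneg])

text \<open>Up to time k the block holds only jumps between two consecutive levels, which have a
  small exponent; its jumps of lower level come after time k.\<close>

lemma levy_char_block: "levy_char Om (S {k}) (real k) (PsiB k)"
  unfolding PsiB_def[abs_def]
  by (rule S_levy_char) (auto simp: g_cases intro!: Bochner_Integration.integrable_diff tr_int[OF level_nonneg])

lemma PsiB_nonneg: "0 \<le> PsiB k \<xi>"
  unfolding PsiB_def using tr_mono[OF level_Suc] by (intro Bochner_Integration.integral_nonneg mult_nonneg_nonneg) (auto simp: cos_le_one)

text \<open>Off the unit ball both truncations equal \<open>v\<close>, because \<open>v 1\<close>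
  lies below all levels. Inside, the quadratic bound on 1 - cos meets the second moment controlled
  by \<open>avar\<close>.\<close>

lemma PsiB_le: "PsiB k \<xi> \<le> (1 / 32) ^ k * (norm \<xi>)\<^sup>2"
proof -
  let ?h = "\<lambda>x. tr (a (Suc k)) x - tr (a k) x"
  have h0: "0 \<le> ?h x" for x using tr_mono[OF level_Suc] by simp
  have pt: "(1 - cos (\<xi> \<bullet> x)) * ?h x \<le> (norm \<xi>)\<^sup>2 * (min 1 ((norm x)\<^sup>2) * (V x - min (V x) (a k)))" for x
  proof (cases "x = 0")
    case False
    show ?thesis
    proof (cases "norm x \<le> 1")
      case True
      have "min 1 ((norm x)\<^sup>2) = (norm x)\<^sup>2" using True by (simp add: min_absorb2 power_le_one)
      moreover have "?h x \<le> V x - min (V x) (a k)" using False by (simp add: trunc_def V_def)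
      moreover have "1 - cos (\<xi> \<bullet> x) \<le> (norm \<xi>)\<^sup>2 * (norm x)\<^sup>2"
      proof -
        have "0 \<le> (norm \<xi>)\<^sup>2 * (norm x)\<^sup>2" by simp
        then show ?thesis using one_minus_cos_inner_le[of \<xi> x] by linarith
      qed
      ultimately have "(1 - cos (\<xi> \<bullet> x)) * ?h x \<le> ((norm \<xi>)\<^sup>2 * (norm x)\<^sup>2) * (V x - min (V x) (a k))"
        using h0[of x] by (intro mult_mono) auto
      then show ?thesis using \<open>min 1 ((norm x)\<^sup>2) = (norm x)\<^sup>2\<close> by (simp add: mult.assoc)
    next
      case F: False
      then have "v (norm x) \<le> v 1" by (intro v_mono) auto
      then have "?h x = 0" using av[of k] av[of "Suc k"] False by (simp add: trunc_def min_absorb1)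
      then show ?thesis using V_nonneg by simp
    qed
  qed simp
  have hi: "integrable lborel (\<lambda>x. (1 - cos (\<xi> \<bullet> x)) * ?h x)"
  proof (rule Bochner_Integration.integrable_bound)
    show "integrable lborel (\<lambda>x. 2 * ?h x)" by (intro integrable_mult_right Bochner_Integration.integrable_diff tr_int level_nonneg)
    have b: "\<bar>1 - cos t\<bar> \<le> \<bar>2\<bar>" for t :: real using cos_le_one[of t] cos_ge_minus_one[of t] by linarith
    show "AE x in lborel. norm ((1 - cos (\<xi> \<bullet> x)) * ?h x) \<le> norm (2 * ?h x)"
      unfolding real_norm_def abs_mult by (intro AE_I2 mult_right_mono b abs_ge_zero)
  qed simp
  have "PsiB k \<xi> \<le> (\<integral>x. (norm \<xi>)\<^sup>2 * (min 1 ((norm x)\<^sup>2) * (V x - min (V x) (a k))) \<partial>lborel)"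
    unfolding PsiB_def by (intro integral_mono hi integrable_mult_right V_tail_int level_nonneg pt)
  also have "\<dots> = (norm \<xi>)\<^sup>2 * (\<integral>x. min 1 ((norm x)\<^sup>2) * (V x - min (V x) (a k)) \<partial>lborel)"
    by (rule integral_mult_right_zero)
  also have "\<dots> \<le> (norm \<xi>)\<^sup>2 * (1 / 32) ^ k" by (intro mult_left_mono avar) simp
  finally show ?thesis by (simp add: mult.commute)
qed

text \<open>In \<open>levy_maximal\<close> take e = 2^-k, time k and c = 32^-k. The bound is a
  constant times k 8^-k, hence at most the same constant times 4^-k, and Borel-Cantelli
  applies.\<close>

lemma AE_good: "AE \<omega> in Om. good \<omega>"
proof -
  define C where "C = 6 * gauss_moment TYPE('b)"
  have C: "0 \<le> C" unfolding C_def gauss_moment_def by simp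
  have "\<exists>A\<in>events. prob A \<le> C * (1 / 4) ^ k \<and>
     (\<forall>\<omega>\<in>space Om - A. \<forall>t. 0 \<le> t \<and> t < real k \<longrightarrow> norm (Z k t \<omega>) \<le> 2 * (1 / 2) ^ k)" for k
  proof (cases "k = 0")
    \<comment> \<open>For k = 0 no time is to be controlled; \<open>levy_maximal\<close> asks for a
      positive horizon.\<close>
    case True then show ?thesis using C by (intro bexI[of _ "{}"]) auto
  next
    case False
    have "\<exists>A\<in>events. prob A \<le> 6 * real k * (1 / 32) ^ k * gauss_moment TYPE('b) / ((1 / 2) ^ k)\<^sup>2 \<and>
     (\<forall>\<omega>\<in>space Om - A. \<forall>t. 0 \<le> t \<and> t < real k \<longrightarrow> norm (S {k} t \<omega>) \<le> 2 * (1 / 2) ^ k)"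
    proof (rule levy_maximal[OF S_meas levy_char_block _ PsiB_nonneg PsiB_le])
      show "PsiB k 0 = 0" by (simp add: PsiB_def)
    qed (use False S_right in auto)
    moreover have "6 * real k * (1 / 32) ^ k * gauss_moment TYPE('b) / ((1 / 2) ^ k)\<^sup>2 \<le> C * (1 / 4) ^ k"
    proof -
      have e: "(1 / 32 :: real) ^ k / ((1 / 2) ^ k)\<^sup>2 = (1 / 8) ^ k"
        by (simp add: power2_eq_square power_mult_distrib[symmetric] power_divide[symmetric])
      have "6 * real k * (1 / 32) ^ k * gauss_moment TYPE('b) / ((1 / 2) ^ k)\<^sup>2 = C * (real k * ((1 / 32) ^ k / ((1 / 2) ^ k)\<^sup>2))"
        by (simp add: C_def)
      also have "\<dots> = C * (real k * (1 / 8) ^ k)" by (simp only: e)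
      also have "\<dots> \<le> C * (2 ^ k * (1 / 8) ^ k)"
        using C by (intro mult_left_mono mult_right_mono) (auto intro: less_imp_le of_nat_less_two_power)
      also have "\<dots> = C * (1 / 4) ^ k" by (simp add: power_mult_distrib[symmetric])
      finally show ?thesis .
    qed
    ultimately show ?thesis unfolding S_def by (simp, meson order_trans)
  qed
  then obtain A where A: "\<And>k. A k \<in> events" "\<And>k. prob (A k) \<le> C * (1 / 4) ^ k"
    "\<And>k \<omega> t. \<omega> \<in> space Om - A k \<Longrightarrow> 0 \<le> t \<Longrightarrow> t < real k \<Longrightarrow> norm (Z k t \<omega>) \<le> 2 * (1 / 2) ^ k"
    by metis
  have "summable (\<lambda>k. prob (A k))"
  proof (rule summable_comparison_test'[where N=0])
    show "summable (\<lambda>k. C * (1 / 4) ^ k)" by (intro summable_mult summable_geometric) simp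
    show "norm (prob (A k)) \<le> C * (1 / 4) ^ k" for k using A(2)[of k] by simp
  qed
  then have "AE \<omega> in Om. eventually (\<lambda>k. \<omega> \<in> space Om - A k) sequentially"
    by (intro borel_cantelli_AE1 A(1)) (simp_all add: emeasure_eq_measure)
  then show ?thesis
  proof eventually_elim
    case (elim \<omega>)
    then show ?case unfolding good_def eventually_sequentially using A(3) by meson
  qed
qed

lemma PsiK_lim: "(\<lambda>K. PsiK K \<xi>) \<longlonglongrightarrow> Psi \<xi>"
  unfolding PsiK_def Psi_def
proof (rule integral_dominated_convergence[where w="\<lambda>x. (2 + (norm \<xi>)\<^sup>2) * (min 1 ((norm x)\<^sup>2) * V x)"])
  show "integrable lborel (\<lambda>x. (2 + (norm \<xi>)\<^sup>2) * (min 1 ((norm x)\<^sup>2) * V x))"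
    by (intro integrable_mult_right V_int)
  show "AE x in lborel. (\<lambda>K. (1 - cos (\<xi> \<bullet> x)) * tr (a K) x) \<longlonglongrightarrow> (1 - cos (\<xi> \<bullet> x)) * V x"
  proof (intro AE_I2)
    fix x :: 'b
    show "(\<lambda>K. (1 - cos (\<xi> \<bullet> x)) * tr (a K) x) \<longlonglongrightarrow> (1 - cos (\<xi> \<bullet> x)) * V x"
    proof (cases "x = 0")
      case False
      obtain N where N: "V x < real N" using reals_Archimedean2 by blast
      have "eventually (\<lambda>K. (1 - cos (\<xi> \<bullet> x)) * tr (a K) x = (1 - cos (\<xi> \<bullet> x)) * V x) sequentially"
        using eventually_ge_at_top[of N]
      proof eventually_elim
        case (elim K)
        then have "real N \<le> real K" by simp
        then have "V x \<le> a K" using N ak[of K] by linarith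
        then show ?case using False by (simp add: tr_eq min_absorb1)
      qed
      then show ?thesis by (rule tendsto_eventually)
    qed simp
  qed
  show "AE x in lborel. norm ((1 - cos (\<xi> \<bullet> x)) * tr (a K) x) \<le> (2 + (norm \<xi>)\<^sup>2) * (min 1 ((norm x)\<^sup>2) * V x)" for K
  proof (intro AE_I2)
    fix x :: 'b
    have c0: "0 \<le> 1 - cos (\<xi> \<bullet> x)" by simp
    have "(1 - cos (\<xi> \<bullet> x)) * tr (a K) x \<le> ((2 + (norm \<xi>)\<^sup>2) * min 1 ((norm x)\<^sup>2)) * V x"
    proof (cases "x = 0")
      case False
      then show ?thesis using one_minus_cos_inner_bound[of \<xi> x] tr_le_V[of x "a K"] tr_nonneg[OF level_nonneg[of K], of x] c0
        by (intro mult_mono) auto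
    qed simp
    moreover have "0 \<le> (1 - cos (\<xi> \<bullet> x)) * tr (a K) x" using c0 tr_nonneg[OF level_nonneg] by (intro mult_nonneg_nonneg)
    ultimately show "norm ((1 - cos (\<xi> \<bullet> x)) * tr (a K) x) \<le> (2 + (norm \<xi>)\<^sup>2) * (min 1 ((norm x)\<^sup>2) * V x)"
      by (simp add: mult.assoc)
  qed
qed simp_all

lemma Psi_nonneg: "0 \<le> Psi \<xi>"
  unfolding Psi_def using V_nonneg by (intro Bochner_Integration.integral_nonneg mult_nonneg_nonneg) (auto simp: cos_le_one)

lemma Psi_v: "Psi \<xi> = (\<integral>x. (1 - cos (\<xi> \<bullet> x)) * v (norm x) \<partial>lborel)"
  unfolding Psi_def by (intro Bochner_Integration.integral_cong refl) (simp add: V_def)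

lemma exists_process:
  "\<exists>(M :: (real \<Rightarrow> 'b) measure) (X :: real \<Rightarrow> (real \<Rightarrow> 'b) \<Rightarrow> 'b). levy_process M X \<and>
    (\<forall>t\<ge>0. \<forall>\<xi>. char_fun_at M X t \<xi> = complex_of_real (exp (- (t * (\<integral>x. (1 - cos (\<xi> \<bullet> x)) * v (norm x) \<partial>lborel))))) \<and>
    (\<forall>t\<ge>0. \<forall>r. radial_decreasing (\<lambda>x. measure M {\<omega>\<in>space M. X t \<omega> \<in> cball x r}))"
proof -
  define M where "M = embed_measure Om (encode_path :: _ \<Rightarrow> real \<Rightarrow> 'b)"
  define r :: "(real \<Rightarrow> 'b) \<Rightarrow> _" where "r = the_inv encode_path"
  have re: "r (encode_path \<omega>) = \<omega>" for \<omega> unfolding r_def by (rule the_inv_f_f[OF inj_encode_path])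
  have rm: "r \<in> M \<rightarrow>\<^sub>M Om" unfolding M_def by (rule measurable_embed_measure1) (simp add: re)
  have em: "encode_path \<in> Om \<rightarrow>\<^sub>M M" unfolding M_def by (rule measurable_embed_measure2[OF inj_encode_path])
  have Me: "M = distr Om M encode_path" unfolding M_def by (rule embed_measure_eq_distr[OF inj_encode_path])
  have d: "distr M Om r = Om"
    by (subst Me, subst distr_distr[OF rm em]) (simp add: comp_def re distr_id)
  interpret M: prob_space M by (subst Me, rule prob_space_distr[OF em])
  let ?X = "\<lambda>t \<omega>. X t (r \<omega>)"
  have Xm: "?X t \<in> borel_measurable M" for t by (rule measurable_compose[OF rm X_meas])
  have lc: "levy_char M ?X T Psi" for T
    by (rule levy_char_distr[OF rm d X_meas X_levy_char[OF AE_good levy_char_partial_sum PsiK_lim]])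
  have gd: "AE \<omega> in M. good (r \<omega>)"
    using AE_good by (subst (asm) d[symmetric]) (rule AE_distrD[OF rm])
  have A: "levy_process M ?X"
  proof (rule M.levy_process_of_levy_char[OF Xm lc])
    show "Psi 0 = 0" by (simp add: Psi_def)
    show "AE \<omega> in M. (\<forall>t\<ge>0. ((\<lambda>s. X s (r \<omega>)) \<longlongrightarrow> X t (r \<omega>)) (at_right t)) \<and>
        (\<forall>t>0. \<exists>l. ((\<lambda>s. X s (r \<omega>)) \<longlongrightarrow> l) (at_left t))"
      using gd by eventually_elim (use good_right good_left in blast)
  qed (rule Psi_nonneg)
  have B: "char_fun_at M ?X t \<xi> = complex_of_real (exp (- (t * (\<integral>x. (1 - cos (\<xi> \<bullet> x)) * v (norm x) \<partial>lborel))))"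
    if "0 \<le> t" for t \<xi>
    unfolding char_fun_at_def using M.levy_char_single[OF lc[of t] that order_refl, of \<xi>] by (simp only: Psi_v)
  have C: "radial_decreasing (\<lambda>x. measure M {\<omega>\<in>space M. ?X t \<omega> \<in> cball x \<rho>})" if t: "0 \<le> t" for t \<rho>
  proof -
    have "radial_decreasing (\<lambda>x. measure Om {\<omega>\<in>space Om. X t \<omega> \<in> cball x \<rho>})"
    proof (rule unimodal_limit_cball[where Y="\<lambda>K. S {..<K} t"])
      show "unimodal_rv Om (S {..<K} t)" for K by (rule unimodal_S[OF g_rd]) simp
      show "AE \<omega> in Om. (\<lambda>K. S {..<K} t \<omega>) \<longlonglongrightarrow> X t \<omega>"
        using AE_good by eventually_elim (rule good_pointwise[OF _ t])
    qed simp_all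
    moreover have "measure M {\<omega>\<in>space M. ?X t \<omega> \<in> cball x \<rho>} = measure Om {\<omega>\<in>space Om. X t \<omega> \<in> cball x \<rho>}" for x
    proof -
      have [measurable]: "cball x \<rho> \<in> sets borel" by simp
      have [measurable]: "{\<omega>\<in>space Om. X t \<omega> \<in> cball x \<rho>} \<in> sets Om" by measurable
      have "measure (distr M Om r) {\<omega>\<in>space Om. X t \<omega> \<in> cball x \<rho>} = measure M (r -` {\<omega>\<in>space Om. X t \<omega> \<in> cball x \<rho>} \<inter> space M)"
        by (rule measure_distr[OF rm]) simp
      also have "r -` {\<omega>\<in>space Om. X t \<omega> \<in> cball x \<rho>} \<inter> space M = {\<omega>\<in>space M. ?X t \<omega> \<in> cball x \<rho>}"
        using measurable_space[OF rm] by auto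
      finally show ?thesis by (simp add: d)
    qed
    ultimately show ?thesis by simp
  qed
  show ?thesis
    by (rule exI[of _ M], rule exI[of _ ?X], intro conjI allI impI) (rule A, erule B, erule C)
qed

end

lemma (in radial_levy_density) exists_radial_levy_process:
  "\<exists>(M :: (real \<Rightarrow> 'b) measure) (X :: real \<Rightarrow> (real \<Rightarrow> 'b) \<Rightarrow> 'b). levy_process M X \<and>
    (\<forall>t\<ge>0. \<forall>\<xi>. char_fun_at M X t \<xi> = complex_of_real (exp (- (t * (\<integral>x. (1 - cos (\<xi> \<bullet> x)) * v (norm x) \<partial>lborel))))) \<and>
    (\<forall>t\<ge>0. \<forall>r. radial_decreasing (\<lambda>x. measure M {\<omega>\<in>space M. X t \<omega> \<in> cball x r}))"
proof -
  obtain a where a: "incseq a" "\<And>k. 1 \<le> a k" "\<And>k. v 1 \<le> a k" "\<And>k. real k \<le> a k"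
     "\<And>k. (\<integral>x. min 1 ((norm x)\<^sup>2) * (V x - min (V x) (a k)) \<partial>lborel) \<le> (1 / 32) ^ k"
    using exists_levels by blast
  interpret radial_levy_levels v dum r0 a by unfold_locales (use a in auto)
  show ?thesis by (rule exists_process)
qed

section \<open>Densities of unimodal laws\<close>

definition translation_continuous :: "('b::euclidean_space \<Rightarrow> real) \<Rightarrow> bool" where
  "translation_continuous F \<longleftrightarrow> (\<forall>h. h \<longlonglongrightarrow> 0 \<longrightarrow> (\<lambda>n. \<integral>x. \<bar>F (x + h n) - F x\<bar> \<partial>lborel) \<longlonglongrightarrow> 0)"

lemma integral_lborel_shift:
  fixes f :: "'b::euclidean_space \<Rightarrow> 'c::{banach,second_countable_topology}"
  assumes [measurable]: "f \<in> borel_measurable borel"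
  shows "(\<integral>x. f (x + h) \<partial>lborel) = (\<integral>x. f x \<partial>lborel)"
proof -
  have "(\<integral>x. f x \<partial>distr lborel borel ((+) h)) = (\<integral>x. f (h + x) \<partial>lborel)" by (rule integral_distr) simp_all
  then show ?thesis by (simp add: lborel_distr_plus add.commute)
qed

lemma integrable_lborel_shift:
  fixes f :: "'b::euclidean_space \<Rightarrow> 'c::{banach,second_countable_topology}"
  assumes f: "integrable lborel f"
  shows "integrable lborel (\<lambda>x. f (x + h))"
proof -
  have "integrable (distr lborel borel ((+) h)) f" using f by (simp add: lborel_distr_plus)
  then have "integrable lborel (\<lambda>x. f (h + x))" by (rule integrable_distr[rotated]) simp
  then show ?thesis by (simp add: add.commute)
qed

lemma integrable_lborel_reflect:
  fixes f :: "'b::euclidean_space \<Rightarrow> 'c::{banach,second_countable_topology}"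
  assumes f: "integrable lborel f"
  shows "integrable lborel (\<lambda>x. f (h - x))"
proof -
  have [measurable]: "f \<in> borel_measurable borel" using borel_measurable_integrable[OF f] by simp
  have d: "distr lborel borel uminus = (lborel :: 'b measure)"
    by (rule distr_lborel_isometry) (auto intro: linear_uminus)
  have "integrable (distr lborel borel uminus) (\<lambda>x. f (x + h))" unfolding d by (rule integrable_lborel_shift[OF f])
  then have "integrable lborel (\<lambda>x. f (- x + h))" by (rule integrable_distr[rotated]) simp
  then show ?thesis by simp
qed

lemma integral_lborel_reflect:
  fixes f :: "'b::euclidean_space \<Rightarrow> 'c::{banach,second_countable_topology}"
  assumes [measurable]: "f \<in> borel_measurable borel"
  shows "(\<integral>x. f (h - x) \<partial>lborel) = (\<integral>x. f x \<partial>lborel)"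
proof -
  have "(\<integral>x. f (- x + h) \<partial>lborel) = (\<integral>x. f (x + h) \<partial>lborel)"
    by (rule integral_lborel_uminus) measurable
  then show ?thesis using integral_lborel_shift[of f h] by simp
qed

lemma translation_continuous_approx:
  fixes F :: "'b::euclidean_space \<Rightarrow> real"
  assumes F: "integrable lborel F"
    and ap: "\<And>e. 0 < e \<Longrightarrow> \<exists>G. integrable lborel G \<and> translation_continuous G \<and> (\<integral>x. \<bar>F x - G x\<bar> \<partial>lborel) < e"
  shows "translation_continuous F"
  unfolding translation_continuous_def
proof (intro allI impI LIMSEQ_I)
  fix h :: "nat \<Rightarrow> 'b" and e :: real assume h: "h \<longlonglongrightarrow> 0" and e: "0 < e"
  obtain G where G: "integrable lborel G" "translation_continuous G" "(\<integral>x. \<bar>F x - G x\<bar> \<partial>lborel) < e / 4"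
    using ap[of "e / 4"] e by auto
  have [measurable]: "F \<in> borel_measurable borel" "G \<in> borel_measurable borel"
    using borel_measurable_integrable[OF F] borel_measurable_integrable[OF G(1)] by simp_all
  have "(\<lambda>n. \<integral>x. \<bar>G (x + h n) - G x\<bar> \<partial>lborel) \<longlonglongrightarrow> 0" using G(2) h by (simp add: translation_continuous_def)
  from LIMSEQ_D[OF this, of "e / 4"] e obtain N where N: "\<And>n. n \<ge> N \<Longrightarrow> \<bar>\<integral>x. \<bar>G (x + h n) - G x\<bar> \<partial>lborel\<bar> < e / 4"
    by auto
  show "\<exists>N. \<forall>n\<ge>N. norm ((\<integral>x. \<bar>F (x + h n) - F x\<bar> \<partial>lborel) - 0) < e"
  proof (intro exI allI impI)
    fix n assume n: "n \<ge> N"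
    have D: "integrable lborel (\<lambda>x. \<bar>F x - G x\<bar>)" using F G(1) by (intro integrable_abs Bochner_Integration.integrable_diff)
    have Dh: "integrable lborel (\<lambda>x. \<bar>F (x + h n) - G (x + h n)\<bar>)" using integrable_lborel_shift[OF D] .
    have Gh: "integrable lborel (\<lambda>x. \<bar>G (x + h n) - G x\<bar>)"
      using G(1) integrable_lborel_shift[OF G(1)] by (intro integrable_abs Bochner_Integration.integrable_diff)
    have Fh: "integrable lborel (\<lambda>x. \<bar>F (x + h n) - F x\<bar>)"
      using F integrable_lborel_shift[OF F] by (intro integrable_abs Bochner_Integration.integrable_diff)
    have "(\<integral>x. \<bar>F (x + h n) - F x\<bar> \<partial>lborel) \<le> (\<integral>x. (\<bar>F (x + h n) - G (x + h n)\<bar> + \<bar>G (x + h n) - G x\<bar>) + \<bar>F x - G x\<bar> \<partial>lborel)"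
      by (intro integral_mono Fh Bochner_Integration.integrable_add Dh Gh D) linarith
    also have "\<dots> = (\<integral>x. \<bar>F (x + h n) - G (x + h n)\<bar> \<partial>lborel) + (\<integral>x. \<bar>G (x + h n) - G x\<bar> \<partial>lborel) + (\<integral>x. \<bar>F x - G x\<bar> \<partial>lborel)"
      by (subst Bochner_Integration.integral_add[OF Bochner_Integration.integrable_add[OF Dh Gh] D])
        (simp only: Bochner_Integration.integral_add[OF Dh Gh])
    also have "(\<integral>x. \<bar>F (x + h n) - G (x + h n)\<bar> \<partial>lborel) = (\<integral>x. \<bar>F x - G x\<bar> \<partial>lborel)"
      by (rule integral_lborel_shift) measurable
    finally have "(\<integral>x. \<bar>F (x + h n) - F x\<bar> \<partial>lborel) < e"
      using G(3) N[OF n] e by linarith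
    moreover have "0 \<le> (\<integral>x. \<bar>F (x + h n) - F x\<bar> \<partial>lborel)" by simp
    ultimately show "norm ((\<integral>x. \<bar>F (x + h n) - F x\<bar> \<partial>lborel) - 0) < e" by simp
  qed
qed

text \<open>For values s, t in {0, 1} the distance |s - t| is s + t - 2 s t, and translation
  preserves integrals, so only the mixed term has to converge. That term lives on U, where openness
  gives eventual membership; the boundary of U, which may have positive measure, never
  enters.\<close>

lemma translation_continuous_indicator_open:
  assumes U: "open U" and fin: "emeasure lborel U < \<infinity>"
  shows "translation_continuous (\<lambda>x::'b::euclidean_space. indicator U x * c)"
  unfolding translation_continuous_def
proof (intro allI impI)
  fix h :: "nat \<Rightarrow> 'b" assume h: "h \<longlonglongrightarrow> 0"
  have [measurable]: "U \<in> sets borel" using U by simp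
  have iU: "integrable lborel (indicator U :: 'b \<Rightarrow> real)" using fin by (intro integrable_real_indicator) simp_all
  have iUh: "integrable lborel (\<lambda>x. indicator U (x + h n) :: real)" for n by (rule integrable_lborel_shift[OF iU])
  have iP: "integrable lborel (\<lambda>x. indicator U (x + h n) * indicator U x :: real)" for n
    by (rule Bochner_Integration.integrable_bound[OF iU]) (auto simp: indicator_def)
  have L: "(\<lambda>n. \<integral>x. indicator U (x + h n) * indicator U x \<partial>lborel) \<longlonglongrightarrow> (\<integral>x. (indicator U x :: real) \<partial>lborel)"
  proof (rule integral_dominated_convergence[OF _ _ iU])
    show "AE x in lborel. (\<lambda>n. indicator U (x + h n) * indicator U x) \<longlonglongrightarrow> (indicator U x :: real)"
    proof (intro AE_I2)
      fix x :: 'b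
      show "(\<lambda>n. indicator U (x + h n) * indicator U x) \<longlonglongrightarrow> (indicator U x :: real)"
      proof (cases "x \<in> U")
        case True
        have "(\<lambda>n. x + h n) \<longlonglongrightarrow> x + 0" by (intro tendsto_intros h)
        then have "eventually (\<lambda>n. x + h n \<in> U) sequentially" using topological_tendstoD[OF _ U] True by force
        then have "eventually (\<lambda>n. indicator U (x + h n) * indicator U x = (indicator U x :: real)) sequentially"
          by eventually_elim simp
        then show ?thesis by (rule tendsto_eventually)
      qed simp
    qed
  qed (auto simp: indicator_def)
  have e: "(\<integral>x. \<bar>indicator U (x + h n) * c - indicator U x * c\<bar> \<partial>lborel)
      = \<bar>c\<bar> * (2 * (\<integral>x. indicator U x \<partial>lborel) - 2 * (\<integral>x. indicator U (x + h n) * indicator U x \<partial>lborel))" for n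
  proof -
    have "(\<integral>x. \<bar>indicator U (x + h n) * c - indicator U x * c\<bar> \<partial>lborel)
       = (\<integral>x. \<bar>c\<bar> * ((indicator U (x + h n) + indicator U x) - 2 * (indicator U (x + h n) * indicator U x)) \<partial>lborel)"
      by (intro Bochner_Integration.integral_cong refl) (auto simp: indicator_def)
    also have "\<dots> = \<bar>c\<bar> * (((\<integral>x. indicator U (x + h n) \<partial>lborel) + (\<integral>x. indicator U x \<partial>lborel)) - 2 * (\<integral>x. indicator U (x + h n) * indicator U x \<partial>lborel))"
      by (simp only: integral_mult_right_zero Bochner_Integration.integral_add[OF iUh iU]
          Bochner_Integration.integral_diff[OF Bochner_Integration.integrable_add[OF iUh iU] integrable_mult_right[OF iP]])
    also have "(\<integral>x. indicator U (x + h n) \<partial>lborel) = (\<integral>x. (indicator U x :: real) \<partial>lborel)"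
      by (rule integral_lborel_shift) measurable
    finally show ?thesis by simp
  qed
  have "(\<lambda>n. \<bar>c\<bar> * (2 * (\<integral>x. indicator U x \<partial>lborel) - 2 * (\<integral>x. indicator U (x + h n) * indicator U x \<partial>lborel)))
     \<longlonglongrightarrow> \<bar>c\<bar> * (2 * (\<integral>x. indicator U x \<partial>lborel) - 2 * (\<integral>x. indicator U x \<partial>lborel))"
    by (intro tendsto_intros L)
  then show "(\<lambda>n. \<integral>x. \<bar>indicator U (x + h n) * c - indicator U x * c\<bar> \<partial>lborel) \<longlonglongrightarrow> 0" unfolding e by simp
qed

text \<open>Outer regularity reduces indicators of Borel sets to open sets; sums and dominated
  limits of simple functions give the general case.\<close>

lemma translation_continuous_integrable:
  fixes F :: "'b::euclidean_space \<Rightarrow> real"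
  assumes "integrable lborel F"
  shows "translation_continuous F"
  using assms
proof (induction rule: integrable_induct)
  case (base A c)
  then have [measurable]: "A \<in> sets borel" by simp
  have iA: "integrable lborel (\<lambda>x. indicator A x *\<^sub>R c)"
    using base by (intro integrable_scaleR_left integrable_real_indicator) auto
  show ?case
  proof (rule translation_continuous_approx[OF iA])
    fix e :: real assume e: "0 < e"
    \<comment> \<open>The added 1 avoids a division by zero when c = 0.\<close>
    define e' where "e' = e / (2 * (\<bar>c\<bar> + 1))"
    have e': "0 < e'" using e by (simp add: e'_def)
    obtain U where U: "open U" "A \<subseteq> U" "emeasure lborel (U - A) < ennreal e'"
      using outer_regular_lborel[of A e'] e' by auto
    have [measurable]: "U \<in> sets borel" using U by simp
    have fD: "emeasure lborel (U - A) < \<infinity>" using U(3) by (rule less_trans) simp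
    have "emeasure lborel U \<le> emeasure lborel A + emeasure lborel (U - A)"
      using U(2) by (subst plus_emeasure) (auto intro!: emeasure_mono)
    also have "\<dots> < \<infinity>" using base(2) fD by simp
    finally have fU: "emeasure lborel U < \<infinity>" .
    have m: "measure lborel (U - A) < e'"
      using U(3) e' fD by (simp add: emeasure_eq_ennreal_measure ennreal_less_iff)
    have "(\<integral>x. \<bar>indicator A x *\<^sub>R c - indicator U x * c\<bar> \<partial>lborel) = (\<integral>x. \<bar>c\<bar> * indicator (U - A) x \<partial>lborel)"
      using U(2) by (intro Bochner_Integration.integral_cong refl) (auto simp: indicator_def)
    also have "\<dots> = \<bar>c\<bar> * measure lborel (U - A)" by simp
    also have "\<dots> \<le> \<bar>c\<bar> * e'" using m by (intro mult_left_mono) auto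
    also have "\<dots> < e" using e by (simp add: e'_def field_simps) (smt (verit) mult_nonneg_nonneg)
    finally have "(\<integral>x. \<bar>indicator A x *\<^sub>R c - indicator U x * c\<bar> \<partial>lborel) < e" .
    moreover have "integrable lborel (\<lambda>x. indicator U x * c)" using fU by (intro integrable_mult_left integrable_real_indicator) auto
    ultimately show "\<exists>G. integrable lborel G \<and> translation_continuous G \<and> (\<integral>x. \<bar>indicator A x *\<^sub>R c - G x\<bar> \<partial>lborel) < e"
      using translation_continuous_indicator_open[OF U(1) fU, of c] by blast
  qed
next
  case (add f g)
  show ?case unfolding translation_continuous_def
  proof (intro allI impI)
    fix h :: "nat \<Rightarrow> 'b" assume h: "h \<longlonglongrightarrow> 0"
    let ?d = "\<lambda>f n. \<integral>x. \<bar>f (x + h n) - f x\<bar> \<partial>lborel"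
    have i: "integrable lborel (\<lambda>x. \<bar>f (x + h n) - f x\<bar>)" if "integrable lborel f" for f :: "'b \<Rightarrow> real" and n
      using that integrable_lborel_shift[OF that] by (intro integrable_abs Bochner_Integration.integrable_diff)
    have "(\<lambda>n. ?d f n + ?d g n) \<longlonglongrightarrow> 0 + 0"
      using add h by (intro tendsto_add) (auto simp: translation_continuous_def)
    then have L: "(\<lambda>n. ?d f n + ?d g n) \<longlonglongrightarrow> 0" by simp
    have "?d (\<lambda>x. f x + g x) n \<le> ?d f n + ?d g n" for n
    proof -
      have "?d (\<lambda>x. f x + g x) n \<le> (\<integral>x. \<bar>f (x + h n) - f x\<bar> + \<bar>g (x + h n) - g x\<bar> \<partial>lborel)"
        using add.hyps by (intro integral_mono i Bochner_Integration.integrable_add) auto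
      then show ?thesis using i[OF add.hyps(1)] i[OF add.hyps(2)] by simp
    qed
    then show "(\<lambda>n. ?d (\<lambda>x. f x + g x) n) \<longlonglongrightarrow> 0"
      by (intro tendsto_sandwich[OF _ _ tendsto_const L]) (auto intro!: always_eventually)
  qed
next
  case (lim f s)
  have [measurable]: "f \<in> borel_measurable borel" "s i \<in> borel_measurable borel" for i
    using borel_measurable_integrable[OF lim.hyps(4)] borel_measurable_integrable[OF lim.hyps(1)] by simp_all
  show ?case
  proof (rule translation_continuous_approx[OF lim.hyps(4)])
    fix e :: real assume e: "0 < e"
    have "(\<lambda>i. \<integral>x. \<bar>f x - s i x\<bar> \<partial>lborel) \<longlonglongrightarrow> (\<integral>x. 0 \<partial>(lborel :: 'b measure))"
    proof (rule integral_dominated_convergence[where w="\<lambda>x. 3 * \<bar>f x\<bar>"])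
      show "integrable lborel (\<lambda>x. 3 * \<bar>f x\<bar>)" using lim.hyps(4) by (intro integrable_mult_right integrable_abs)
      show "AE x in lborel. (\<lambda>i. \<bar>f x - s i x\<bar>) \<longlonglongrightarrow> 0"
      proof (intro AE_I2)
        fix x :: 'b
        have "(\<lambda>i. \<bar>f x - s i x\<bar>) \<longlonglongrightarrow> \<bar>f x - f x\<bar>" using lim.hyps(2)[of x] by (intro tendsto_intros) simp
        then show "(\<lambda>i. \<bar>f x - s i x\<bar>) \<longlonglongrightarrow> 0" by simp
      qed
      show "AE x in lborel. norm \<bar>f x - s i x\<bar> \<le> 3 * \<bar>f x\<bar>" for i
      proof (intro AE_I2)
        fix x :: 'b
        show "norm \<bar>f x - s i x\<bar> \<le> 3 * \<bar>f x\<bar>" using lim.hyps(3)[of x i] by simp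
      qed
    qed simp_all
    then have "eventually (\<lambda>i. (\<integral>x. \<bar>f x - s i x\<bar> \<partial>lborel) < e) sequentially"
      using e by (intro order_tendstoD(2)) simp_all
    then obtain i where "(\<integral>x. \<bar>f x - s i x\<bar> \<partial>lborel) < e" using eventually_happens'[OF sequentially_bot] by blast
    then show "\<exists>G. integrable lborel G \<and> translation_continuous G \<and> (\<integral>x. \<bar>f x - G x\<bar> \<partial>lborel) < e"
      using lim.hyps(1) lim.IH by blast
  qed
qed

text \<open>The measure argument only fixes the type.\<close>

definition ball_volume :: "'b::euclidean_space measure \<Rightarrow> real \<Rightarrow> ennreal" where
  "ball_volume _ r = emeasure lborel (cball (0::'b) r)"

section \<open>Laws whose ball masses decrease with the distance from the origin\<close>

definition ball_unimodal :: "'b::euclidean_space measure \<Rightarrow> bool" where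
  "ball_unimodal \<mu> \<longleftrightarrow> (\<forall>r. radial_decreasing (\<lambda>x. measure \<mu> (cball x r)))"

locale unimodal_law = prob_space \<mu> for \<mu> :: "'b::euclidean_space measure" +
  assumes sets_mu[simp, measurable_cong]: "sets \<mu> = sets borel" and uni: "ball_unimodal \<mu>"
begin

lemma space_mu[simp]: "space \<mu> = UNIV"
  using sets_eq_imp_space_eq[OF sets_mu] by simp

text \<open>Measures the pairs at distance at most e by their first or by their second point; this
  trades ball masses under \<open>\<mu>\<close> for Lebesgue volumes.\<close>

lemma fubini_cball:
  assumes [measurable]: "A \<in> sets borel"
  shows "(\<integral>\<^sup>+x. indicator A x * emeasure \<mu> (cball x e) \<partial>lborel) = (\<integral>\<^sup>+z. emeasure lborel (A \<inter> cball z e) \<partial>\<mu>)"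
proof -
  interpret P: pair_sigma_finite lborel \<mu> ..
  let ?f = "\<lambda>x z. if x \<in> A \<and> dist x z \<le> e then 1 else 0 :: ennreal"
  have m: "case_prod ?f \<in> borel_measurable (lborel \<Otimes>\<^sub>M \<mu>)" by measurable
  have "(\<integral>\<^sup>+z. (\<integral>\<^sup>+x. ?f x z \<partial>lborel) \<partial>\<mu>) = (\<integral>\<^sup>+x. (\<integral>\<^sup>+z. ?f x z \<partial>\<mu>) \<partial>lborel)"
    by (rule P.Fubini'[OF m])
  moreover have "(\<integral>\<^sup>+x. ?f x z \<partial>lborel) = emeasure lborel (A \<inter> cball z e)" for z
  proof -
    have "(\<integral>\<^sup>+x. ?f x z \<partial>lborel) = (\<integral>\<^sup>+x. indicator (A \<inter> cball z e) x \<partial>lborel)"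
      by (intro nn_integral_cong) (auto simp: indicator_def dist_commute)
    then show ?thesis by simp
  qed
  moreover have "(\<integral>\<^sup>+z. ?f x z \<partial>\<mu>) = indicator A x * emeasure \<mu> (cball x e)" for x
  proof -
    have "(\<integral>\<^sup>+z. ?f x z \<partial>\<mu>) = (\<integral>\<^sup>+z. indicator A x * indicator (cball x e) z \<partial>\<mu>)"
      by (intro nn_integral_cong) (auto simp: indicator_def)
    then show ?thesis by (simp add: nn_integral_cmult_indicator)
  qed
  ultimately show ?thesis by simp
qed

abbreviation "vol \<equiv> ball_volume \<mu>"

lemma vol_pos: "0 < r \<Longrightarrow> 0 < vol r" and vol_fin: "0 \<le> r \<Longrightarrow> vol r < \<infinity>"
  and vol_shift: "0 \<le> r \<Longrightarrow> emeasure lborel (cball (x::'b) r) = vol r"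
  unfolding ball_volume_def by (auto simp: emeasure_cball ennreal_zero_less_mult_iff)

text \<open>Every ball of radius e centred within distance r of the origin carries at least the mass
  of the ball at y, and by Fubini the masses of all balls of radius e integrate to
  \<open>vol e\<close>.\<close>

lemma cball_bound:
  assumes r: "0 < r" "r \<le> norm y" and e: "0 < e"
  shows "emeasure \<mu> (cball y e) * vol r \<le> vol e"
proof -
  have "emeasure \<mu> (cball y e) * vol r = (\<integral>\<^sup>+x. emeasure \<mu> (cball y e) * indicator (cball (0::'b) r) x \<partial>lborel)"
    by (simp add: nn_integral_cmult_indicator ball_volume_def)
  also have "\<dots> \<le> (\<integral>\<^sup>+x. indicator UNIV x * emeasure \<mu> (cball x e) \<partial>lborel)"
  proof (rule nn_integral_mono)
    fix x :: 'b
    have "norm x \<le> norm y \<Longrightarrow> emeasure \<mu> (cball y e) \<le> emeasure \<mu> (cball x e)"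
      using uni by (simp add: ball_unimodal_def radial_decreasing_def emeasure_eq_measure ennreal_leI)
    then show "emeasure \<mu> (cball y e) * indicator (cball 0 r) x \<le> indicator UNIV x * emeasure \<mu> (cball x e)"
      using r by (cases "norm x \<le> r") (auto simp: indicator_def)
  qed
  also have "\<dots> = (\<integral>\<^sup>+z. emeasure lborel (UNIV \<inter> cball z e) \<partial>\<mu>)" by (rule fubini_cball) simp
  also have "\<dots> = vol e" using e emeasure_space_1 by (simp add: vol_shift)
  finally show ?thesis .
qed

text \<open>A small enough ball around a point of an open set lies inside it, so by Fatou the
  measure of A is at most a lower limit of averaged ball masses over A, to which
  \<open>cball_bound\<close> applies.\<close>

lemma open_bound:
  assumes r: "0 < r" and A: "open A" "\<And>y. y \<in> A \<Longrightarrow> r \<le> norm y"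
  shows "emeasure \<mu> A * vol r \<le> emeasure lborel A"
proof -
  have [measurable]: "A \<in> sets borel" using A by simp
  let ?e = "\<lambda>n. 1 / real (Suc n)"
  have vpos: "vol (?e n) \<noteq> 0" "vol (?e n) \<noteq> \<top>" for n using vol_pos[of "?e n"] vol_fin[of "?e n"] by auto
  have Fm: "(\<lambda>z. emeasure lborel (A \<inter> cball z e)) \<in> borel_measurable \<mu>" for e
  proof -
    have "(\<lambda>z. \<integral>\<^sup>+x. (if x \<in> A \<and> dist x z \<le> e then 1 else 0 :: ennreal) \<partial>lborel) \<in> borel_measurable borel" by measurable
    also have "(\<lambda>z. \<integral>\<^sup>+x. (if x \<in> A \<and> dist x z \<le> e then 1 else 0 :: ennreal) \<partial>lborel) = (\<lambda>z. \<integral>\<^sup>+x. indicator (A \<inter> cball z e) x \<partial>lborel)"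
      by (intro ext nn_integral_cong) (auto simp: indicator_def dist_commute)
    finally show ?thesis by simp
  qed
  have bnd: "(\<integral>\<^sup>+z. emeasure lborel (A \<inter> cball z (?e n)) / vol (?e n) \<partial>\<mu>) * vol r \<le> emeasure lborel A" for n
  proof -
    have "(\<integral>\<^sup>+z. emeasure lborel (A \<inter> cball z (?e n)) \<partial>\<mu>) * vol r = (\<integral>\<^sup>+x. indicator A x * emeasure \<mu> (cball x (?e n)) \<partial>lborel) * vol r"
      by (simp add: fubini_cball)
    also have "\<dots> = (\<integral>\<^sup>+x. (indicator A x * emeasure \<mu> (cball x (?e n))) * vol r \<partial>lborel)"
    proof (rule nn_integral_multc[symmetric])
      have "(\<lambda>x. indicator A x * (\<integral>\<^sup>+z. (if dist x z \<le> ?e n then 1 else 0 :: ennreal) \<partial>\<mu>)) \<in> borel_measurable borel" by measurable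
      also have "(\<lambda>x. indicator A x * (\<integral>\<^sup>+z. (if dist x z \<le> ?e n then 1 else 0 :: ennreal) \<partial>\<mu>)) = (\<lambda>x. indicator A x * (\<integral>\<^sup>+z. indicator (cball x (?e n)) z \<partial>\<mu>))"
        by (intro ext arg_cong2[where f="(*)"] refl nn_integral_cong) (auto simp: indicator_def)
      finally show "(\<lambda>x. indicator A x * emeasure \<mu> (cball x (?e n))) \<in> borel_measurable lborel" by simp
    qed
    also have "\<dots> \<le> (\<integral>\<^sup>+x. vol (?e n) * indicator A x \<partial>lborel)"
      using cball_bound[OF r A(2), of _ "?e n"] by (intro nn_integral_mono) (auto simp: indicator_def)
    also have "\<dots> = vol (?e n) * emeasure lborel A" by (simp add: nn_integral_cmult_indicator)
    finally have "(\<integral>\<^sup>+z. emeasure lborel (A \<inter> cball z (?e n)) \<partial>\<mu>) * vol r / vol (?e n) \<le> vol (?e n) * emeasure lborel A / vol (?e n)"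
      by (rule divide_right_mono_ennreal)
    also have "vol (?e n) * emeasure lborel A / vol (?e n) = emeasure lborel A"
      using vpos[of n] by (subst mult.commute) (rule mult_divide_eq_ennreal)
    finally show ?thesis
      using Fm by (subst nn_integral_divide) (simp_all add: ennreal_times_divide mult.commute)
  qed
  have pt: "indicator A z \<le> liminf (\<lambda>n. emeasure lborel (A \<inter> cball z (?e n)) / vol (?e n))" for z
  proof (cases "z \<in> A")
    case True
    obtain d where d: "0 < d" "cball z d \<subseteq> A" using A(1) True open_contains_cball by blast
    obtain N where N: "1 / real (Suc N) < d" using d(1) nat_approx_posE by blast
    have "eventually (\<lambda>n. indicator A z \<le> emeasure lborel (A \<inter> cball z (?e n)) / vol (?e n)) sequentially"
      using eventually_ge_at_top[of N]
    proof eventually_elim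
      case (elim n)
      have "?e n \<le> ?e N" using elim by (simp add: frac_le)
      then have "cball z (?e n) \<subseteq> A" using N d(2) by (meson less_imp_le order_trans subset_cball)
      then have "A \<inter> cball z (?e n) = cball z (?e n)" by blast
      then have "emeasure lborel (A \<inter> cball z (?e n)) = vol (?e n)" by (simp add: vol_shift)
      moreover have "vol (?e n) / vol (?e n) = 1" using mult_divide_eq_ennreal[OF vpos[of n], of 1] by (simp only: mult_1)
      ultimately show ?case using True by (simp only: indicator_simps order_refl)
    qed
    then show ?thesis by (rule Liminf_bounded)
  qed simp
  have "emeasure \<mu> A = (\<integral>\<^sup>+z. indicator A z \<partial>\<mu>)" by simp
  also have "\<dots> \<le> (\<integral>\<^sup>+z. liminf (\<lambda>n. emeasure lborel (A \<inter> cball z (?e n)) / vol (?e n)) \<partial>\<mu>)"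
    by (intro nn_integral_mono pt)
  also have "\<dots> \<le> liminf (\<lambda>n. \<integral>\<^sup>+z. emeasure lborel (A \<inter> cball z (?e n)) / vol (?e n) \<partial>\<mu>)"
    using Fm by (intro nn_integral_liminf) simp
  also have "\<dots> \<le> emeasure lborel A / vol r"
  proof -
    have "(\<integral>\<^sup>+z. emeasure lborel (A \<inter> cball z (?e n)) / vol (?e n) \<partial>\<mu>) \<le> emeasure lborel A / vol r" for n
      using divide_right_mono_ennreal[OF bnd[of n], of "vol r"] vol_pos[OF r] vol_fin[of r] r
      by (simp add: ennreal_mult_divide_eq)
    then have "liminf (\<lambda>n. \<integral>\<^sup>+z. emeasure lborel (A \<inter> cball z (?e n)) / vol (?e n) \<partial>\<mu>) \<le> liminf (\<lambda>n::nat. emeasure lborel A / vol r)"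
      by (intro Liminf_mono always_eventually) simp
    then show ?thesis by (simp add: Liminf_const)
  qed
  finally have "emeasure \<mu> A * vol r \<le> emeasure lborel A / vol r * vol r" by (rule mult_right_mono) simp
  then show ?thesis using vol_pos[OF r] vol_fin[of r] r by (simp add: ennreal_divide_times ennreal_mult_divide_eq)
qed

text \<open>Outer regularity extends the estimate from open to Borel sets; cutting the open hull
  with the exterior of the ball keeps it away from the origin.\<close>

lemma borel_bound:
  assumes r: "0 < r" and [measurable]: "A \<in> sets borel" and A: "\<And>y. y \<in> A \<Longrightarrow> r < norm y"
  shows "emeasure \<mu> A * vol r \<le> emeasure lborel A"
proof (rule ennreal_le_epsilon)
  fix e :: real assume e: "0 < e"
  obtain U where U: "open U" "A \<subseteq> U" "emeasure lborel (U - A) \<le> ennreal e"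
    using outer_regular_lborel_le[of A e] e by auto
  let ?U = "U \<inter> {y. r < norm y}"
  have oU: "open ?U" using U(1) by (intro open_Int) (auto intro!: open_Collect_less continuous_intros)
  have [measurable]: "U \<in> sets borel" using U by simp
  have "emeasure \<mu> A * vol r \<le> emeasure \<mu> ?U * vol r"
    using U(2) A oU by (intro mult_right_mono emeasure_mono) auto
  also have "\<dots> \<le> emeasure lborel ?U" using oU by (intro open_bound[OF r]) auto
  also have "\<dots> \<le> emeasure lborel (A \<union> (U - A))" by (intro emeasure_mono) auto
  also have "\<dots> \<le> emeasure lborel A + emeasure lborel (U - A)" by (intro emeasure_subadditive) auto
  also have "\<dots> \<le> emeasure lborel A + ennreal e" using U(3) by (rule add_left_mono)
  finally show "emeasure \<mu> A * vol r \<le> emeasure lborel A + ennreal e" .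
qed

text \<open>Beyond any positive radius the law is dominated by a multiple of Lebesgue measure, so a
  Lebesgue null set can have mass only at the origin, which \<open>atom\<close> excludes. The same
  domination bounds the Radon-Nikodym density beyond that radius.\<close>

lemma exists_density:
  assumes atom: "emeasure \<mu> {0} = 0"
  shows "\<exists>F::'b \<Rightarrow> real. integrable lborel F \<and> (\<forall>x. 0 \<le> F x) \<and> \<mu> = density lborel (\<lambda>x. ennreal (F x)) \<and>
     (\<forall>r>0. \<exists>c. AE x in lborel. r < norm x \<longrightarrow> F x \<le> c)"
proof -
  have ac: "absolutely_continuous lborel \<mu>"
    unfolding absolutely_continuous_def
  proof
    fix A :: "'b set" assume A: "A \<in> null_sets lborel"
    then have [measurable]: "A \<in> sets borel" by (simp add: null_sets_def)
    have "emeasure \<mu> (A \<inter> {y. 1 / real (Suc n) < norm y}) = 0" for n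
    proof -
      have "emeasure \<mu> (A \<inter> {y. 1 / real (Suc n) < norm y}) * vol (1 / real (Suc n)) \<le> emeasure lborel (A \<inter> {y. 1 / real (Suc n) < norm y})"
        by (rule borel_bound) auto
      also have "\<dots> \<le> emeasure lborel A" by (intro emeasure_mono) auto
      also have "\<dots> = 0" using A by (simp add: null_sets_def)
      finally show ?thesis using vol_pos[of "1 / real (Suc n)"] by auto
    qed
    then have "(\<Union>n. A \<inter> {y. 1 / real (Suc n) < norm y}) \<in> null_sets \<mu>" by (intro null_sets_UN) (auto simp: null_sets_def)
    moreover have "{0} \<in> null_sets \<mu>" using atom by (simp add: null_sets_def)
    ultimately have n: "(\<Union>n. A \<inter> {y. 1 / real (Suc n) < norm y}) \<union> {0} \<in> null_sets \<mu>" by (rule null_sets.Un)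
    have "A \<subseteq> (\<Union>n. A \<inter> {y. 1 / real (Suc n) < norm y}) \<union> {0}"
    proof
      fix y assume y: "y \<in> A"
      show "y \<in> (\<Union>n. A \<inter> {y. 1 / real (Suc n) < norm y}) \<union> {0}"
      proof (cases "y = 0")
        case False
        then obtain n where "1 / real (Suc n) < norm y" using nat_approx_posE[of "norm y"] by auto
        then show ?thesis using y by blast
      qed simp
    qed
    then show "A \<in> null_sets \<mu>" using n by (rule null_sets_subset[rotated 2]) simp_all
  qed
  obtain f where fm: "f \<in> borel_measurable lborel" and f: "density lborel f = \<mu>"
    using sigma_finite_measure.Radon_Nikodym[OF sigma_finite_lborel ac] by auto
  have [measurable]: "f \<in> borel_measurable borel" using fm by simp
  have int1: "(\<integral>\<^sup>+x. f x \<partial>lborel) = 1"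
    using emeasure_space_1 unfolding f[symmetric] by (simp add: emeasure_density)
  then have fin: "AE x in lborel. f x \<noteq> \<infinity>" by (intro nn_integral_PInf_AE) auto
  define F where "F x = enn2real (f x)" for x
  have [measurable]: "F \<in> borel_measurable borel" unfolding F_def by measurable
  have fF: "AE x in lborel. f x = ennreal (F x)" using fin by eventually_elim (simp add: F_def less_top)
  have mu: "\<mu> = density lborel (\<lambda>x. ennreal (F x))"
    unfolding f[symmetric] by (rule density_cong) (use fF in auto)
  have "(\<integral>\<^sup>+x. ennreal (F x) \<partial>lborel) = 1"
    unfolding int1[symmetric] by (rule nn_integral_cong_AE) (use fF in auto)
  then have iF: "integrable lborel F" by (intro integrableI_nonneg) (auto simp: F_def)
  have "\<exists>c. AE x in lborel. r < norm x \<longrightarrow> F x \<le> c" if r: "0 < r" for r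
  proof -
    define c where "c = 1 / enn2real (vol r)"
    have vr: "vol r = ennreal (enn2real (vol r))" "0 < enn2real (vol r)"
      using vol_fin[of r] vol_pos[OF r] r by (auto simp: enn2real_positive_iff)
    have c: "0 < c" using vr(2) by (simp add: c_def)
    have b: "emeasure \<mu> A \<le> ennreal c * emeasure lborel A" if [measurable]: "A \<in> sets borel" and "\<And>y. y \<in> A \<Longrightarrow> r < norm y" for A
    proof -
      have "ennreal c * vol r = 1"
        by (subst vr(1)) (use vr(2) in \<open>simp add: c_def ennreal_mult[symmetric]\<close>)
      then have "emeasure \<mu> A = ennreal c * (emeasure \<mu> A * vol r)"
        by (simp only: mult.left_commute[of "ennreal c"] mult_1_right)
      also have "\<dots> \<le> ennreal c * emeasure lborel A" by (intro mult_left_mono borel_bound[OF r]) (use that in auto)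
      finally show ?thesis .
    qed
    \<comment> \<open>The slack 1 gives (c + 1) m \<le> c m for the measure m of the set where F
      exceeds c + 1, hence m = 0. Finiteness of m has to be secured first.\<close>
    have "AE x in lborel. r < norm x \<longrightarrow> F x \<le> c + 1"
    proof -
      let ?B = "{x. r < norm x \<and> c + 1 < F x}"
      have [measurable]: "?B \<in> sets borel" by measurable
      have "ennreal (c + 1) * emeasure lborel ?B = (\<integral>\<^sup>+x. ennreal (c + 1) * indicator ?B x \<partial>lborel)"
        by (simp add: nn_integral_cmult_indicator)
      also have "\<dots> \<le> (\<integral>\<^sup>+x. ennreal (F x) * indicator ?B x \<partial>lborel)"
        by (intro nn_integral_mono) (auto simp: indicator_def intro!: ennreal_leI)
      also have "\<dots> = emeasure \<mu> ?B" unfolding mu by (simp add: emeasure_density)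
      finally have le: "ennreal (c + 1) * emeasure lborel ?B \<le> emeasure \<mu> ?B" .
      have "ennreal (c + 1) * emeasure lborel ?B < \<infinity>"
        by (rule le_less_trans[OF le]) (simp add: emeasure_eq_measure)
      then have fB: "emeasure lborel ?B < \<infinity>" using c by (auto simp: ennreal_mult_less_top)
      then obtain m where m: "emeasure lborel ?B = ennreal m" "0 \<le> m" by (metis ennreal_cases infinity_ennreal_def less_irrefl)
      have "ennreal (c + 1) * ennreal m \<le> ennreal c * ennreal m"
      proof -
        have "emeasure \<mu> ?B \<le> ennreal c * emeasure lborel ?B" by (rule b) simp_all
        from order_trans[OF le this] show ?thesis by (simp only: m(1))
      qed
      moreover have "ennreal ((c + 1) * m) = ennreal (c + 1) * ennreal m" "ennreal (c * m) = ennreal c * ennreal m"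
        using c m(2) by (intro ennreal_mult; simp)+
      ultimately have "ennreal ((c + 1) * m) \<le> ennreal (c * m)" by (simp only:)
      then have "(c + 1) * m \<le> c * m" using c m(2) by (subst (asm) ennreal_le_iff) auto
      then have "m = 0" using m(2) by (simp add: distrib_right)
      then have "emeasure lborel ?B = 0" using m by simp
      then have "AE x in lborel. x \<notin> ?B" by (intro AE_not_in) (simp add: null_sets_def)
      then show ?thesis by eventually_elim auto
    qed
    then show ?thesis by blast
  qed
  then show ?thesis using iF mu by (intro exI[of _ F]) (simp add: F_def)
qed

end

section \<open>Self-convolution of a density that is bounded off the origin\<close>

locale bounded_off_zero =
  fixes F :: "'b::euclidean_space \<Rightarrow> real"
  assumes F_int: "integrable lborel F" and F_nonneg: "\<And>x. 0 \<le> F x"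
    and F_bnd: "\<And>r. 0 < r \<Longrightarrow> \<exists>c. AE x in lborel. r < norm x \<longrightarrow> F x \<le> c"
begin

definition Q where "Q x = (\<integral>z. F (x - z) * F z \<partial>lborel)"

lemma F_meas[measurable]: "F \<in> borel_measurable borel" using borel_measurable_integrable[OF F_int] by simp

lemma Q_nonneg: "0 \<le> Q x" unfolding Q_def using F_nonneg by (intro Bochner_Integration.integral_nonneg) simp

text \<open>For |x| > 2 r the points z and x - z cannot both be within r of the origin. Splitting F
  into its part \<open>a\<close> near the origin and the bounded part \<open>b\<close>, the product
  of two near parts vanishes, and by symmetry Q is the convolution of the integrable function 2 a +
  b with the bounded function b.\<close>

lemma Q_split:
  assumes r: "0 < r"
  shows "\<exists>k b c. integrable lborel k \<and> (AE z in lborel. \<bar>b z\<bar> \<le> c) \<and> b \<in> borel_measurable borel \<and> 0 \<le> c \<and>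
    (\<forall>x. 2 * r < norm x \<longrightarrow> integrable lborel (\<lambda>z. F (x - z) * F z)) \<and>
    (\<forall>x. integrable lborel (\<lambda>z. k (x - z) * b z)) \<and>
    (\<forall>x. 2 * r < norm x \<longrightarrow> Q x = (\<integral>z. k (x - z) * b z \<partial>lborel))"
proof -
  define a where "a z = (if norm z \<le> r then F z else 0)" for z
  define b where "b z = (if norm z \<le> r then 0 else F z)" for z
  have [measurable]: "a \<in> borel_measurable borel" "b \<in> borel_measurable borel" unfolding a_def b_def by measurable
  obtain c0 where c0: "AE x in lborel. r < norm x \<longrightarrow> F x \<le> c0" using F_bnd[OF r] by blast
  define c where "c = max c0 0"
  have c: "0 \<le> c" by (simp add: c_def)
  have bc: "AE z in lborel. \<bar>b z\<bar> \<le> c"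
    using c0 by eventually_elim (use F_nonneg in \<open>auto simp: b_def c_def\<close>)
  have ai: "integrable lborel a" "integrable lborel b"
    by (rule Bochner_Integration.integrable_bound[OF F_int]; simp add: a_def b_def)+
  have kb: "integrable lborel (\<lambda>z. k (x - z) * b z)" if k: "integrable lborel k" for k :: "'b \<Rightarrow> real" and x
  proof (rule Bochner_Integration.integrable_bound)
    show "integrable lborel (\<lambda>z. k (x - z) * c)" by (intro integrable_mult_left integrable_lborel_reflect k)
    have [measurable]: "k \<in> borel_measurable borel" using borel_measurable_integrable[OF k] by simp
    show "(\<lambda>z. k (x - z) * b z) \<in> borel_measurable lborel" by measurable
    show "AE z in lborel. norm (k (x - z) * b z) \<le> norm (k (x - z) * c)"
      using bc by eventually_elim (use c in \<open>auto simp: abs_mult intro!: mult_left_mono\<close>)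
  qed
  have ba: "integrable lborel (\<lambda>z. b (x - z) * a z)" "(\<integral>z. b (x - z) * a z \<partial>lborel) = (\<integral>z. a (x - z) * b z \<partial>lborel)" for x
  proof -
    have e: "(\<lambda>z. b (x - z) * a z) = (\<lambda>z. (\<lambda>w. a (x - w) * b w) (x - z))" by (auto simp: mult.commute)
    show "integrable lborel (\<lambda>z. b (x - z) * a z)" unfolding e by (rule integrable_lborel_reflect[OF kb[OF ai(1)]])
    show "(\<integral>z. b (x - z) * a z \<partial>lborel) = (\<integral>z. a (x - z) * b z \<partial>lborel)"
      unfolding e by (rule integral_lborel_reflect) measurable
  qed
  have sp: "F (x - z) * F z = (a (x - z) * b z + b (x - z) * a z) + b (x - z) * b z" if "2 * r < norm x" for x z
  proof -
    have "\<not> (norm (x - z) \<le> r \<and> norm z \<le> r)" using that norm_triangle_ineq[of "x - z" z] by auto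
    then show ?thesis by (auto simp: a_def b_def)
  qed
  let ?k = "\<lambda>z. 2 * a z + b z"
  have ki: "integrable lborel ?k" using ai by simp
  show ?thesis
  proof (rule exI[of _ ?k], rule exI[of _ b], rule exI[of _ c], intro conjI allI impI ki bc c)
    show "b \<in> borel_measurable borel" by simp
    show "integrable lborel (\<lambda>z. ?k (x - z) * b z)" for x by (rule kb[OF ki])
    fix x :: 'b assume x: "2 * r < norm x"
    note i = kb[OF ai(1), of x] ba(1)[of x] kb[OF ai(2), of x]
    show "integrable lborel (\<lambda>z. F (x - z) * F z)"
      unfolding sp[OF x] by (intro Bochner_Integration.integrable_add i)
    have "Q x = ((\<integral>z. a (x - z) * b z \<partial>lborel) + (\<integral>z. b (x - z) * a z \<partial>lborel)) + (\<integral>z. b (x - z) * b z \<partial>lborel)"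
      unfolding Q_def sp[OF x]
      by (simp only: Bochner_Integration.integral_add[OF Bochner_Integration.integrable_add[OF i(1,2)] i(3)] Bochner_Integration.integral_add[OF i(1,2)])
    also have "\<dots> = 2 * (\<integral>z. a (x - z) * b z \<partial>lborel) + (\<integral>z. b (x - z) * b z \<partial>lborel)" by (simp add: ba(2))
    also have "\<dots> = (\<integral>z. 2 * (a (x - z) * b z) + b (x - z) * b z \<partial>lborel)"
      using i by (subst Bochner_Integration.integral_add) auto
    also have "\<dots> = (\<integral>z. ?k (x - z) * b z \<partial>lborel)"
      by (intro Bochner_Integration.integral_cong refl) (simp add: algebra_simps)
    finally show "Q x = (\<integral>z. ?k (x - z) * b z \<partial>lborel)" .
  qed
qed

lemma Q_integrable: "x \<noteq> 0 \<Longrightarrow> integrable lborel (\<lambda>z. F (x - z) * F z)"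
proof -
  assume x: "x \<noteq> 0"
  have r: "0 < norm x / 3" "2 * (norm x / 3) < norm x" using x by auto
  show ?thesis using Q_split[OF r(1)] r(2) by blast
qed

text \<open>After \<open>Q_split\<close> the change of Q is at most c times the L1 distance between
  \<open>k\<close> and its translate, which tends to 0.\<close>

lemma Q_cont:
  assumes x: "x0 \<noteq> 0" shows "isCont Q x0"
  unfolding isCont_def tendsto_at_iff_sequentially
proof (intro allI impI)
  fix X assume X: "\<forall>i. X i \<in> UNIV - {x0}" "X \<longlonglongrightarrow> x0"
  have r: "0 < norm x0 / 3" "2 * (norm x0 / 3) < norm x0" using x by auto
  obtain k b c where k: "integrable lborel k" and bc: "AE z in lborel. \<bar>b z\<bar> \<le> c" and [measurable]: "b \<in> borel_measurable borel"
    and c: "0 \<le> c" and kb': "\<forall>x. integrable lborel (\<lambda>z. k (x - z) * b z)"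
    and Qe': "\<forall>x. 2 * (norm x0 / 3) < norm x \<longrightarrow> Q x = (\<integral>z. k (x - z) * b z \<partial>lborel)"
    using Q_split[OF r(1)] by (elim exE conjE) (rule that)
  note kb = kb'[rule_format] and Qe = Qe'[rule_format]
  have [measurable]: "k \<in> borel_measurable borel" using borel_measurable_integrable[OF k] by simp
  have "(\<lambda>n. X n - x0) \<longlonglongrightarrow> x0 - x0" by (intro tendsto_intros X)
  then have "(\<lambda>n. \<integral>w. \<bar>k (w + (X n - x0)) - k w\<bar> \<partial>lborel) \<longlonglongrightarrow> 0"
    using translation_continuous_integrable[OF k] by (simp add: translation_continuous_def)
  then have L: "(\<lambda>n. c * (\<integral>w. \<bar>k (w + (X n - x0)) - k w\<bar> \<partial>lborel)) \<longlonglongrightarrow> 0"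
    using tendsto_mult_left[of _ 0 sequentially c] by simp
  have bnd: "\<bar>(\<integral>z. k (X n - z) * b z \<partial>lborel) - (\<integral>z. k (x0 - z) * b z \<partial>lborel)\<bar> \<le> c * (\<integral>w. \<bar>k (w + (X n - x0)) - k w\<bar> \<partial>lborel)" for n
  proof -
    have i: "integrable lborel (\<lambda>z. \<bar>k (X n - z) - k (x0 - z)\<bar>)"
      by (intro integrable_abs Bochner_Integration.integrable_diff integrable_lborel_reflect k)
    have "\<bar>(\<integral>z. k (X n - z) * b z \<partial>lborel) - (\<integral>z. k (x0 - z) * b z \<partial>lborel)\<bar> = norm (\<integral>z. k (X n - z) * b z - k (x0 - z) * b z \<partial>lborel)"
      by (simp add: Bochner_Integration.integral_diff[OF kb kb])
    also have "\<dots> \<le> (\<integral>z. norm (k (X n - z) * b z - k (x0 - z) * b z) \<partial>lborel)" by (rule integral_norm_bound)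
    also have "\<dots> \<le> (\<integral>z. c * \<bar>k (X n - z) - k (x0 - z)\<bar> \<partial>lborel)"
    proof (rule integral_mono_AE)
      show "integrable lborel (\<lambda>z. norm (k (X n - z) * b z - k (x0 - z) * b z))"
        by (intro integrable_norm Bochner_Integration.integrable_diff kb)
      show "integrable lborel (\<lambda>z. c * \<bar>k (X n - z) - k (x0 - z)\<bar>)" by (intro integrable_mult_right i)
      show "AE z in lborel. norm (k (X n - z) * b z - k (x0 - z) * b z) \<le> c * \<bar>k (X n - z) - k (x0 - z)\<bar>"
        using bc
      proof eventually_elim
        case (elim z)
        have "norm (k (X n - z) * b z - k (x0 - z) * b z) = \<bar>b z\<bar> * \<bar>k (X n - z) - k (x0 - z)\<bar>"
          by (simp add: abs_mult[symmetric] algebra_simps)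
        also have "\<dots> \<le> c * \<bar>k (X n - z) - k (x0 - z)\<bar>" using elim by (intro mult_right_mono) auto
        finally show ?case .
      qed
    qed
    also have "\<dots> = c * (\<integral>z. \<bar>k (X n - z) - k (x0 - z)\<bar> \<partial>lborel)" by (rule integral_mult_right_zero)
    also have "(\<integral>z. \<bar>k (X n - z) - k (x0 - z)\<bar> \<partial>lborel) = (\<integral>z. (\<lambda>w. \<bar>k (w + (X n - x0)) - k w\<bar>) (x0 - z) \<partial>lborel)"
      by (intro Bochner_Integration.integral_cong refl) (simp add: algebra_simps)
    also have "\<dots> = (\<integral>w. \<bar>k (w + (X n - x0)) - k w\<bar> \<partial>lborel)"
      by (rule integral_lborel_reflect) measurable
    finally show ?thesis .
  qed
  have "(\<lambda>n. (\<integral>z. k (X n - z) * b z \<partial>lborel) - (\<integral>z. k (x0 - z) * b z \<partial>lborel)) \<longlonglongrightarrow> 0"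
  proof (rule Lim_null_comparison[OF _ L], intro always_eventually allI)
    fix n show "norm ((\<integral>z. k (X n - z) * b z \<partial>lborel) - (\<integral>z. k (x0 - z) * b z \<partial>lborel)) \<le> c * (\<integral>w. \<bar>k (w + (X n - x0)) - k w\<bar> \<partial>lborel)"
      using bnd[of n] by (simp only: real_norm_def)
  qed
  then have lim: "(\<lambda>n. \<integral>z. k (X n - z) * b z \<partial>lborel) \<longlonglongrightarrow> (\<integral>z. k (x0 - z) * b z \<partial>lborel)"
    by (rule LIM_zero_cancel)
  have "(\<lambda>n. norm (X n)) \<longlonglongrightarrow> norm x0" by (intro tendsto_norm X)
  then have "eventually (\<lambda>n. 2 * (norm x0 / 3) < norm (X n)) sequentially" using r(2) by (rule order_tendstoD(1))
  then have "eventually (\<lambda>n. (\<integral>z. k (X n - z) * b z \<partial>lborel) = (Q \<circ> X) n) sequentially"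
    by eventually_elim (simp only: Qe comp_def)
  from tendsto_cong[THEN iffD1, OF this lim] show "(Q \<circ> X) \<longlonglongrightarrow> Q x0" by (simp only: Qe[OF r(2)])
qed

lemma Q_meas[measurable]: "Q \<in> borel_measurable borel"
  unfolding Q_def[abs_def] by measurable

text \<open>Ball masses are compared instead of values: by continuity the mass of a small ball is
  its volume times the central value up to an error \<open>\<delta>\<close>, and a gap of 3
  \<open>\<delta>\<close> is too wide for two such errors.\<close>

lemma Q_radial:
  assumes uni: "ball_unimodal (density lborel (\<lambda>x. ennreal (Q x)))" and fin: "finite_measure (density lborel (\<lambda>x. ennreal (Q x)))"
    and x: "x \<noteq> 0" "norm x \<le> norm y"
  shows "Q y \<le> Q x"
proof (rule ccontr)
  assume "\<not> Q y \<le> Q x"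
  define \<delta> where "\<delta> = (Q y - Q x) / 3"
  have d: "0 < \<delta>" using \<open>\<not> Q y \<le> Q x\<close> by (simp add: \<delta>_def)
  have y: "y \<noteq> 0" using x by auto
  let ?D = "density lborel (\<lambda>x. ennreal (Q x))"
  interpret D: finite_measure ?D by (rule fin)
  obtain d1 where d1: "0 < d1" "\<And>u. dist u x < d1 \<Longrightarrow> dist (Q u) (Q x) < \<delta>"
    using Q_cont[OF x(1)] d unfolding continuous_at_eps_delta by metis
  obtain d2 where d2: "0 < d2" "\<And>u. dist u y < d2 \<Longrightarrow> dist (Q u) (Q y) < \<delta>"
    using Q_cont[OF y] d unfolding continuous_at_eps_delta by metis
  define e where "e = min d1 d2 / 2"
  have e: "0 < e" "e < d1" "e < d2" using d1(1) d2(1) by (auto simp: e_def min_def)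
  let ?V = "measure lborel (cball (0::'b) e)"
  have V: "0 < ?V" using e(1) by (simp add: measure_def emeasure_cball)
  have Vs: "emeasure lborel (cball (z::'b) e) = ennreal ?V" for z
    using e(1) by (simp add: measure_def emeasure_cball)
  have ux: "Q u \<le> Q x + \<delta>" if "u \<in> cball x e" for u
    using d1(2)[of u] that e by (auto simp: dist_commute dist_real_def)
  have uy: "Q y - \<delta> \<le> Q u" if "u \<in> cball y e" for u
    using d2(2)[of u] that e by (auto simp: dist_commute dist_real_def)
  have "emeasure ?D (cball x e) = (\<integral>\<^sup>+u. ennreal (Q u) * indicator (cball x e) u \<partial>lborel)"
    by (subst emeasure_density) auto
  also have "\<dots> \<le> (\<integral>\<^sup>+u. ennreal (Q x + \<delta>) * indicator (cball x e) u \<partial>lborel)"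
    using ux by (intro nn_integral_mono) (auto simp: indicator_def intro!: ennreal_leI)
  also have "\<dots> = ennreal (Q x + \<delta>) * ennreal ?V" by (simp add: nn_integral_cmult_indicator Vs)
  also have "\<dots> = ennreal ((Q x + \<delta>) * ?V)" using Q_nonneg[of x] d by (simp add: ennreal_mult)
  finally have "ennreal (measure ?D (cball x e)) \<le> ennreal ((Q x + \<delta>) * ?V)" by (simp only: D.emeasure_eq_measure)
  then have 1: "measure ?D (cball x e) \<le> (Q x + \<delta>) * ?V" using Q_nonneg[of x] d by (subst (asm) ennreal_le_iff) auto
  have "ennreal ((Q y - \<delta>) * ?V) = ennreal (Q y - \<delta>) * ennreal ?V"
    using Q_nonneg[of x] d by (intro ennreal_mult) (auto simp: \<delta>_def)
  also have "\<dots> = (\<integral>\<^sup>+u. ennreal (Q y - \<delta>) * indicator (cball y e) u \<partial>lborel)"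
    by (simp add: nn_integral_cmult_indicator Vs)
  also have "\<dots> \<le> (\<integral>\<^sup>+u. ennreal (Q u) * indicator (cball y e) u \<partial>lborel)"
    using uy by (intro nn_integral_mono) (auto simp: indicator_def intro!: ennreal_leI)
  also have "\<dots> = emeasure ?D (cball y e)" by (subst emeasure_density) auto
  finally have "ennreal ((Q y - \<delta>) * ?V) \<le> ennreal (measure ?D (cball y e))" by (simp only: D.emeasure_eq_measure)
  then have 2: "(Q y - \<delta>) * ?V \<le> measure ?D (cball y e)" by (subst (asm) ennreal_le_iff) auto
  have "measure ?D (cball y e) \<le> measure ?D (cball x e)"
    using uni x(2) by (simp add: ball_unimodal_def radial_decreasing_def)
  then have "(Q y - \<delta>) * ?V \<le> (Q x + \<delta>) * ?V" using 1 2 by linarith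
  then have "Q y - \<delta> \<le> Q x + \<delta>" using V by simp
  moreover have "3 * \<delta> = Q y - Q x" by (simp add: \<delta>_def)
  ultimately show False using d by linarith
qed

end

lemma (in prob_space) unimodal_sum_density:
  fixes Y1 Y2 :: "'a \<Rightarrow> 'b::euclidean_space"
  assumes ind: "indep_var borel Y1 borel Y2" and same: "distr M borel Y2 = distr M borel Y1"
    and uni: "ball_unimodal (distr M borel Y1)" and atom: "emeasure (distr M borel Y1) {0} = 0"
    and uni2: "ball_unimodal (distr M borel (\<lambda>w. Y1 w + Y2 w))"
  shows "\<exists>q::real \<Rightarrow> real. (\<forall>r. 0 \<le> q r) \<and> distr M borel (\<lambda>w. Y1 w + Y2 w) = density lborel (\<lambda>x. ennreal (q (norm x))) \<and>
     (\<lambda>x::'b. ennreal (q (norm x))) \<in> borel_measurable borel \<and>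
     (\<forall>r s. 0 < r \<and> r \<le> s \<longrightarrow> q s \<le> q r) \<and> continuous_on {0<..} q"
proof -
  have [measurable]: "Y1 \<in> borel_measurable M" "Y2 \<in> borel_measurable M"
    using indep_var_rv1[OF ind] indep_var_rv2[OF ind] by auto
  interpret U: unimodal_law "distr M borel Y1"
    using uni by (intro unimodal_law.intro unimodal_law_axioms.intro prob_space_distr) simp_all
  obtain F :: "'b \<Rightarrow> real" where F: "integrable lborel F" "\<And>x. 0 \<le> F x"
    "distr M borel Y1 = density lborel (\<lambda>x. ennreal (F x))"
    "\<And>r. 0 < r \<Longrightarrow> \<exists>c. AE x in lborel. r < norm x \<longrightarrow> F x \<le> c"
    using U.exists_density[OF atom] by blast
  interpret B: bounded_off_zero F by (rule bounded_off_zero.intro) (rule F(1), rule F(2), erule F(4))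
  let ?D = "density lborel (\<lambda>x. ennreal (F x))"
  have "distr M borel (\<lambda>w. Y1 w + Y2 w) = density lborel (\<lambda>x. ennreal (B.Q x))"
  proof (rule measure_eqI)
    fix A assume "A \<in> sets (distr M borel (\<lambda>w. Y1 w + Y2 w))"
    then have [measurable]: "A \<in> sets borel" by simp
    have "emeasure (distr M borel (\<lambda>w. Y1 w + Y2 w)) A = (\<integral>\<^sup>+w. indicator A (Y1 w + Y2 w) \<partial>M)"
      by (subst nn_integral_indicator[symmetric], simp, subst nn_integral_distr) auto
    also have "\<dots> = (\<integral>\<^sup>+p. indicator A (fst p + snd p) \<partial>distr M (borel \<Otimes>\<^sub>M borel) (\<lambda>w. (Y1 w, Y2 w)))"
      by (subst nn_integral_distr) auto
    also have "\<dots> = (\<integral>\<^sup>+p. indicator A (fst p + snd p) \<partial>(distr M borel Y1 \<Otimes>\<^sub>M distr M borel Y1))"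
      using ind by (simp add: indep_var_distribution_eq same)
    also have "\<dots> = (\<integral>\<^sup>+u. \<integral>\<^sup>+v. indicator A (u + v) \<partial>distr M borel Y1 \<partial>distr M borel Y1)"
      by (subst U.nn_integral_fst[symmetric]) auto
    also have "\<dots> = (\<integral>\<^sup>+u. ennreal (F u) * (\<integral>\<^sup>+v. ennreal (F v) * indicator A (u + v) \<partial>lborel) \<partial>lborel)"
      unfolding F(3) by (simp add: nn_integral_density)
    also have "\<dots> = (\<integral>\<^sup>+u. (\<integral>\<^sup>+x. ennreal (F (x - u) * F u) * indicator A x \<partial>lborel) \<partial>lborel)"
    proof (rule nn_integral_cong)
      fix u :: 'b
      have "(\<integral>\<^sup>+x. ennreal (F (x - u)) * indicator A x \<partial>lborel) = (\<integral>\<^sup>+x. ennreal (F (x - u)) * indicator A x \<partial>distr lborel borel ((+) u))"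
        by (simp add: lborel_distr_plus)
      also have "\<dots> = (\<integral>\<^sup>+v. ennreal (F v) * indicator A (u + v) \<partial>lborel)"
        by (subst nn_integral_distr) auto
      finally have "ennreal (F u) * (\<integral>\<^sup>+v. ennreal (F v) * indicator A (u + v) \<partial>lborel) = ennreal (F u) * (\<integral>\<^sup>+x. ennreal (F (x - u)) * indicator A x \<partial>lborel)" by simp
      also have "\<dots> = (\<integral>\<^sup>+x. ennreal (F u) * (ennreal (F (x - u)) * indicator A x) \<partial>lborel)"
        by (rule nn_integral_cmult[symmetric]) measurable
      also have "\<dots> = (\<integral>\<^sup>+x. ennreal (F (x - u) * F u) * indicator A x \<partial>lborel)"
        using F(2) by (intro nn_integral_cong) (simp add: ennreal_mult mult_ac)
      finally show "ennreal (F u) * (\<integral>\<^sup>+v. ennreal (F v) * indicator A (u + v) \<partial>lborel) = (\<integral>\<^sup>+x. ennreal (F (x - u) * F u) * indicator A x \<partial>lborel)" .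
    qed
    also have "\<dots> = (\<integral>\<^sup>+x. (\<integral>\<^sup>+u. ennreal (F (x - u) * F u) * indicator A x \<partial>lborel) \<partial>lborel)"
      by (rule lborel_pair.Fubini') measurable
    also have "\<dots> = (\<integral>\<^sup>+x. ennreal (B.Q x) * indicator A x \<partial>lborel)"
    proof (rule nn_integral_cong_AE)
      \<comment> \<open>At x = 0 the integrand need not be integrable, so the identity is claimed
        off this null set.\<close>
      show "AE x in lborel. (\<integral>\<^sup>+u. ennreal (F (x - u) * F u) * indicator A x \<partial>lborel) = ennreal (B.Q x) * indicator A x"
        using AE_lborel_singleton[of 0]
      proof eventually_elim
        case (elim x)
        have "(\<integral>\<^sup>+u. ennreal (F (x - u) * F u) * indicator A x \<partial>lborel) = (\<integral>\<^sup>+u. ennreal (F (x - u) * F u) \<partial>lborel) * indicator A x"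
          by (rule nn_integral_multc) measurable
        also have "(\<integral>\<^sup>+u. ennreal (F (x - u) * F u) \<partial>lborel) = ennreal (B.Q x)"
          unfolding B.Q_def by (rule nn_integral_eq_integral[OF B.Q_integrable[OF elim]]) (simp add: F(2))
        finally show ?case .
      qed
    qed
    also have "\<dots> = emeasure (density lborel (\<lambda>x. ennreal (B.Q x))) A" by (subst emeasure_density) auto
    finally show "emeasure (distr M borel (\<lambda>w. Y1 w + Y2 w)) A = emeasure (density lborel (\<lambda>x. ennreal (B.Q x))) A" .
  qed simp
  note law = this
  have fin: "finite_measure (density lborel (\<lambda>x. ennreal (B.Q x)))"
    unfolding law[symmetric] by (intro prob_space.finite_measure prob_space_distr) simp
  have rad: "B.Q y \<le> B.Q x" if "x \<noteq> 0" "norm x \<le> norm y" for x y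
    using B.Q_radial[OF uni2[unfolded law] fin that] .
  \<comment> \<open>Q is radial away from the origin, so its values on a single ray determine the
    profile q.\<close>
  define b0 :: 'b where "b0 = (SOME b. b \<in> Basis)"
  have b0: "norm b0 = 1" unfolding b0_def by (simp add: SOME_Basis)
  define q where "q r = B.Q (r *\<^sub>R b0)" for r
  have Qq: "B.Q x = q (norm x)" if "x \<noteq> 0" for x
  proof -
    have "norm (norm x *\<^sub>R b0) = norm x" "norm x *\<^sub>R b0 \<noteq> 0" using b0 that by auto
    then show ?thesis unfolding q_def using that by (intro antisym rad) simp_all
  qed
  have qm: "(\<lambda>x::'b. ennreal (q (norm x))) \<in> borel_measurable borel" unfolding q_def by measurable
  have "density lborel (\<lambda>x. ennreal (B.Q x)) = density lborel (\<lambda>x. ennreal (q (norm x)))"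
  proof (rule density_cong)
    show "AE x in lborel. ennreal (B.Q x) = ennreal (q (norm x))"
      using AE_lborel_singleton[of 0] by eventually_elim (rule arg_cong[where f=ennreal], erule Qq)
  qed (use qm in simp_all)
  then have "distr M borel (\<lambda>w. Y1 w + Y2 w) = density lborel (\<lambda>x. ennreal (q (norm x)))" using law by simp
  moreover have "q s \<le> q r" if "0 < r" "r \<le> s" for r s
  proof -
    have "r *\<^sub>R b0 \<noteq> 0" "norm (r *\<^sub>R b0) = r" "norm (s *\<^sub>R b0) = s" using that b0 by auto
    then show ?thesis unfolding q_def using that by (intro rad) simp_all
  qed
  moreover have "continuous_on {0<..} q"
  proof (rule continuous_at_imp_continuous_on, rule ballI)
    fix r :: real assume "r \<in> {0<..}"
    then have "r *\<^sub>R b0 \<noteq> 0" using b0 by auto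
    then have "isCont B.Q (r *\<^sub>R b0)" by (rule B.Q_cont)
    moreover have "isCont (\<lambda>r. r *\<^sub>R b0) r" by (intro continuous_intros)
    ultimately show "isCont q r" unfolding q_def[abs_def] by (rule isCont_o2[rotated])
  qed
  moreover have "0 \<le> q r" for r unfolding q_def by (rule B.Q_nonneg)
  ultimately show ?thesis using qm by (intro exI[of _ q]) simp
qed

section \<open>Two additional dimensions\<close>

text \<open>The sublevel sets are discs of area pi (a^2 - r^2), and the derivative in a is 2 pi
  a.\<close>

lemma plane_radial_law:
  assumes r: "0 \<le> r"
  shows "distr (lborel :: (real \<times> real) measure) borel (\<lambda>z. sqrt (r\<^sup>2 + (norm z)\<^sup>2))
       = density lborel (\<lambda>u. ennreal (2 * pi * u) * indicator {r..} u)"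
proof (rule measure_eqI_generator_eq[where E="range (\<lambda>a. {..a::real})" and \<Omega>=UNIV and A="\<lambda>i. {..real i}"])
  let ?M = "distr (lborel :: (real \<times> real) measure) borel (\<lambda>z. sqrt (r\<^sup>2 + (norm z)\<^sup>2))"
  let ?N = "density lborel (\<lambda>u. ennreal (2 * pi * u) * indicator {r..} u)"
  have M1: "emeasure ?M {..a} = ennreal (if r \<le> a then pi * (a\<^sup>2 - r\<^sup>2) else 0)" for a
  proof (cases "r \<le> a")
    case True
    then have ra: "0 \<le> a\<^sup>2 - r\<^sup>2" using r by (simp add: power_mono)
    have "emeasure ?M {..a} = emeasure lborel ((\<lambda>z::real \<times> real. sqrt (r\<^sup>2 + (norm z)\<^sup>2)) -` {..a} \<inter> space lborel)"
      by (rule emeasure_distr) simp_all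
    also have "((\<lambda>z::real \<times> real. sqrt (r\<^sup>2 + (norm z)\<^sup>2)) -` {..a} \<inter> space lborel) = cball 0 (sqrt (a\<^sup>2 - r\<^sup>2))"
    proof (intro equalityI subsetI)
      fix z :: "real \<times> real" assume "z \<in> (\<lambda>z. sqrt (r\<^sup>2 + (norm z)\<^sup>2)) -` {..a} \<inter> space lborel"
      then have "r\<^sup>2 + (norm z)\<^sup>2 \<le> a\<^sup>2" by (simp add: real_sqrt_le_iff' sqrt_le_D)
      then show "z \<in> cball 0 (sqrt (a\<^sup>2 - r\<^sup>2))" by (simp add: real_le_rsqrt)
    next
      fix z :: "real \<times> real" assume "z \<in> cball 0 (sqrt (a\<^sup>2 - r\<^sup>2))"
      then have "(norm z)\<^sup>2 \<le> (sqrt (a\<^sup>2 - r\<^sup>2))\<^sup>2" by (intro power_mono) simp_all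
      then have "r\<^sup>2 + (norm z)\<^sup>2 \<le> a\<^sup>2" using ra by simp
      then show "z \<in> (\<lambda>z. sqrt (r\<^sup>2 + (norm z)\<^sup>2)) -` {..a} \<inter> space lborel"
        using True r by (simp add: real_le_lsqrt)
    qed
    also have "emeasure lborel (cball (0 :: real \<times> real) (sqrt (a\<^sup>2 - r\<^sup>2))) = ennreal (pi * (a\<^sup>2 - r\<^sup>2))"
      using ra by (simp add: emeasure_cball unit_ball_vol_2)
    finally show ?thesis using True by simp
  next
    case False
    have ge: "r \<le> sqrt (r\<^sup>2 + (norm z)\<^sup>2)" for z :: "real \<times> real" by (intro real_le_rsqrt) simp
    have e: "((\<lambda>z::real \<times> real. sqrt (r\<^sup>2 + (norm z)\<^sup>2)) -` {..a} \<inter> space lborel) = {}"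
    proof (rule equals0I)
      fix z :: "real \<times> real" assume "z \<in> (\<lambda>z. sqrt (r\<^sup>2 + (norm z)\<^sup>2)) -` {..a} \<inter> space lborel"
      then have "sqrt (r\<^sup>2 + (norm z)\<^sup>2) \<le> a" by (simp only: vimage_eq IntE atMost_iff Int_iff)
      then show False using ge[of z] False by linarith
    qed
    have "emeasure ?M {..a} = emeasure lborel ((\<lambda>z::real \<times> real. sqrt (r\<^sup>2 + (norm z)\<^sup>2)) -` {..a} \<inter> space lborel)"
      by (rule emeasure_distr) simp_all
    then have "emeasure ?M {..a} = 0" by (simp only: e emeasure_empty)
    then show ?thesis using False by simp
  qed
  show "emeasure ?M X = emeasure ?N X" if XE: "X \<in> range (\<lambda>a. {..a::real})" for X
  proof -
    obtain a where X: "X = {..a}" using XE by blast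
    have N1: "emeasure ?N {..a} = (\<integral>\<^sup>+u. ennreal (2 * pi * u) * indicator {r..a} u \<partial>lborel)"
      by (subst emeasure_density) (auto intro!: nn_integral_cong simp: indicator_def)
    show ?thesis
    proof (cases "r \<le> a")
      case True
      have "(\<integral>\<^sup>+u. ennreal (2 * pi * u) * indicator {r..a} u \<partial>lborel) = ennreal (pi * a\<^sup>2 - pi * r\<^sup>2)"
        using True r by (intro nn_integral_FTC_Icc) (auto intro!: derivative_eq_intros)
      then show ?thesis unfolding X M1 N1 using True by (simp add: right_diff_distrib)
    next
      case False
      then have "{r..a} = {}" by simp
      then show ?thesis unfolding X M1 N1 using False by simp
    qed
  qed
  show "Int_stable (range (\<lambda>a. {..a::real}))" by (auto simp: Int_stable_def)
  show "sets ?M = sigma_sets UNIV (range (\<lambda>a. {..a::real}))"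
    by (simp add: borel_eq_atMost)
  show "sets ?N = sigma_sets UNIV (range (\<lambda>a. {..a::real}))"
    by (simp add: borel_eq_atMost)
  show "emeasure ?M {..real i} \<noteq> \<infinity>" for i by (simp add: M1)
  show "(\<Union>i. {..real i}) = UNIV" using real_arch_simple by auto
qed auto

text \<open>This is the integral of a radial function with profile G over a plane at distance r from
  the origin: in polar coordinates, with u the distance from the origin of the whole space, the area
  element is 2 pi u du.\<close>

definition tail_mass :: "(real \<Rightarrow> ennreal) \<Rightarrow> real \<Rightarrow> ennreal" where
  "tail_mass G r = (\<integral>\<^sup>+u. ennreal (2 * pi * u) * indicator {r..} u * G u \<partial>lborel)"

lemma nn_integral_slice:
  fixes T :: "'b::euclidean_space \<Rightarrow> 'a::euclidean_space \<times> (real \<times> real)"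
  assumes T: "linear T" "\<And>x. norm (T x) = norm x" and dim: "DIM('b) = DIM('a) + 2"
    and [measurable]: "H \<in> borel_measurable borel" "G \<in> borel_measurable borel"
  shows "(\<integral>\<^sup>+x. H (fst (T x)) * G (norm x) \<partial>lborel) = (\<integral>\<^sup>+s. H s * tail_mass G (norm s) \<partial>lborel)"
proof -
  have [measurable]: "(fst :: 'a \<times> (real \<times> real) \<Rightarrow> 'a) \<in> borel_measurable borel"
    by (intro borel_measurable_continuous_onI continuous_intros)
  have "(\<integral>\<^sup>+x. H (fst (T x)) * G (norm x) \<partial>lborel) = (\<integral>\<^sup>+x. (\<lambda>c. H (fst c) * G (norm c)) (T x) \<partial>lborel)"
    by (simp add: T(2))
  also have "\<dots> = (\<integral>\<^sup>+c. H (fst c) * G (norm c) \<partial>(lborel :: ('a \<times> (real \<times> real)) measure))"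
    by (rule nn_integral_lborel_isometry[OF T, where f="\<lambda>c. H (fst c) * G (norm c)"]) (simp_all add: dim)
  also have "\<dots> = (\<integral>\<^sup>+c. H (fst c) * G (norm c) \<partial>((lborel :: 'a measure) \<Otimes>\<^sub>M (lborel :: (real \<times> real) measure)))"
    by (simp only: lborel_prod)
  also have "\<dots> = (\<integral>\<^sup>+s. \<integral>\<^sup>+z. H s * G (norm (s, z)) \<partial>(lborel :: (real \<times> real) measure) \<partial>lborel)"
  proof -
    have "(\<lambda>c. H (fst c) * G (norm c)) \<in> borel_measurable ((lborel :: 'a measure) \<Otimes>\<^sub>M (lborel :: (real \<times> real) measure))"
      unfolding lborel_prod by simp
    from sigma_finite_measure.nn_integral_fst[OF sigma_finite_lborel this] show ?thesis by simp
  qed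
  also have "\<dots> = (\<integral>\<^sup>+s. H s * tail_mass G (norm s) \<partial>lborel)"
  proof (rule nn_integral_cong)
    fix s :: 'a
    have "(\<integral>\<^sup>+z. H s * G (norm (s, z)) \<partial>(lborel :: (real \<times> real) measure)) = H s * (\<integral>\<^sup>+z. G (sqrt ((norm s)\<^sup>2 + (norm z)\<^sup>2)) \<partial>(lborel :: (real \<times> real) measure))"
      unfolding norm_Pair by (rule nn_integral_cmult) measurable
    also have "(\<integral>\<^sup>+z. G (sqrt ((norm s)\<^sup>2 + (norm z)\<^sup>2)) \<partial>(lborel :: (real \<times> real) measure))
       = (\<integral>\<^sup>+u. G u \<partial>distr (lborel :: (real \<times> real) measure) borel (\<lambda>z. sqrt ((norm s)\<^sup>2 + (norm z)\<^sup>2)))"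
      by (subst nn_integral_distr) simp_all
    also have "\<dots> = tail_mass G (norm s)"
      unfolding plane_radial_law[OF norm_ge_zero] tail_mass_def by (subst nn_integral_density) simp_all
    finally show "(\<integral>\<^sup>+z. H s * G (norm (s, z)) \<partial>(lborel :: (real \<times> real) measure)) = H s * tail_mass G (norm s)" .
  qed
  finally show ?thesis .
qed

text \<open>The Householder reflection along a - b.\<close>

lemma reflection_exists:
  fixes a b :: "'b::euclidean_space"
  assumes ab: "norm a = norm b"
  obtains S where "linear S" "\<And>x. norm (S x) = norm x" "\<And>x y. S x \<bullet> S y = x \<bullet> y" "S a = b"
proof (cases "a = b")
  case True
  show ?thesis by (rule that[of "\<lambda>x. x"]) (simp_all add: True linear_ident)
next
  case False
  define w where "w = a - b"
  define k where "k = w \<bullet> w"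
  have k: "k \<noteq> 0" using False by (simp add: k_def w_def)
  define S where "S z = z - (2 * (z \<bullet> w) / k) *\<^sub>R w" for z
  have lin: "linear S"
    unfolding S_def by (intro linearI) (simp_all add: algebra_simps inner_add_left add_divide_distrib)
  have inn: "S x \<bullet> S y = x \<bullet> y" for x y
  proof -
    have "S x \<bullet> S y = x \<bullet> y - 2 * (y \<bullet> w) / k * (x \<bullet> w) - 2 * (x \<bullet> w) / k * (y \<bullet> w) + 2 * (x \<bullet> w) / k * (2 * (y \<bullet> w) / k) * k"
      by (simp add: S_def inner_diff_left inner_diff_right k_def[symmetric] inner_commute[of w y])
    also have "\<dots> = x \<bullet> y" using k by simp
    finally show ?thesis .
  qed
  have "a \<bullet> a = b \<bullet> b" using ab by (simp add: dot_square_norm)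
  then have "2 * (a \<bullet> w) = k"
    unfolding k_def w_def by (simp add: inner_diff_left inner_diff_right inner_commute[of b a])
  then have "S a = b" using k by (simp add: S_def w_def)
  then show ?thesis using that[OF lin _ inn] inn by (simp add: norm_eq_sqrt_inner)
qed

lemma nn_integral_inner_radial:
  fixes e e' :: "'b::euclidean_space"
  assumes "norm e = norm e'" and [measurable]: "h \<in> borel_measurable borel" "G \<in> borel_measurable borel"
  shows "(\<integral>\<^sup>+x. h (e \<bullet> x) * G (norm x) \<partial>lborel) = (\<integral>\<^sup>+x. h (e' \<bullet> x) * G (norm x) \<partial>lborel)"
proof -
  obtain S where S: "linear S" "\<And>x. norm (S x) = norm x" "\<And>x y. S x \<bullet> S y = x \<bullet> y" "S e = e'"
    using reflection_exists[OF assms(1)] by metis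
  have "(\<integral>\<^sup>+x. h (e' \<bullet> x) * G (norm x) \<partial>lborel) = (\<integral>\<^sup>+x. (\<lambda>y. h (e' \<bullet> y) * G (norm y)) (S x) \<partial>lborel)"
    by (rule nn_integral_lborel_isometry[symmetric, OF S(1,2) refl, where f="\<lambda>y. h (e' \<bullet> y) * G (norm y)"]) measurable
  also have "\<dots> = (\<integral>\<^sup>+x. h (e \<bullet> x) * G (norm x) \<partial>lborel)"
    by (simp add: S(2,3) S(4)[symmetric])
  finally show ?thesis by simp
qed

text \<open>If both halves exceed \<open>\<rho> / 2\<close> in direction e, the sum exceeds
  \<open>\<rho>\<close>; by independence and equality of laws the square of the probability in
  question is 0.\<close>

lemma (in prob_space) indep_halves_tail:
  fixes Y1 Y2 :: "'a \<Rightarrow> 'b::euclidean_space"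
  assumes ind: "indep_var borel Y1 borel Y2" and same: "distr M borel Y2 = distr M borel Y1"
    and null: "prob {\<omega>\<in>space M. \<rho> < e \<bullet> (Y1 \<omega> + Y2 \<omega>)} = 0"
  shows "prob {\<omega>\<in>space M. \<rho> / 2 < e \<bullet> Y1 \<omega>} = 0"
proof -
  have [measurable]: "Y1 \<in> borel_measurable M" "Y2 \<in> borel_measurable M"
    using indep_var_rv1[OF ind] indep_var_rv2[OF ind] by auto
  let ?A = "{x. \<rho> / 2 < e \<bullet> x}"
  have [measurable]: "?A \<in> sets borel" by measurable
  have d: "measure (distr M borel Y) ?A = prob {\<omega>\<in>space M. \<rho> / 2 < e \<bullet> Y \<omega>}" if [measurable]: "Y \<in> borel_measurable M" for Y
    by (subst measure_distr) (auto intro!: arg_cong[where f=prob])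
  have "prob {\<omega>\<in>space M. \<rho> / 2 < e \<bullet> Y2 \<omega>} = prob {\<omega>\<in>space M. \<rho> / 2 < e \<bullet> Y1 \<omega>}"
    using d[of Y1] d[of Y2] same by simp
  moreover have "prob {\<omega>\<in>space M. Y1 \<omega> \<in> ?A \<and> Y2 \<omega> \<in> ?A} = prob {\<omega>\<in>space M. Y1 \<omega> \<in> ?A} * prob {\<omega>\<in>space M. Y2 \<omega> \<in> ?A}"
    by (rule prob_indep_random_variable[OF ind]) simp_all
  moreover have "prob {\<omega>\<in>space M. Y1 \<omega> \<in> ?A \<and> Y2 \<omega> \<in> ?A} \<le> prob {\<omega>\<in>space M. \<rho> < e \<bullet> (Y1 \<omega> + Y2 \<omega>)}"
    by (rule finite_measure_mono) (auto simp: inner_add_right)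
  ultimately have "prob {\<omega>\<in>space M. \<rho> / 2 < e \<bullet> Y1 \<omega>} * prob {\<omega>\<in>space M. \<rho> / 2 < e \<bullet> Y1 \<omega>} \<le> 0" using null by simp
  then show ?thesis using measure_nonneg[of M "{\<omega>\<in>space M. \<rho> / 2 < e \<bullet> Y1 \<omega>}"]
    by (simp add: mult_le_0_iff order_antisym_conv)
qed

lemma levy_process_halves:
  assumes lp: "levy_process M X" and t: "0 < t"
  shows "prob_space.indep_var M borel (X (t / 2)) borel (\<lambda>\<omega>. X t \<omega> - X (t / 2) \<omega>)"
    and "distr M borel (\<lambda>\<omega>. X t \<omega> - X (t / 2) \<omega>) = distr M borel (X (t / 2))"
proof -
  interpret prob_space M using lp by (simp add: levy_process_def)
  let ?s = "\<lambda>i::nat. if i = 0 then t / 2 else t"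
  let ?D = "\<lambda>i \<omega>. if i = 0 then X (?s 0) \<omega> else X (?s i) \<omega> - X (?s (i - 1)) \<omega>"
  have "indep_vars (\<lambda>_. borel) ?D {0..1}"
    using lp t unfolding levy_process_def by (elim conjE) (drule spec[of _ "1::nat"], drule spec[of _ ?s], simp)
  then have iv: "indep_vars (\<lambda>_. borel) ?D {0, 1}" by (simp add: atLeast0_atMost_Suc insert_commute)
  have "indep_var borel ((\<lambda>f. f 0) \<circ> (\<lambda>\<omega>. restrict (\<lambda>i. ?D i \<omega>) {0::nat})) borel ((\<lambda>f. f 1) \<circ> (\<lambda>\<omega>. restrict (\<lambda>i. ?D i \<omega>) {1::nat}))"
    by (rule indep_var_compose[OF indep_var_restrict[OF iv]]) auto
  then show "indep_var borel (X (t / 2)) borel (\<lambda>\<omega>. X t \<omega> - X (t / 2) \<omega>)" by (simp add: comp_def)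
  have "\<forall>s t. 0 \<le> s \<and> s \<le> t \<longrightarrow> distr M borel (\<lambda>\<omega>. X t \<omega> - X s \<omega>) = distr M borel (X (t - s))"
    using lp unfolding levy_process_def by blast
  from this[rule_format, of "t / 2" t] t
  show "distr M borel (\<lambda>\<omega>. X t \<omega> - X (t / 2) \<omega>) = distr M borel (X (t / 2))" by simp
qed

lemma levy_process_rv: "levy_process M X \<Longrightarrow> 0 \<le> t \<Longrightarrow> X t \<in> borel_measurable M"
  by (simp add: levy_process_def)

text \<open>Halving the time halves the bound, so at time t / 2^m the pairing with
  \<open>\<xi>\<close> is of order 2^-m and 1 - exp (- t \<open>\<Psi>\<close> / 2^m) of order 4^-m.
  Multiplying by 2^m leaves t \<open>\<Psi>\<close> of order 2^-m for every m.\<close>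

lemma levy_process_unbounded:
  fixes X :: "real \<Rightarrow> 'w \<Rightarrow> 'a::euclidean_space"
  assumes lp: "levy_process M X" and t: "0 < t"
    and ch: "\<And>\<tau> \<xi>. 0 \<le> \<tau> \<Longrightarrow> (\<integral>\<omega>. cis (\<xi> \<bullet> X \<tau> \<omega>) \<partial>M) = complex_of_real (exp (- (\<tau> * \<Psi> \<xi>)))"
    and pos: "\<And>\<xi>. 0 \<le> \<Psi> \<xi>"
    and bnd: "AE \<omega> in M. norm (X t \<omega>) \<le> r"
  shows "\<Psi> \<xi> = 0"
proof -
  interpret prob_space M using lp by (simp add: levy_process_def)
  have Xm[measurable]: "0 \<le> \<tau> \<Longrightarrow> X \<tau> \<in> borel_measurable M" for \<tau> using levy_process_rv[OF lp] .
  have null: "prob {\<omega>\<in>space M. norm e * r / 2 ^ m < e \<bullet> X (t / 2 ^ m) \<omega>} = 0" for e m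
  proof (induction m)
    case 0
    have "AE \<omega> in M. \<not> norm e * r < e \<bullet> X t \<omega>"
      using bnd
    proof eventually_elim
      case (elim \<omega>)
      have "e \<bullet> X t \<omega> \<le> norm e * norm (X t \<omega>)" by (rule norm_cauchy_schwarz)
      also have "\<dots> \<le> norm e * r" using elim by (rule mult_left_mono) simp
      finally show ?case by simp
    qed
    then have "prob {\<omega>\<in>space M. norm e * r < e \<bullet> X t \<omega>} = 0"
      using t by (subst prob_Collect_eq_0) simp_all
    then show ?case by simp
  next
    case (Suc m)
    have tm: "0 < t / 2 ^ m" using t by simp
    have e1: "t / 2 ^ m / 2 = t / 2 ^ Suc m" "norm e * r / 2 ^ m / 2 = norm e * r / 2 ^ Suc m" by simp_all
    have "prob {\<omega>\<in>space M. norm e * r / 2 ^ m / 2 < e \<bullet> X (t / 2 ^ m / 2) \<omega>} = 0"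
      by (rule indep_halves_tail[OF levy_process_halves[OF lp tm]]) (use Suc in simp)
    then show ?case by (simp only: e1)
  qed
  define C where "C = (norm \<xi> * r)\<^sup>2 / 2"
  \<comment> \<open>The lower bound y / (1 + y) for 1 - exp (-y), with the denominator enlarged to 1
    + t * \<open>\<Psi> \<xi>\<close>, makes the left-hand side independent of m.\<close>
  have key: "t * \<Psi> \<xi> / (1 + t * \<Psi> \<xi>) \<le> C * (1 / 2) ^ m" for m
  proof -
    let ?\<tau> = "t / 2 ^ m" and ?\<rho> = "norm \<xi> * r / 2 ^ m"
    have t0: "0 \<le> ?\<tau>" using t by simp
    note Xm[OF t0, measurable]
    have a1: "AE \<omega> in M. \<not> ?\<rho> < \<xi> \<bullet> X ?\<tau> \<omega>"
      using null[of \<xi> m] by (subst (asm) prob_Collect_eq_0) simp_all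
    have a2: "AE \<omega> in M. \<not> ?\<rho> < - \<xi> \<bullet> X ?\<tau> \<omega>"
      using null[of "- \<xi>" m] by (subst (asm) prob_Collect_eq_0) simp_all
    have ic: "integrable M (\<lambda>\<omega>. cis (\<xi> \<bullet> X ?\<tau> \<omega>))" by (rule integrable_const_bound[where B=1]) simp_all
    have icos: "integrable M (\<lambda>\<omega>. cos (\<xi> \<bullet> X ?\<tau> \<omega>))" by (rule integrable_const_bound[where B=1]) simp_all
    have "exp (- (?\<tau> * \<Psi> \<xi>)) = Re (\<integral>\<omega>. cis (\<xi> \<bullet> X ?\<tau> \<omega>) \<partial>M)" using ch[OF t0, of \<xi>] by simp
    also have "\<dots> = (\<integral>\<omega>. cos (\<xi> \<bullet> X ?\<tau> \<omega>) \<partial>M)" using ic by (simp add: integral_Re[symmetric] del: integral_Re)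
    finally have "1 - exp (- (?\<tau> * \<Psi> \<xi>)) = (\<integral>\<omega>. 1 - cos (\<xi> \<bullet> X ?\<tau> \<omega>) \<partial>M)" using icos by (simp add: prob_space)
    also have "\<dots> \<le> (\<integral>\<omega>. ?\<rho>\<^sup>2 / 2 \<partial>M)"
    proof (rule integral_mono_AE)
      show "AE \<omega> in M. 1 - cos (\<xi> \<bullet> X ?\<tau> \<omega>) \<le> ?\<rho>\<^sup>2 / 2"
        using a1 a2
      proof eventually_elim
        case (elim \<omega>)
        then have "\<bar>\<xi> \<bullet> X ?\<tau> \<omega>\<bar> \<le> ?\<rho>" by (simp add: abs_le_iff)
        then have "(\<xi> \<bullet> X ?\<tau> \<omega>)\<^sup>2 \<le> ?\<rho>\<^sup>2" by (metis abs_ge_zero order_trans abs_of_nonneg abs_le_square_iff)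
        then show ?case using one_minus_cos_le[of "\<xi> \<bullet> X ?\<tau> \<omega>"] by linarith
      qed
    qed (use icos in simp_all)
    also have "\<dots> = ?\<rho>\<^sup>2 / 2" by (simp add: prob_space)
    finally have 1: "1 - exp (- (?\<tau> * \<Psi> \<xi>)) \<le> ?\<rho>\<^sup>2 / 2" .
    define y where "y = ?\<tau> * \<Psi> \<xi>"
    have y0: "0 \<le> y" unfolding y_def by (rule mult_nonneg_nonneg[OF t0 pos])
    have y1: "y \<le> t * \<Psi> \<xi>"
    proof -
      have "?\<tau> \<le> t" using t by (simp add: divide_le_eq)
      then show ?thesis unfolding y_def using pos by (rule mult_right_mono)
    qed
    have "exp (- y) \<le> 1 / (1 + y)"
      using exp_ge_add_one_self[of y] y0 by (simp add: exp_minus field_simps)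
    then have "y / (1 + y) \<le> 1 - exp (- y)" using y0 by (simp add: field_simps)
    moreover have "y / (1 + t * \<Psi> \<xi>) \<le> y / (1 + y)" using y0 y1 by (intro divide_left_mono) auto
    ultimately have "y / (1 + t * \<Psi> \<xi>) \<le> ?\<rho>\<^sup>2 / 2" using 1 unfolding y_def by linarith
    then have "2 ^ m * (y / (1 + t * \<Psi> \<xi>)) \<le> 2 ^ m * (?\<rho>\<^sup>2 / 2)" by (intro mult_left_mono) simp_all
    moreover have "2 ^ m * (y / (1 + t * \<Psi> \<xi>)) = t * \<Psi> \<xi> / (1 + t * \<Psi> \<xi>)" by (simp add: y_def)
    moreover have "2 ^ m * (?\<rho>\<^sup>2 / 2) = C * (1 / 2) ^ m"
      by (simp add: C_def power_divide power2_eq_square)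
    ultimately show ?thesis by (simp only:)
  qed
  have "(\<lambda>m. C * (1 / 2) ^ m) \<longlonglongrightarrow> C * 0" by (intro tendsto_intros LIMSEQ_power_zero) simp
  then have "t * \<Psi> \<xi> / (1 + t * \<Psi> \<xi>) \<le> C * 0" by (rule LIMSEQ_le_const) (use key in blast)
  then have "t * \<Psi> \<xi> / (1 + t * \<Psi> \<xi>) \<le> 0" by simp
  moreover have "0 < 1 + t * \<Psi> \<xi>" using t pos[of \<xi>] by (intro add_pos_nonneg) simp_all
  ultimately have "t * \<Psi> \<xi> \<le> 0" by (simp add: divide_le_0_iff)
  then show ?thesis using t pos[of \<xi>] by (simp add: mult_le_0_iff)
qed

section \<open>The theorem\<close>

lemma tail_mass_antimono: "r \<le> s \<Longrightarrow> tail_mass G s \<le> tail_mass G r"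
  unfolding tail_mass_def by (intro nn_integral_mono mult_right_mono mult_left_mono) (auto simp: indicator_def)

lemma tail_mass_split:
  assumes [measurable]: "G \<in> borel_measurable borel" and "a \<le> x"
  shows "tail_mass G a = (\<integral>\<^sup>+u. ennreal (2 * pi * u) * indicator {a..x} u * G u \<partial>lborel) + tail_mass G x"
proof -
  have "tail_mass G a = (\<integral>\<^sup>+u. ennreal (2 * pi * u) * indicator {a..x} u * G u + ennreal (2 * pi * u) * indicator {x..} u * G u \<partial>lborel)"
    unfolding tail_mass_def
  proof (rule nn_integral_cong_AE)
    show "AE u in lborel. ennreal (2 * pi * u) * indicator {a..} u * G u =
        ennreal (2 * pi * u) * indicator {a..x} u * G u + ennreal (2 * pi * u) * indicator {x..} u * G u"
      using AE_lborel_singleton[of x] by eventually_elim (use assms(2) in \<open>auto simp: indicator_def\<close>)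
  qed
  also have "\<dots> = (\<integral>\<^sup>+u. ennreal (2 * pi * u) * indicator {a..x} u * G u \<partial>lborel) + tail_mass G x"
    unfolding tail_mass_def by (rule nn_integral_add) measurable
  finally show ?thesis .
qed

text \<open>Relative to a fixed a < r the tail at x is a finite constant minus the integral of a
  continuous function from a to x, so the fundamental theorem of calculus applies.\<close>

lemma tail_mass_deriv:
  fixes q :: "real \<Rightarrow> real"
  defines "G \<equiv> \<lambda>u. ennreal (if 0 < u then q u else 0)"
  assumes Gm[measurable]: "G \<in> borel_measurable borel" and q0: "\<And>u. 0 \<le> q u" and cont: "continuous_on {0<..} q"
    and fin: "\<And>r. 0 < r \<Longrightarrow> tail_mass G r < \<infinity>" and r: "0 < r"
  shows "((\<lambda>r. enn2real (tail_mass G r)) has_real_derivative - (2 * pi * r * q r)) (at r)"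
proof -
  define a where "a = r / 2"
  define b where "b = 2 * r"
  have ab: "0 < a" "a < r" "r < b" using r by (auto simp: a_def b_def)
  let ?f = "\<lambda>u. 2 * pi * u * q u"
  have cf: "continuous_on {a..b} ?f"
    by (intro continuous_intros continuous_on_subset[OF cont]) (use ab in auto)
  have eq: "enn2real (tail_mass G x) = enn2real (tail_mass G a) - integral {a..x} ?f" if x: "a \<le> x" "x \<le> b" for x
  proof -
    have "(\<integral>\<^sup>+u. ennreal (2 * pi * u) * indicator {a..x} u * G u \<partial>lborel) = (\<integral>\<^sup>+u. ennreal (?f u * indicator {a..x} u) \<partial>lborel)"
    proof (rule nn_integral_cong)
      fix u :: real
      show "ennreal (2 * pi * u) * indicator {a..x} u * G u = ennreal (?f u * indicator {a..x} u)"
      proof (cases "u \<in> {a..x}")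
        case True
        then have "0 < u" using ab by auto
        then show ?thesis using True q0[of u] by (simp add: G_def ennreal_mult)
      qed simp
    qed
    also have "\<dots> = ennreal (integral {a..x} ?f)"
    proof -
      have c: "continuous_on {a..x} ?f" using cf by (rule continuous_on_subset) (use x in auto)
      have i: "set_integrable lborel {a..x} ?f" by (rule borel_integrable_atLeastAtMost'[OF c])
      have "(\<integral>u. ?f u * indicator {a..x} u \<partial>lborel) = integral {a..x} ?f"
        using set_borel_integral_eq_integral(2)[OF i] by (simp add: set_lebesgue_integral_def mult.commute)
      moreover have "integrable lborel (\<lambda>u. ?f u * indicator {a..x} u)"
        using i by (simp add: set_integrable_def mult.commute)
      ultimately show ?thesis
        using nn_integral_eq_integral[of lborel "\<lambda>u. ?f u * indicator {a..x} u"] q0 ab by (simp add: indicator_def)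
    qed
    finally have e1: "tail_mass G a = ennreal (integral {a..x} ?f) + tail_mass G x"
      using tail_mass_split[OF Gm x(1)] by simp
    have i0: "0 \<le> integral {a..x} ?f"
      by (rule integral_nonneg[OF integrable_continuous_real[OF continuous_on_subset[OF cf]]]) (use x ab q0 in auto)
    have fx: "tail_mass G x < \<infinity>" using fin[of x] x ab by simp
    show ?thesis unfolding e1 using i0 fx by (subst enn2real_plus) auto
  qed
  have "((\<lambda>x. integral {a..x} ?f) has_real_derivative ?f r) (at r within {a..b})"
    using cf ab by (intro integral_has_real_derivative) auto
  then have "((\<lambda>x. integral {a..x} ?f) has_real_derivative ?f r) (at r)"
    using ab by (simp add: at_within_Icc_at)
  from DERIV_diff[OF DERIV_const this]
  have D: "((\<lambda>x. enn2real (tail_mass G a) - integral {a..x} ?f) has_real_derivative - ?f r) (at r)" by simp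
  have ev: "eventually (\<lambda>x. enn2real (tail_mass G a) - integral {a..x} ?f = enn2real (tail_mass G x)) (nhds r)"
  proof -
    have "eventually (\<lambda>x. x \<in> {a<..<b}) (nhds r)" using ab by (intro eventually_nhds_in_open) auto
    then show ?thesis by eventually_elim (rule eq[symmetric], simp_all)
  qed
  show ?thesis by (rule DERIV_cong_ev[THEN iffD1, OF refl ev refl D])
qed

lemma min_sum_le: "finite I \<Longrightarrow> (\<And>i. i \<in> I \<Longrightarrow> 0 \<le> a i) \<Longrightarrow> min 1 (\<Sum>i\<in>I. a i) \<le> (\<Sum>i\<in>I. min 1 (a i :: real))"
proof (induction I rule: finite_induct)
  case (insert i I)
  have "min 1 (a i + sum a I) \<le> min 1 (a i) + min 1 (sum a I)"
  proof -
    have "0 \<le> a i" by (rule insert.prems) simp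
    moreover have "0 \<le> sum a I" by (rule sum_nonneg) (rule insert.prems, simp)
    ultimately show ?thesis by (auto simp: min_def)
  qed
  also have "\<dots> \<le> min 1 (a i) + (\<Sum>i\<in>I. min 1 (a i))" using insert by simp
  finally show ?case using insert.hyps by simp
qed simp

text \<open>Since 2 pi u v(u) = - \<open>\<nu>' u\<close>, the tail mass of v is
  \<open>\<nu>\<close>. The sign of v follows from monotonicity: if \<open>\<nu>'\<close> were
  positive at s, it would stay at least as large to the right of s because - \<open>\<nu>'\<close> /
  r is nonincreasing, and \<open>\<nu> s\<close> would be negative.\<close>

lemma radial_derivative_facts:
  fixes \<nu> \<nu>' :: "real \<Rightarrow> real"
  assumes nu_nonneg: "\<forall>r>0. 0 \<le> \<nu> r"
    and ac: "\<forall>r>0. set_integrable lborel {r<..} \<nu>' \<and> \<nu> r = - set_lebesgue_integral lborel {r<..} \<nu>'"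
    and cond: "\<forall>r s. 0 < r \<and> r \<le> s \<longrightarrow> - \<nu>' s / s \<le> - \<nu>' r / r"
  defines "v \<equiv> \<lambda>r. - \<nu>' r / (2 * pi * r)"
  defines "g \<equiv> \<lambda>u. if 0 < u then v u else 0"
  shows "\<And>r. 0 < r \<Longrightarrow> 0 \<le> v r" and "\<And>r s. 0 < r \<Longrightarrow> r \<le> s \<Longrightarrow> v s \<le> v r"
    and "g \<in> borel_measurable borel"
    and "\<And>r. 0 < r \<Longrightarrow> tail_mass (\<lambda>u. ennreal (g u)) r = ennreal (\<nu> r)"
proof -
  have vw: "v r = (- \<nu>' r / r) / (2 * pi)" for r by (simp add: v_def)
  have int: "integrable lborel (\<lambda>u. indicator {r<..} u * \<nu>' u)" and nu: "\<nu> r = - (\<integral>u. indicator {r<..} u * \<nu>' u \<partial>lborel)"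
    if "0 < r" for r
    using ac that by (auto simp: set_integrable_def set_lebesgue_integral_def)
  show mono: "v s \<le> v r" if "0 < r" "r \<le> s" for r s
    unfolding vw using cond that by (intro divide_right_mono) simp_all
  have neg: "\<nu>' s \<le> 0" if s: "0 < s" for s
  proof (rule ccontr)
    assume "\<not> \<nu>' s \<le> 0"
    then have p: "0 < \<nu>' s" by simp
    have ge: "\<nu>' s \<le> \<nu>' u" if "s < u" for u
    proof -
      have "\<nu>' s / s \<le> \<nu>' u / u" using cond s that by force
      then have "\<nu>' s / s * u \<le> \<nu>' u" using that s by (simp add: field_simps)
      moreover have "\<nu>' s \<le> \<nu>' s / s * u" using p that s by (simp add: field_simps)
      ultimately show ?thesis by linarith
    qed
    have "(\<integral>u. \<nu>' s * indicator {s<..s + 1} u \<partial>lborel) \<le> (\<integral>u. indicator {s<..} u * \<nu>' u \<partial>lborel)"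
    proof (rule integral_mono)
      show "integrable lborel (\<lambda>u. \<nu>' s * indicator {s<..s + 1} u)"
        by (intro integrable_mult_right integrable_real_indicator) auto
      show "\<nu>' s * indicator {s<..s + 1} u \<le> indicator {s<..} u * \<nu>' u" for u
      proof (cases "s < u")
        case True
        then have "0 < \<nu>' u" using ge[OF True] p by linarith
        then show ?thesis using ge[OF True] True by (cases "u \<le> s + 1") simp_all
      qed simp
    qed (rule int[OF s])
    then have "\<nu>' s \<le> - \<nu> s" using nu[OF s] by simp
    moreover have "0 \<le> \<nu> s" using nu_nonneg s by simp
    ultimately show False using p by linarith
  qed
  show v0: "0 \<le> v r" if "0 < r" for r unfolding v_def using neg[OF that] that by (intro divide_nonneg_pos) simp_all
  \<comment> \<open>Integrability gives measurability on half-lines away from 0; those beyond 1 / (n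
    + 1) exhaust the positive axis.\<close>
  have nm: "(\<lambda>u. indicator {0<..} u * \<nu>' u) \<in> borel_measurable borel"
  proof (rule borel_measurable_LIMSEQ_real)
    show "(\<lambda>u. indicator {1 / real (Suc n)<..} u * \<nu>' u) \<in> borel_measurable borel" for n
      using borel_measurable_integrable[OF int[of "1 / real (Suc n)"]] by simp
    fix u :: real
    show "(\<lambda>n. indicator {1 / real (Suc n)<..} u * \<nu>' u) \<longlonglongrightarrow> indicator {0<..} u * \<nu>' u"
    proof (cases "0 < u")
      case True
      obtain N where N: "1 / real (Suc N) < u" using True nat_approx_posE by blast
      have "eventually (\<lambda>n. indicator {1 / real (Suc n)<..} u * \<nu>' u = indicator {0<..} u * \<nu>' u) sequentially"
        using eventually_ge_at_top[of N]
      proof eventually_elim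
        case (elim n)
        have "1 / real (Suc n) \<le> 1 / real (Suc N)" using elim by (simp add: frac_le)
        then have "1 / real (Suc n) < u" using N by linarith
        then show ?case using True by (simp add: indicator_def)
      qed
      then show ?thesis by (rule tendsto_eventually)
    next
      case False
      have "u \<notin> {1 / real (Suc n)<..}" for n
      proof -
        have "0 < 1 / real (Suc n)" by simp
        then show ?thesis using False by (simp only: greaterThan_iff)
      qed
      then show ?thesis using False by simp
    qed
  qed
  have "g = (\<lambda>u. - (indicator {0<..} u * \<nu>' u) / (2 * pi * u))"
    by (auto simp: g_def v_def fun_eq_iff indicator_def)
  also have "\<dots> \<in> borel_measurable borel" using nm by measurable
  finally show "g \<in> borel_measurable borel" .
  show "tail_mass (\<lambda>u. ennreal (g u)) r = ennreal (\<nu> r)" if r: "0 < r" for r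
  proof -
    have "tail_mass (\<lambda>u. ennreal (g u)) r = (\<integral>\<^sup>+u. ennreal (- (indicator {r<..} u * \<nu>' u)) \<partial>lborel)"
      unfolding tail_mass_def
    proof (rule nn_integral_cong_AE)
      show "AE u in lborel. ennreal (2 * pi * u) * indicator {r..} u * ennreal (g u) = ennreal (- (indicator {r<..} u * \<nu>' u))"
        using AE_lborel_singleton[of r]
      proof eventually_elim
        case (elim u)
        show ?case
        proof (cases "r < u")
          case True
          then have u: "0 < u" using r by simp
          have "ennreal (2 * pi * u) * ennreal (v u) = ennreal (2 * pi * u * v u)"
            using u v0[OF u] by (intro ennreal_mult[symmetric]) simp_all
          also have "2 * pi * u * v u = - \<nu>' u" using u by (simp add: v_def)
          finally show ?thesis using True u by (simp add: g_def)
        qed (use elim in simp)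
      qed
    qed
    also have "\<dots> = ennreal (\<integral>u. - (indicator {r<..} u * \<nu>' u) \<partial>lborel)"
    proof (rule nn_integral_eq_integral)
      show "integrable lborel (\<lambda>u. - (indicator {r<..} u * \<nu>' u))" using int[OF r] by simp
      show "AE u in lborel. 0 \<le> - (indicator {r<..} u * \<nu>' u)"
      proof (intro AE_I2)
        fix u :: real show "0 \<le> - (indicator {r<..} u * \<nu>' u)" using neg[of u] r by (cases "r < u") simp_all
      qed
    qed
    also have "(\<integral>u. - (indicator {r<..} u * \<nu>' u) \<partial>lborel) = \<nu> r" using nu[OF r] by simp
    finally show ?thesis .
  qed
qed

lemma linear_isometry_inner:
  fixes f :: "'a::real_inner \<Rightarrow> 'b::real_inner"
  assumes "linear f" "\<And>x. norm (f x) = norm x"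
  shows "f x \<bullet> f y = x \<bullet> y"
  by (simp add: dot_norm linear_add[OF assms(1), symmetric] assms(2))

lemma emeasure_lborel_ball_nonzero: "0 < e \<Longrightarrow> emeasure lborel (ball (x::'a::euclidean_space) e) \<noteq> 0"
  by (simp add: emeasure_ball ennreal_eq_0_iff not_le)

text \<open>A difference at r persists on an open set of radii, and the points with these norms form
  a nonempty open set, which has positive Lebesgue measure.\<close>

lemma radial_continuous_eq:
  fixes p R :: "real \<Rightarrow> real"
  assumes ae: "AE s in (lborel :: 'a::euclidean_space measure). p (norm s) = R (norm s)"
    and p: "continuous_on {0<..} p" and R: "continuous_on {0<..} R" and r: "0 < r"
  shows "p r = R r"
proof (rule ccontr)
  assume ne: "p r \<noteq> R r"
  have "continuous_on {0<..} (\<lambda>x. p x - R x)" by (intro continuous_intros p R)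
  then have "isCont (\<lambda>x. p x - R x) r" using r by (simp add: continuous_on_eq_continuous_at)
  moreover have ne0: "p r - R r \<noteq> 0" using ne by simp
  ultimately have "eventually (\<lambda>x. p x - R x \<noteq> 0) (at r)"
    unfolding isCont_def by (rule tendsto_imp_eventually_ne)
  then have "eventually (\<lambda>x. p x - R x \<noteq> 0) (nhds r)" using ne0 by (simp only: eventually_nhds_conv_at not_False_eq_True simp_thms)
  then obtain U where U: "open U" "r \<in> U" "\<And>x. x \<in> U \<Longrightarrow> p x - R x \<noteq> 0" unfolding eventually_nhds by blast
  let ?A = "(norm :: 'a \<Rightarrow> real) -` U"
  have oA: "open ?A" using U(1) by (intro open_vimage continuous_intros)
  obtain b :: 'a where b: "b \<in> Basis" using nonempty_Basis by blast
  have ne: "?A \<noteq> {}" using U(2) r b by (intro notI) (auto dest!: equals0D[of _ "r *\<^sub>R b"])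
  have "AE s in (lborel :: 'a measure). s \<notin> ?A" using ae by eventually_elim (use U(3) in force)
  then have A0: "emeasure lborel ?A = 0" using oA
    by (subst (asm) AE_iff_measurable[of ?A]) (simp_all add: vimage_def)
  obtain x e where xe: "0 < e" "ball x e \<subseteq> ?A" using oA ne open_contains_ball by blast
  have "emeasure lborel (ball x e) \<le> emeasure lborel ?A" using xe(2) oA by (intro emeasure_mono) simp_all
  then have "emeasure lborel (ball x e) = 0" using A0 by simp
  then show False using emeasure_lborel_ball_nonzero[OF xe(1)] by blast
qed

theorem theorem1p5:
  fixes M :: "'w measure" and X :: "real \<Rightarrow> 'w \<Rightarrow> 'a::euclidean_space"
    and \<psi> :: "real \<Rightarrow> real" and \<nu> \<nu>' :: "real \<Rightarrow> real" and p :: "real \<Rightarrow> real \<Rightarrow> real"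
  assumes dim: "DIM('b::euclidean_space) = DIM('a) + 2"
    and levy: "levy_process M X"
    and exponent: "\<forall>t\<ge>0. \<forall>\<xi>. char_fun_at M X t \<xi> = complex_of_real (exp (- (t * \<psi> (norm \<xi>))))"
    and nu_nonneg: "\<forall>r>0. 0 \<le> \<nu> r"
    and nu_levy: "integrable lborel (\<lambda>x::'a. min 1 (norm x ^ 2) * \<nu> (norm x))"
    and LK: "\<forall>\<xi>::'a. \<psi> (norm \<xi>) = (\<integral>x. (1 - cos (\<xi> \<bullet> x)) * \<nu> (norm x) \<partial>lborel)"
    and nu_infinite: "nn_integral (lborel :: 'a measure) (\<lambda>x. ennreal (\<nu> (norm x))) = \<infinity>"
    and nu_nonincr: "\<forall>r s. 0 < r \<and> r \<le> s \<longrightarrow> \<nu> s \<le> \<nu> r"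
    and nu_abs_cont: "\<forall>r>0. set_integrable lborel {r<..} \<nu>' \<and>
                              \<nu> r = - set_lebesgue_integral lborel {r<..} \<nu>'"
    and nu'_cond: "\<forall>r s. 0 < r \<and> r \<le> s \<longrightarrow> - \<nu>' s / s \<le> - \<nu>' r / r"
    and density: "\<forall>t>0. distributed M lborel (X t) (\<lambda>x. ennreal (p t (norm x)))"
    and density_version: "\<forall>t>0. continuous_on {0<..} (p t)"
  shows "\<exists>(M' :: (real \<Rightarrow> 'b) measure) X' q.
           levy_process M' X' \<and>
           (\<forall>t\<ge>0. \<forall>\<xi>::'b. char_fun_at M' X' t \<xi> = complex_of_real (exp (- (t * \<psi> (norm \<xi>))))) \<and>
           (\<forall>t>0. distributed M' lborel (X' t) (\<lambda>x. ennreal (q t (norm x))) \<and>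
                  (\<forall>r s. 0 < r \<and> r \<le> s \<longrightarrow> q t s \<le> q t r) \<and>
                  (\<forall>r>0. \<exists>D. (p t has_real_derivative D) (at r) \<and> q t r = - 1 / (2 * pi * r) * D) \<and>
                  (\<forall>x::'b. x \<noteq> 0 \<longrightarrow> continuous (at x) (\<lambda>y. q t (norm y))))"
proof -
  interpret M: prob_space M using levy by (simp add: levy_process_def)
  define v where "v r = - \<nu>' r / (2 * pi * r)" for r
  define g where "g u = (if 0 < u then v u else 0)" for u
  let ?Gv = "\<lambda>u. ennreal (g u)"
  note facts = radial_derivative_facts[OF nu_nonneg nu_abs_cont nu'_cond, folded v_def, folded g_def]
  have v0: "0 \<le> v r" if "0 < r" for r using facts(1)[OF that] .
  have vmono: "v s \<le> v r" if "0 < r" "r \<le> s" for r s using facts(2)[OF that] .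
  have gm[measurable]: "g \<in> borel_measurable borel" using facts(3) .
  have gtail: "tail_mass ?Gv r = ennreal (\<nu> r)" if "0 < r" for r using facts(4)[OF that] .
  have g0: "0 \<le> g u" for u using v0 by (simp add: g_def)

  \<comment> \<open>An infinite Levy measure rules out that \<open>\<nu>\<close> vanishes, and a
    positive value of \<open>\<nu>\<close> forces one of \<open>v\<close> through the tail mass.
    This yields the witnesses \<open>r1\<close> and \<open>r0\<close> for the two density
    locales.\<close>
  have "\<exists>r1>0. 0 < \<nu> r1"
  proof (rule ccontr)
    assume nex: "\<not> (\<exists>r1>0. 0 < \<nu> r1)"
    have z: "\<nu> r = 0" if "0 < r" for r using nex nu_nonneg that by force
    have "(\<integral>\<^sup>+x. ennreal (\<nu> (norm x)) \<partial>(lborel :: 'a measure)) = (\<integral>\<^sup>+x. 0 \<partial>(lborel :: 'a measure))"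
    proof (rule nn_integral_cong_AE)
      show "AE x in (lborel :: 'a measure). ennreal (\<nu> (norm x)) = 0"
        using AE_lborel_singleton[of 0] by eventually_elim (simp add: z)
    qed
    then show False using nu_infinite by simp
  qed
  then obtain r1 where r1: "0 < r1" "0 < \<nu> r1" by blast
  have "\<exists>r0>0. 0 < v r0"
  proof (rule ccontr)
    assume nex: "\<not> (\<exists>r0>0. 0 < v r0)"
    have z: "v r = 0" if "0 < r" for r using nex v0[OF that] that by force
    have "g u = 0" for u using z by (simp add: g_def)
    then have "tail_mass ?Gv r1 = 0" by (simp add: tail_mass_def)
    then show False using gtail[OF r1(1)] r1(2) by simp
  qed
  then obtain r0 where r0: "0 < r0" "0 < v r0" by blast
  interpret N: radial_levy_density \<nu> "TYPE('a)" r1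
    using nu_nonneg nu_nonincr nu_levy r1 by unfold_locales simp_all

  \<comment> \<open>Mutually inverse isometries identify the larger space with the product of the
    smaller one and a plane. \<open>fst (T x)\<close> is the projection, and pairing with
    \<open>f (\<eta>, 0)\<close> sees nothing but it.\<close>
  obtain f :: "'a \<times> (real \<times> real) \<Rightarrow> 'b" and T where T: "linear f" "linear T" "\<And>x. norm (f x) = norm x" "\<And>y. norm (T y) = norm y"
     "\<And>x. T (f x) = x" "\<And>y. f (T y) = y"
    by (rule isomorphisms_UNIV_UNIV[where 'M="'a \<times> (real \<times> real)" and 'N='b]) (use dim in simp_all)
  have Tm[measurable]: "T \<in> borel_measurable borel"
    using T(2) by (simp add: borel_measurable_continuous_onI linear_continuous_on linear_conv_bounded_linear)
  have fstm[measurable]: "(fst :: 'a \<times> (real \<times> real) \<Rightarrow> 'a) \<in> borel_measurable borel"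
    by (intro borel_measurable_continuous_onI continuous_intros)
  have fin: "f (\<eta>, 0) \<bullet> x = \<eta> \<bullet> fst (T x)" for \<eta> x
    using linear_isometry_inner[OF T(1,3), of "(\<eta>, 0)" "T x"] T(6)[of x] by (simp add: inner_prod_def)
  have nf: "norm (f (\<eta>, 0)) = norm \<eta>" for \<eta> by (simp add: T(3) norm_Pair)

  \<comment> \<open>Rotation invariance replaces \<open>\<xi>\<close> by a vector of equal norm
    coming from the smaller space; integrating out the plane then turns \<open>v\<close> into
    \<open>\<nu>\<close>.\<close>
  have lift: "(\<integral>\<^sup>+x. h (\<xi> \<bullet> x) * ?Gv (norm x) \<partial>lborel) = (\<integral>\<^sup>+s. h (\<eta> \<bullet> s) * ennreal (N.V s) \<partial>lborel)"
    if n: "norm \<xi> = norm \<eta>" and [measurable]: "h \<in> borel_measurable borel" for h :: "real \<Rightarrow> ennreal" and \<xi> :: 'b and \<eta> :: 'a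
  proof -
    have "(\<integral>\<^sup>+x. h (\<xi> \<bullet> x) * ?Gv (norm x) \<partial>lborel) = (\<integral>\<^sup>+x. h (f (\<eta>, 0) \<bullet> x) * ?Gv (norm x) \<partial>lborel)"
      by (rule nn_integral_inner_radial) (simp_all add: n nf)
    also have "\<dots> = (\<integral>\<^sup>+x. h (\<eta> \<bullet> fst (T x)) * ?Gv (norm x) \<partial>lborel)" by (simp only: fin)
    also have "\<dots> = (\<integral>\<^sup>+s. h (\<eta> \<bullet> s) * tail_mass ?Gv (norm s) \<partial>lborel)"
      by (rule nn_integral_slice[OF T(2,4) dim, where H="\<lambda>s. h (\<eta> \<bullet> s)"]) simp_all
    also have "\<dots> = (\<integral>\<^sup>+s. h (\<eta> \<bullet> s) * ennreal (N.V s) \<partial>lborel)"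
    proof (rule nn_integral_cong_AE)
      show "AE s in lborel. h (\<eta> \<bullet> s) * tail_mass ?Gv (norm s) = h (\<eta> \<bullet> s) * ennreal (N.V s)"
        using AE_lborel_singleton[of 0] by eventually_elim (simp add: gtail N.V_def)
    qed
    finally show ?thesis .
  qed

  obtain ea :: 'a where ea: "ea \<in> Basis" using nonempty_Basis by blast
  have vint: "integrable lborel (\<lambda>x::'b. min 1 ((norm x)\<^sup>2) * v (norm x))"
  proof -
    have e: "min 1 ((norm x)\<^sup>2) * v (norm x) = min 1 ((norm x)\<^sup>2) * g (norm x)" for x :: 'b by (simp add: g_def)
    \<comment> \<open>\<open>lift\<close> treats functions of one direction only. So min 1 |x|^2 is
      dominated by the sum of min 1 (b \<bullet> x)^2 over the basis, and each summand is lifted to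
      the direction \<open>ea\<close>.\<close>
    have part: "(\<integral>\<^sup>+x. ennreal (min 1 ((b \<bullet> x)\<^sup>2)) * ?Gv (norm x) \<partial>lborel) < \<infinity>" if b: "b \<in> Basis" for b :: 'b
    proof -
      have "(\<integral>\<^sup>+x. ennreal (min 1 ((b \<bullet> x)\<^sup>2)) * ?Gv (norm x) \<partial>lborel) = (\<integral>\<^sup>+s. ennreal (min 1 ((ea \<bullet> s)\<^sup>2)) * ennreal (N.V s) \<partial>lborel)"
        by (rule lift[of b ea "\<lambda>y. ennreal (min 1 (y\<^sup>2))"]) (use ea b in simp_all)
      also have "\<dots> \<le> (\<integral>\<^sup>+s. ennreal (min 1 ((norm s)\<^sup>2) * N.V s) \<partial>lborel)"
      proof (rule nn_integral_mono)
        fix s :: 'a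
        have "(ea \<bullet> s)\<^sup>2 \<le> (norm s)\<^sup>2"
          using Basis_le_norm[OF ea, of s] by (intro abs_le_square_iff[THEN iffD1]) (simp add: inner_commute)
        then have "min 1 ((ea \<bullet> s)\<^sup>2) * N.V s \<le> min 1 ((norm s)\<^sup>2) * N.V s"
          using N.V_nonneg by (intro mult_right_mono min.mono) simp_all
        then show "ennreal (min 1 ((ea \<bullet> s)\<^sup>2)) * ennreal (N.V s) \<le> ennreal (min 1 ((norm s)\<^sup>2) * N.V s)"
          using N.V_nonneg[of s] by (subst ennreal_mult[symmetric]) (simp_all add: ennreal_leI)
      qed
      also have "\<dots> < \<infinity>" using N.V_int N.V_nonneg by (subst nn_integral_eq_integral) simp_all
      finally show ?thesis .
    qed
    have "(\<integral>\<^sup>+x. ennreal (min 1 ((norm (x::'b))\<^sup>2) * g (norm x)) \<partial>lborel) \<le> (\<integral>\<^sup>+x. (\<Sum>b\<in>Basis. ennreal (min 1 ((b \<bullet> (x::'b))\<^sup>2)) * ?Gv (norm x)) \<partial>lborel)"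
    proof (rule nn_integral_mono)
      fix x :: 'b
      have "min 1 ((norm x)\<^sup>2) \<le> (\<Sum>b\<in>Basis. min 1 ((b \<bullet> x)\<^sup>2))"
        unfolding norm2_eq_sum_Basis[of x] inner_commute[of x] by (rule min_sum_le) simp_all
      then have "ennreal (min 1 ((norm x)\<^sup>2)) \<le> ennreal (\<Sum>b\<in>Basis. min 1 ((b \<bullet> x)\<^sup>2))" by (rule ennreal_leI)
      then have "ennreal (min 1 ((norm x)\<^sup>2)) * ?Gv (norm x) \<le> ennreal (\<Sum>b\<in>Basis. min 1 ((b \<bullet> x)\<^sup>2)) * ?Gv (norm x)"
        by (rule mult_right_mono) simp
      also have "\<dots> = (\<Sum>b\<in>Basis. ennreal (min 1 ((b \<bullet> x)\<^sup>2)) * ?Gv (norm x))"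
      proof -
        have "ennreal (\<Sum>b\<in>Basis. min 1 ((b \<bullet> x)\<^sup>2)) = (\<Sum>b\<in>Basis. ennreal (min 1 ((b \<bullet> x)\<^sup>2)))"
          by (rule sum_ennreal[symmetric]) simp
        then show ?thesis by (simp only: sum_distrib_right)
      qed
      finally show "ennreal (min 1 ((norm x)\<^sup>2) * g (norm x)) \<le> (\<Sum>b\<in>Basis. ennreal (min 1 ((b \<bullet> x)\<^sup>2)) * ?Gv (norm x))"
        using g0 by (simp add: ennreal_mult)
    qed
    also have "\<dots> = (\<Sum>b\<in>(Basis::'b set). (\<integral>\<^sup>+x. ennreal (min 1 ((b \<bullet> x)\<^sup>2)) * ?Gv (norm x) \<partial>lborel))"
      by (rule nn_integral_sum) simp
    also have "\<dots> < \<infinity>" using part by simp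
    finally have "(\<integral>\<^sup>+x. ennreal (min 1 ((norm (x::'b))\<^sup>2) * g (norm x)) \<partial>lborel) < \<infinity>" .
    then show ?thesis unfolding e using g0 by (intro integrableI_nonneg) simp_all
  qed
  interpret B: radial_levy_density v "TYPE('b)" r0
    by (rule radial_levy_density.intro) (use v0 vmono vint r0 in simp_all)

  have psi: "(\<integral>x. (1 - cos (\<xi> \<bullet> x)) * v (norm x) \<partial>lborel) = \<psi> (norm \<xi>)" for \<xi> :: 'b
  proof -
    define \<eta> where "\<eta> = norm \<xi> *\<^sub>R ea"
    have n: "norm \<xi> = norm \<eta>" using ea by (simp add: \<eta>_def)
    have e: "(1 - cos (\<xi> \<bullet> x)) * v (norm x) = (1 - cos (\<xi> \<bullet> x)) * g (norm x)" for x by (simp add: g_def)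
    have eV: "(1 - cos (\<eta> \<bullet> s)) * \<nu> (norm s) = (1 - cos (\<eta> \<bullet> s)) * N.V s" for s by (simp add: N.V_def)
    have i: "integrable lborel (\<lambda>s. (1 - cos (\<eta> \<bullet> s)) * N.V s)"
    proof (rule Bochner_Integration.integrable_bound[OF integrable_mult_right[OF N.V_int, of "2 + (norm \<eta>)\<^sup>2"]])
      show "AE s in lborel. norm ((1 - cos (\<eta> \<bullet> s)) * N.V s) \<le> norm ((2 + (norm \<eta>)\<^sup>2) * (min 1 ((norm s)\<^sup>2) * N.V s))"
      proof (intro AE_I2)
        fix s :: 'a
        have "(1 - cos (\<eta> \<bullet> s)) * N.V s \<le> ((2 + (norm \<eta>)\<^sup>2) * min 1 ((norm s)\<^sup>2)) * N.V s"
          by (rule mult_right_mono[OF one_minus_cos_inner_bound N.V_nonneg])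
        moreover have "0 \<le> (1 - cos (\<eta> \<bullet> s)) * N.V s" using N.V_nonneg by simp
        ultimately show "norm ((1 - cos (\<eta> \<bullet> s)) * N.V s) \<le> norm ((2 + (norm \<eta>)\<^sup>2) * (min 1 ((norm s)\<^sup>2) * N.V s))"
          by (simp only: real_norm_def mult.assoc[symmetric])
      qed
    qed simp
    have em: "ennreal ((1 - cos y) * z) = ennreal (1 - cos y) * ennreal z" if "0 \<le> z" for y z
      using that by (intro ennreal_mult) simp_all
    have "(\<integral>\<^sup>+x. ennreal ((1 - cos (\<xi> \<bullet> x)) * g (norm x)) \<partial>lborel) = (\<integral>\<^sup>+x. ennreal (1 - cos (\<xi> \<bullet> x)) * ?Gv (norm x) \<partial>lborel)"
      by (simp only: em g0)
    also have "\<dots> = (\<integral>\<^sup>+s. ennreal (1 - cos (\<eta> \<bullet> s)) * ennreal (N.V s) \<partial>lborel)"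
      by (rule lift[OF n, of "\<lambda>y. ennreal (1 - cos y)"]) simp
    also have "\<dots> = (\<integral>\<^sup>+s. ennreal ((1 - cos (\<eta> \<bullet> s)) * N.V s) \<partial>lborel)" by (simp only: em N.V_nonneg)
    also have "\<dots> = ennreal (\<integral>s. (1 - cos (\<eta> \<bullet> s)) * N.V s \<partial>lborel)"
      by (rule nn_integral_eq_integral[OF i]) (simp add: N.V_nonneg)
    finally have nn: "(\<integral>\<^sup>+x. ennreal ((1 - cos (\<xi> \<bullet> x)) * g (norm x)) \<partial>lborel) = ennreal (\<integral>s. (1 - cos (\<eta> \<bullet> s)) * N.V s \<partial>lborel)" .
    have "(\<integral>x. (1 - cos (\<xi> \<bullet> x)) * v (norm x) \<partial>lborel) = enn2real (\<integral>\<^sup>+x. ennreal ((1 - cos (\<xi> \<bullet> x)) * g (norm x)) \<partial>lborel)"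
      unfolding e by (rule integral_eq_nn_integral) (simp_all add: g0)
    also have "\<dots> = (\<integral>s. (1 - cos (\<eta> \<bullet> s)) * N.V s \<partial>lborel)"
      unfolding nn by (rule enn2real_ennreal) (simp add: N.V_nonneg)
    also have "\<dots> = \<psi> (norm \<eta>)" using LK by (simp only: eV)
    finally show ?thesis by (simp only: n)
  qed

  obtain M' :: "(real \<Rightarrow> 'b) measure" and X' :: "real \<Rightarrow> (real \<Rightarrow> 'b) \<Rightarrow> 'b" where lp': "levy_process M' X'"
    and ch': "\<And>t \<xi>. 0 \<le> t \<Longrightarrow> char_fun_at M' X' t \<xi> = complex_of_real (exp (- (t * \<psi> (norm \<xi>))))"
    and un': "\<And>t r. 0 \<le> t \<Longrightarrow> radial_decreasing (\<lambda>x. measure M' {\<omega>\<in>space M'. X' t \<omega> \<in> cball x r})"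
    using B.exists_radial_levy_process unfolding psi by blast
  interpret M': prob_space M' using lp' by (simp add: levy_process_def)
  have X'm[measurable]: "X' t \<in> borel_measurable M'" if "0 \<le> t" for t by (rule levy_process_rv[OF lp' that])
  have Xm[measurable]: "X t \<in> borel_measurable M" if "0 \<le> t" for t by (rule levy_process_rv[OF levy that])
  have chX: "(\<integral>\<omega>. cis (\<xi> \<bullet> X \<tau> \<omega>) \<partial>M) = complex_of_real (exp (- (\<tau> * \<psi> (norm \<xi>))))" if "0 \<le> \<tau>" for \<tau> \<xi>
    using exponent that by (simp add: char_fun_at_def)
  have psi0: "0 \<le> \<psi> (norm (\<xi>::'a))" for \<xi>
  proof -
    have eV: "(1 - cos (\<xi> \<bullet> s)) * \<nu> (norm s) = (1 - cos (\<xi> \<bullet> s)) * N.V s" for s by (simp add: N.V_def)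
    have "\<psi> (norm \<xi>) = (\<integral>s. (1 - cos (\<xi> \<bullet> s)) * N.V s \<partial>lborel)" using LK by (simp only: eV)
    also have "0 \<le> \<dots>" by (intro Bochner_Integration.integral_nonneg mult_nonneg_nonneg N.V_nonneg) simp
    finally show ?thesis .
  qed
  have law: "distr M borel (X t) = density lborel (\<lambda>x. ennreal (p t (norm x)))"
    and pm: "(\<lambda>x::'a. ennreal (p t (norm x))) \<in> borel_measurable borel" if "0 < t" for t
  proof -
    have d: "distributed M lborel (X t) (\<lambda>x. ennreal (p t (norm x)))" using density that by simp
    show "(\<lambda>x::'a. ennreal (p t (norm x))) \<in> borel_measurable borel" using distributed_borel_measurable[OF d] by simp
    have "distr M borel (X t) = distr M lborel (X t)" by (rule distr_cong) simp_all
    then show "distr M borel (X t) = density lborel (\<lambda>x. ennreal (p t (norm x)))"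
      using distributed_distr_eq_density[OF d] by simp
  qed
  have no_atom: "emeasure (distr M borel (X t)) {0} = 0" if t: "0 < t" for t
  proof -
    have "emeasure (density lborel (\<lambda>x. ennreal (p t (norm x)))) {0::'a} = (\<integral>\<^sup>+x. ennreal (p t (norm x)) * indicator {0} x \<partial>(lborel :: 'a measure))"
      using pm[OF t] by (intro emeasure_density) simp_all
    also have "\<dots> = (\<integral>\<^sup>+x. 0 \<partial>(lborel :: 'a measure))"
    proof (rule nn_integral_cong_AE)
      show "AE x in (lborel :: 'a measure). ennreal (p t (norm x)) * indicator {0} x = 0"
        using AE_lborel_singleton[of 0] by eventually_elim simp
    qed
    finally show ?thesis unfolding law[OF t] by simp
  qed
  \<comment> \<open>As \<open>f (\<xi>, 0)\<close> has the norm of \<open>\<xi>\<close>, the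
    exponents agree along it. This compares in law two processes that live on unrelated probability
    spaces.\<close>
  have proj: "distr M' borel (\<lambda>\<omega>. fst (T (X' t \<omega>))) = distr M borel (X t)" if t: "0 \<le> t" for t
  proof (rule distr_eq_of_char_eq[OF M'.prob_space_axioms _ M.prob_space_axioms Xm[OF t]])
    note X'm[OF t, measurable]
    show "(\<lambda>\<omega>. fst (T (X' t \<omega>))) \<in> borel_measurable M'" by measurable
    show "(\<integral>\<omega>. cis (\<xi> \<bullet> fst (T (X' t \<omega>))) \<partial>M') = (\<integral>\<omega>. cis (\<xi> \<bullet> X t \<omega>) \<partial>M)" for \<xi>
      using ch'[OF t, of "f (\<xi>, 0)"] by (simp only: chX[OF t] fin[symmetric] nf char_fun_at_def)
  qed
  have main: "\<exists>q::real \<Rightarrow> real. distributed M' lborel (X' t) (\<lambda>x. ennreal (q (norm x))) \<and>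
      (\<forall>r s. 0 < r \<and> r \<le> s \<longrightarrow> q s \<le> q r) \<and>
      (\<forall>r>0. (p t has_real_derivative - (2 * pi * r * q r)) (at r)) \<and> continuous_on {0<..} q" if t: "0 < t" for t
  proof -
    have t2: "0 < t / 2" "0 \<le> t / 2" "0 \<le> t" using t by simp_all
    note X'm[OF t2(2), measurable] X'm[OF t2(3), measurable]
    have bu: "ball_unimodal (distr M' borel (X' \<tau>))" if "0 \<le> \<tau>" for \<tau>
    proof -
      note X'm[OF that, measurable]
      have "measure (distr M' borel (X' \<tau>)) (cball x r) = measure M' {\<omega>\<in>space M'. X' \<tau> \<omega> \<in> cball x r}" for x r
        by (subst measure_distr) (auto intro!: arg_cong[where f="measure M'"])
      then show ?thesis unfolding ball_unimodal_def using un'[OF that] by simp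
    qed
    \<comment> \<open>The two halves are independent with the law of \<open>X' (t / 2)\<close>, so
      the density at time t is a self-convolution.\<close>
    have sum: "(\<lambda>\<omega>. X' (t / 2) \<omega> + (X' t \<omega> - X' (t / 2) \<omega>)) = X' t" by simp
    \<comment> \<open>The origin projects to the origin, which has no mass under the law of
      \<open>X (t / 2)\<close>.\<close>
    have atom': "emeasure (distr M' borel (X' (t / 2))) {0} = 0"
    proof -
      have "emeasure (distr M' borel (X' (t / 2))) {0} = emeasure M' (X' (t / 2) -` {0} \<inter> space M')"
        by (rule emeasure_distr) simp_all
      also have "\<dots> \<le> emeasure M' ((\<lambda>\<omega>. fst (T (X' (t / 2) \<omega>))) -` {0} \<inter> space M')"
        using linear_0[OF T(2)] by (intro emeasure_mono) (auto simp: zero_prod_def)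
      also have "\<dots> = emeasure (distr M' borel (\<lambda>\<omega>. fst (T (X' (t / 2) \<omega>)))) {0}"
        by (rule emeasure_distr[symmetric]) simp_all
      also have "\<dots> = 0" unfolding proj[OF t2(2)] by (rule no_atom[OF t2(1)])
      finally show ?thesis by simp
    qed
    obtain q where q0: "\<And>r. 0 \<le> q r" and qlaw: "distr M' borel (X' t) = density lborel (\<lambda>x. ennreal (q (norm x)))"
      and qm[measurable]: "(\<lambda>x::'b. ennreal (q (norm x))) \<in> borel_measurable borel"
      and qmono: "\<forall>r s. 0 < r \<and> r \<le> s \<longrightarrow> q s \<le> q r" and qcont: "continuous_on {0<..} q"
      using M'.unimodal_sum_density[OF levy_process_halves[OF lp' t] bu[OF t2(2)] atom'] bu[OF t2(3)] unfolding sum by blast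
    \<comment> \<open>Continuity of q, and with it measurability, is available on the positive axis
      only, so the profile is cut off there.\<close>
    define G where "G u = ennreal (if 0 < u then q u else 0)" for u
    have Gm[measurable]: "G \<in> borel_measurable borel"
    proof -
      have "(\<lambda>u. if u \<in> {0<..} then q u else 0) \<in> borel_measurable borel"
        by (rule borel_measurable_continuous_on_if[OF _ qcont]) simp_all
      then show ?thesis unfolding G_def[abs_def] by simp
    qed
    define R where "R = tail_mass G"
    have Rm: "(\<lambda>s::'a. R (norm s)) \<in> borel_measurable borel"
    proof -
      have "(\<lambda>s::'a. \<integral>\<^sup>+u. ennreal (2 * pi * u) * (if norm s \<le> u then 1 else 0) * G u \<partial>lborel) \<in> borel_measurable borel"
        by measurable
      moreover have "indicator {r..} u = (if r \<le> u then 1 else 0 :: ennreal)" for r u :: real by simp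
      ultimately show ?thesis unfolding R_def tail_mass_def by (simp only:)
    qed
    have slice: "distr M borel (X t) = density lborel (\<lambda>s. R (norm s))"
    proof (rule measure_eqI)
      fix A assume "A \<in> sets (distr M borel (X t))"
      then have [measurable]: "A \<in> sets borel" by simp
      have "emeasure (distr M borel (X t)) A = emeasure (distr M' borel (\<lambda>\<omega>. fst (T (X' t \<omega>)))) A" by (simp only: proj[OF t2(3)])
      also have "\<dots> = (\<integral>\<^sup>+\<omega>. indicator A (fst (T (X' t \<omega>))) \<partial>M')"
        by (subst nn_integral_indicator[symmetric], simp, subst nn_integral_distr) simp_all
      also have "\<dots> = (\<integral>\<^sup>+x. indicator A (fst (T x)) \<partial>distr M' borel (X' t))"
        by (rule nn_integral_distr[symmetric]) simp_all
      also have "\<dots> = (\<integral>\<^sup>+x. ennreal (q (norm x)) * indicator A (fst (T x)) \<partial>lborel)"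
        unfolding qlaw by (rule nn_integral_density) simp_all
      also have "\<dots> = (\<integral>\<^sup>+x. indicator A (fst (T x)) * G (norm x) \<partial>lborel)"
      proof (rule nn_integral_cong_AE)
        show "AE x in lborel. ennreal (q (norm x)) * indicator A (fst (T x)) = indicator A (fst (T x)) * G (norm x)"
          using AE_lborel_singleton[of 0] by eventually_elim (simp add: G_def mult.commute)
      qed
      also have "\<dots> = (\<integral>\<^sup>+s. indicator A s * R (norm s) \<partial>lborel)"
        unfolding R_def by (rule nn_integral_slice[OF T(2,4) dim]) simp_all
      also have "\<dots> = emeasure (density lborel (\<lambda>s. R (norm s))) A"
        using Rm by (subst emeasure_density) (simp_all add: mult.commute)
      finally show "emeasure (distr M borel (X t)) A = emeasure (density lborel (\<lambda>s. R (norm s))) A" .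
    qed simp
    have ae: "AE s in (lborel :: 'a measure). ennreal (p t (norm s)) = R (norm s)"
      using slice unfolding law[OF t]
      by (subst (asm) sigma_finite_measure.density_unique_iff[OF sigma_finite_lborel]) (use pm[OF t] Rm in simp_all)
    \<comment> \<open>An infinite value at r would spread over the whole ball of radius r by
      monotonicity, while almost everywhere R is the finite number
      \<open>ennreal (p t (norm s))\<close>.\<close>
    have Rfin: "R r < \<infinity>" if r: "0 < r" for r
    proof (rule ccontr)
      assume "\<not> R r < \<infinity>"
      then have top: "R s = \<infinity>" if "s \<le> r" for s
        using tail_mass_antimono[OF that, of G] by (simp add: R_def less_top[symmetric] top_unique)
      have "AE s in (lborel :: 'a measure). s \<notin> ball 0 r"
        using ae by eventually_elim (use top in force)
      then have "emeasure lborel (ball (0::'a) r) = 0"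
        by (subst (asm) AE_iff_measurable[of "ball 0 r"]) auto
      then show False using emeasure_lborel_ball_nonzero[OF r] by blast
    qed
    txt \<open>The coercion to \<open>ennreal\<close> forgets negative values of \<open>p t\<close>, so \<open>p t\<close> is determined by its law only
      where the density is positive.\<close>
    have Rpos: "R r \<noteq> 0" if r: "0 < r" for r
    proof
      assume z: "R r = 0"
      have zs: "R s = 0" if "r \<le> s" for s using tail_mass_antimono[OF that, of G] z by (simp add: R_def)
      \<comment> \<open>A vanishing tail confines \<open>X t\<close> to a ball. Then
        \<open>\<psi>\<close> is zero on all norms, so \<open>X t\<close> is 0 almost surely, which
        contradicts the absence of atoms.\<close>
      have "AE x in distr M borel (X t). norm x \<le> r"
        unfolding slice
      proof (subst AE_density)
        show "(\<lambda>s::'a. R (norm s)) \<in> borel_measurable lborel" using Rm by simp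
        show "AE s in (lborel :: 'a measure). 0 < R (norm s) \<longrightarrow> norm s \<le> r"
        proof (intro AE_I2 impI)
          fix s :: 'a assume "0 < R (norm s)"
          then show "norm s \<le> r" using zs[of "norm s"] by (cases "r \<le> norm s") auto
        qed
      qed
      then have bd: "AE \<omega> in M. norm (X t \<omega>) \<le> r" by (rule AE_distrD[rotated]) (rule Xm[OF t2(3)])
      have p0: "\<psi> (norm \<xi>) = 0" for \<xi> :: 'a
        using levy_process_unbounded[where \<Psi>="\<lambda>\<xi>. \<psi> (norm \<xi>)", OF levy t _ psi0 bd] chX by blast
      have "distr M borel (X t) = distr M borel (\<lambda>_. 0)"
        by (rule distr_eq_of_char_eq[OF M.prob_space_axioms Xm[OF t2(3)] M.prob_space_axioms])
          (simp_all add: chX[OF t2(3)] p0 M.prob_space)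
      then have "emeasure (distr M borel (X t)) {0} = emeasure (distr M borel (\<lambda>_. 0::'a)) {0}" by (simp only:)
      also have "\<dots> = 1" by (subst emeasure_distr) (simp_all add: M.emeasure_space_1)
      finally show False using no_atom[OF t] by simp
    qed
    define Rr where "Rr r = enn2real (R r)" for r
    have RRr: "R r = ennreal (Rr r)" "0 < Rr r" if r: "0 < r" for r
      using Rfin[OF r] Rpos[OF r] by (auto simp: Rr_def less_top enn2real_positive_iff zero_less_iff_neq_zero)
    have dR: "(Rr has_real_derivative - (2 * pi * r * q r)) (at r)" if r: "0 < r" for r
      unfolding Rr_def R_def G_def
      by (rule tail_mass_deriv[OF _ q0 qcont _ r]) (use Gm Rfin in \<open>simp_all add: G_def[abs_def] R_def\<close>)
    have cR: "continuous_on {0<..} Rr"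
      by (rule continuous_at_imp_continuous_on) (use dR in \<open>auto intro: DERIV_isCont\<close>)
    \<comment> \<open>Positivity of \<open>Rr\<close> removes the ambiguity of the coercion, so the
      two continuous profiles agree almost everywhere and hence at every positive radius.\<close>
    have pR: "p t r = Rr r" if r: "0 < r" for r
    proof (rule radial_continuous_eq[where 'a='a, OF _ _ cR r])
      show "continuous_on {0<..} (p t)" using density_version t by simp
      show "AE s in (lborel :: 'a measure). p t (norm s) = Rr (norm s)"
        using ae AE_lborel_singleton[of 0]
      proof eventually_elim
        case (elim s)
        then have "0 < norm s" by simp
        note RR = RRr[OF this]
        have eq: "ennreal (p t (norm s)) = ennreal (Rr (norm s))" using elim(1) RR(1) by (rule trans)
        show ?case
        proof (cases "0 \<le> p t (norm s)")
          case True
          then show ?thesis using eq RR(2) by (simp add: ennreal_inj)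
        next
          case False
          then have "ennreal (Rr (norm s)) = 0" using eq by (simp add: ennreal_neg)
          then show ?thesis using RR(2) by (simp add: ennreal_eq_0_iff)
        qed
      qed
    qed
    have dp: "(p t has_real_derivative - (2 * pi * r * q r)) (at r)" if r: "0 < r" for r
    proof (rule DERIV_cong_ev[THEN iffD1, OF refl _ refl dR[OF r]])
      have "eventually (\<lambda>x. x \<in> {0<..}) (nhds r)" using r by (intro eventually_nhds_in_open) simp_all
      then show "eventually (\<lambda>x. Rr x = p t x) (nhds r)" by eventually_elim (simp only: pR greaterThan_iff)
    qed
    have dist: "distributed M' lborel (X' t) (\<lambda>x. ennreal (q (norm x)))"
    proof -
      have "distr M' lborel (X' t) = distr M' borel (X' t)" by (rule distr_cong) simp_all
      then have 1: "distr M' lborel (X' t) = density lborel (\<lambda>x. ennreal (q (norm x)))" by (simp only: qlaw)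
      have 2: "(\<lambda>x::'b. ennreal (q (norm x))) \<in> borel_measurable lborel" using qm by simp
      have 3: "X' t \<in> M' \<rightarrow>\<^sub>M lborel" using X'm[OF t2(3)] by simp
      show ?thesis unfolding distributed_def using 1 2 3 by (intro conjI)
    qed
    show ?thesis
      by (rule exI[of _ q], intro conjI allI impI) (rule dist, use qmono in blast, erule dp, rule qcont)
  qed
  have "\<forall>t. \<exists>q::real \<Rightarrow> real. 0 < t \<longrightarrow> distributed M' lborel (X' t) (\<lambda>x. ennreal (q (norm x))) \<and>
      (\<forall>r s. 0 < r \<and> r \<le> s \<longrightarrow> q s \<le> q r) \<and>
      (\<forall>r>0. (p t has_real_derivative - (2 * pi * r * q r)) (at r)) \<and> continuous_on {0<..} q" by (intro allI) (use main in blast)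
  from choice[OF this] obtain q :: "real \<Rightarrow> real \<Rightarrow> real" where qq: "\<forall>t. 0 < t \<longrightarrow> distributed M' lborel (X' t) (\<lambda>x. ennreal (q t (norm x))) \<and>
      (\<forall>r s. 0 < r \<and> r \<le> s \<longrightarrow> q t s \<le> q t r) \<and>
      (\<forall>r>0. (p t has_real_derivative - (2 * pi * r * q t r)) (at r)) \<and> continuous_on {0<..} (q t)" ..
  note q = qq[rule_format, THEN conjunct1]
    qq[rule_format, THEN conjunct2, THEN conjunct1]
    qq[rule_format, THEN conjunct2, THEN conjunct2, THEN conjunct1, rule_format]
    qq[rule_format, THEN conjunct2, THEN conjunct2, THEN conjunct2]
  have D: "\<exists>D. (p t has_real_derivative D) (at r) \<and> q t r = - 1 / (2 * pi * r) * D" if "0 < t" "0 < r" for t r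
    using q(3)[OF that] that by (intro exI[of _ "- (2 * pi * r * q t r)"]) simp
  have C: "continuous (at x) (\<lambda>y. q t (norm y))" if "0 < t" "x \<noteq> 0" for t and x :: 'b
  proof (rule isCont_o2[where g="q t" and f=norm])
    show "isCont norm x" by (intro continuous_intros)
    show "isCont (q t) (norm x)" using q(4)[OF that(1)] that(2) by (simp add: continuous_on_eq_continuous_at)
  qed
  show ?thesis
    by (rule exI[of _ M'], rule exI[of _ X'], rule exI[of _ q], intro conjI allI impI)
      (rule lp', erule ch', erule q(1), erule (1) q(2)[rule_format], erule (1) D, erule (1) C)
qed

end
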